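(* Let $k$ be a field, let $m,t\in\mathbb{N}$ with $m\ge 1$ and $t\ge 3$, and let $n_1=n_2=\dots=n_m=t$. Let $C=C(n_1,\dots,n_m)$ be the cyclic quiver obtained by joining cyclically $m$ linear paths of lengths $n_1,\dots,n_m$, with arrows $\alpha^i_1,\dots,\alpha^i_{n_i}$ forming the $i$-th path, let $I_C=\langle \alpha^m_{n_m}\alpha^1_1,\ \alpha^i_{n_i}\alpha^{i+1}_1,\ i=1,\dots,m-1\rangle$, and let $A=A_C=kC/I_C$. Then $\operatorname{Frobdim}(A)>\dim_k(A)$.
   Context: Quiver: $C(n_1,\dots,n_m)$ is a single oriented cycle with $n_1+\dots+n_m$ vertices, numbered $1,\dots,n_1+\dots+n_m$ in cyclic order, and $n_1+\dots+n_m$ arrows; for $1\le i\le m$ and $1\le j\le n_i$ the arrow $\alpha^i_j$ goes from vertex $n_1+\dots+n_{i-1}+j$ to the next vertex in cyclic order (the last arrow $\alpha^m_{n_m}$ ends at vertex $1$). Thus $\alpha^i_1\cdots\alpha^i_{n_i}$ is a path, followed by $\alpha^{i+1}_1$ (indices $i$ mod $m$), and $I_C$ is generated by the length-2 paths at the $m$ junctions. Paths are composed left to right; the product in $kC$ is concatenation, or $0$ when not composable; $kC$ includes the trivial paths. A nearly Frobenius coproduct on a $k$-algebra $A$ with multiplication $\mu$ is a $k$-linear map $\Delta:A\to A\otimes_k A$ such that $(\Delta\otimes 1)\circ\Delta=(1\otimes\Delta)\circ\Delta$ and $\Delta\circ \mu=(1\otimes \mu)\circ(\Delta\otimes 1)=(\mu\otimes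 1)\circ(1\otimes\Delta)$. The set of all such $\Delta$ is a $k$-vector space $\mathcal{E}$, and $\operatorname{Frobdim}(A)=\dim_k\mathcal{E}$. *)

theory Defs
  imports "Jordan_Normal_Form.Missing_VectorSpace" "Graph_Theory.Arc_Walk" "HOL-Algebra.QuotRing"
begin

text \<open>
  Vector spaces and (not necessarily commutative) algebras over a field \<open>K\<close> are
  \<open>module\<close> records; their dimension is \<open>vectorspace.dim\<close>. In records that only serve as
  vector spaces the ring fields \<open>mult\<close> and \<open>one\<close> carry no meaning.
\<close>

section \<open>Free vector spaces and quotients\<close>

definition free_vs :: "('k, 'r) ring_scheme \<Rightarrow> 'x set \<Rightarrow> ('k, 'x \<Rightarrow> 'k) module" where
  "free_vs K X =
    \<lparr>carrier = {f. range f \<subseteq> carrier K \<and> {x. f x \<noteq> \<zero>\<^bsub>K\<^esub>} \<subseteq> X \<and> finite {x. f x \<noteq> \<zero>\<^bsub>K\<^esub>}},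
     mult = undefined, one = undefined,
     zero = (\<lambda>x. \<zero>\<^bsub>K\<^esub>),
     add = (\<lambda>f g x. f x \<oplus>\<^bsub>K\<^esub> g x),
     smult = (\<lambda>c f x. c \<otimes>\<^bsub>K\<^esub> f x)\<rparr>"

definition free_gen :: "('k, 'r) ring_scheme \<Rightarrow> 'x \<Rightarrow> 'x \<Rightarrow> 'k" where
  "free_gen K x = (\<lambda>y. if y = x then \<one>\<^bsub>K\<^esub> else \<zero>\<^bsub>K\<^esub>)"

text \<open>
  The ring part is that of \<open>M Quot N\<close>; \<open>mult\<close> and \<open>one\<close> are meaningful when \<open>N\<close> is a
  two-sided ideal of an algebra \<open>M\<close>.
\<close>

definition quot_module :: "('k, 'v, 'x) module_scheme \<Rightarrow> 'v set \<Rightarrow> ('k, 'v set) module" where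
  "quot_module M N =
    \<lparr>carrier = carrier (M Quot N), mult = mult (M Quot N), one = one (M Quot N),
     zero = zero (M Quot N), add = add (M Quot N),
     smult = (\<lambda>c X. \<Union>x\<in>X. N +>\<^bsub>M\<^esub> (c \<odot>\<^bsub>M\<^esub> x))\<rparr>"

section \<open>Tensor products over \<open>K\<close>\<close>

definition tensor_rels ::
  "('k, 'r) ring_scheme \<Rightarrow> ('k, 'v, 'x) module_scheme \<Rightarrow> ('k, 'w, 'y) module_scheme
    \<Rightarrow> ('v \<times> 'w \<Rightarrow> 'k) set" where
  "tensor_rels K V W =
    (let F = free_vs K (carrier V \<times> carrier W); \<epsilon> = free_gen K in
      {\<epsilon> (v \<oplus>\<^bsub>V\<^esub> v', w) \<ominus>\<^bsub>F\<^esub> (\<epsilon> (v, w) \<oplus>\<^bsub>F\<^esub> \<epsilon> (v', w)) | v v' w.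
        v \<in> carrier V \<and> v' \<in> carrier V \<and> w \<in> carrier W} \<union>
      {\<epsilon> (v, w \<oplus>\<^bsub>W\<^esub> w') \<ominus>\<^bsub>F\<^esub> (\<epsilon> (v, w) \<oplus>\<^bsub>F\<^esub> \<epsilon> (v, w')) | v w w'.
        v \<in> carrier V \<and> w \<in> carrier W \<and> w' \<in> carrier W} \<union>
      {\<epsilon> (c \<odot>\<^bsub>V\<^esub> v, w) \<ominus>\<^bsub>F\<^esub> (c \<odot>\<^bsub>F\<^esub> \<epsilon> (v, w)) | c v w.
        c \<in> carrier K \<and> v \<in> carrier V \<and> w \<in> carrier W} \<union>
      {\<epsilon> (v, c \<odot>\<^bsub>W\<^esub> w) \<ominus>\<^bsub>F\<^esub> (c \<odot>\<^bsub>F\<^esub> \<epsilon> (v, w)) | c v w.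
        c \<in> carrier K \<and> v \<in> carrier V \<and> w \<in> carrier W})"

definition tensor_null ::
  "('k, 'r) ring_scheme \<Rightarrow> ('k, 'v, 'x) module_scheme \<Rightarrow> ('k, 'w, 'y) module_scheme
    \<Rightarrow> ('v \<times> 'w \<Rightarrow> 'k) set" where
  "tensor_null K V W =
    LinearCombinations.module.span K (free_vs K (carrier V \<times> carrier W)) (tensor_rels K V W)"

definition tensor ::
  "('k, 'r) ring_scheme \<Rightarrow> ('k, 'v, 'x) module_scheme \<Rightarrow> ('k, 'w, 'y) module_scheme
    \<Rightarrow> ('k, ('v \<times> 'w \<Rightarrow> 'k) set) module" where
  "tensor K V W = quot_module (free_vs K (carrier V \<times> carrier W)) (tensor_null K V W)"

definition pure_tensor ::
  "('k, 'r) ring_scheme \<Rightarrow> ('k, 'v, 'x) module_scheme \<Rightarrow> ('k, 'w, 'y) module_scheme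
    \<Rightarrow> 'v \<Rightarrow> 'w \<Rightarrow> ('v \<times> 'w \<Rightarrow> 'k) set" where
  "pure_tensor K V W v w =
    tensor_null K V W +>\<^bsub>free_vs K (carrier V \<times> carrier W)\<^esub> free_gen K (v, w)"

text \<open>
  The linear map \<open>V \<otimes> W \<rightarrow> U\<close> induced by a bilinear map \<open>\<beta>\<close>, computed on a representative
  \<open>\<phi>\<close> of the coset \<open>z\<close>; for bilinear \<open>\<beta>\<close> the value is independent of the choice of \<open>\<phi>\<close>.
\<close>

definition tensor_lift ::
  "('k, 'r) ring_scheme \<Rightarrow> ('k, 'u, 'z) module_scheme \<Rightarrow> ('v \<Rightarrow> 'w \<Rightarrow> 'u)
    \<Rightarrow> ('v \<times> 'w \<Rightarrow> 'k) set \<Rightarrow> 'u" where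
  "tensor_lift K U \<beta> z =
    (let \<phi> = (SOME \<phi>. \<phi> \<in> z) in
      \<Oplus>\<^bsub>U\<^esub>p\<in>{p. \<phi> p \<noteq> \<zero>\<^bsub>K\<^esub>}. \<phi> p \<odot>\<^bsub>U\<^esub> \<beta> (fst p) (snd p))"

text \<open>\<open>tensor_map K V' W' f g\<close> is \<open>f \<otimes> g : V \<otimes> W \<rightarrow> V' \<otimes> W'\<close>.\<close>

definition tensor_map ::
  "('k, 'r) ring_scheme \<Rightarrow> ('k, 'v2, 'x) module_scheme \<Rightarrow> ('k, 'w2, 'y) module_scheme
    \<Rightarrow> ('v \<Rightarrow> 'v2) \<Rightarrow> ('w \<Rightarrow> 'w2) \<Rightarrow> ('v \<times> 'w \<Rightarrow> 'k) set \<Rightarrow> ('v2 \<times> 'w2 \<Rightarrow> 'k) set" where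
  "tensor_map K V' W' f g =
    tensor_lift K (tensor K V' W') (\<lambda>v w. pure_tensor K V' W' (f v) (g w))"

text \<open>\<open>(U \<otimes> V) \<otimes> W \<rightarrow> U \<otimes> (V \<otimes> W)\<close>\<close>

definition tensor_assoc ::
  "('k, 'r) ring_scheme \<Rightarrow> ('k, 'u, 'z) module_scheme \<Rightarrow> ('k, 'v, 'x) module_scheme
    \<Rightarrow> ('k, 'w, 'y) module_scheme \<Rightarrow> (('u \<times> 'v \<Rightarrow> 'k) set \<times> 'w \<Rightarrow> 'k) set
    \<Rightarrow> ('u \<times> ('v \<times> 'w \<Rightarrow> 'k) set \<Rightarrow> 'k) set" where
  "tensor_assoc K U V W =
    (let T = tensor K U (tensor K V W) in
      tensor_lift K T (\<lambda>x w. tensor_lift K T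
        (\<lambda>u v. pure_tensor K U (tensor K V W) u (pure_tensor K V W v w)) x))"

text \<open>\<open>U \<otimes> (V \<otimes> W) \<rightarrow> (U \<otimes> V) \<otimes> W\<close>\<close>

definition tensor_assoc_inv ::
  "('k, 'r) ring_scheme \<Rightarrow> ('k, 'u, 'z) module_scheme \<Rightarrow> ('k, 'v, 'x) module_scheme
    \<Rightarrow> ('k, 'w, 'y) module_scheme \<Rightarrow> ('u \<times> ('v \<times> 'w \<Rightarrow> 'k) set \<Rightarrow> 'k) set
    \<Rightarrow> (('u \<times> 'v \<Rightarrow> 'k) set \<times> 'w \<Rightarrow> 'k) set" where
  "tensor_assoc_inv K U V W =
    (let T = tensor K (tensor K U V) W in
      tensor_lift K T (\<lambda>u x. tensor_lift K T
        (\<lambda>v w. pure_tensor K (tensor K U V) W (pure_tensor K U V u v) w) x))"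

section \<open>Nearly Frobenius coproducts\<close>

definition alg_mult ::
  "('k, 'r) ring_scheme \<Rightarrow> ('k, 'a, 'x) module_scheme \<Rightarrow> ('a \<times> 'a \<Rightarrow> 'k) set \<Rightarrow> 'a" where
  "alg_mult K A = tensor_lift K A (\<lambda>a b. a \<otimes>\<^bsub>A\<^esub> b)"

definition nearly_frobenius ::
  "('k, 'r) ring_scheme \<Rightarrow> ('k, 'a, 'x) module_scheme
    \<Rightarrow> ('a \<Rightarrow> ('a \<times> 'a \<Rightarrow> 'k) set) \<Rightarrow> bool" where
  "nearly_frobenius K A \<Delta> \<longleftrightarrow>
    (let AA = tensor K A A; \<mu> = alg_mult K A;
         \<Delta>_1 = tensor_map K AA A \<Delta> (\<lambda>a. a); id_\<Delta> = tensor_map K A AA (\<lambda>a. a) \<Delta>;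
         \<mu>_1 = tensor_map K A A \<mu> (\<lambda>a. a); id_\<mu> = tensor_map K A A (\<lambda>a. a) \<mu>
     in \<Delta> \<in> LinearCombinations.module_hom K A AA \<and>
        (\<forall>a\<in>carrier A. tensor_assoc K A A A (\<Delta>_1 (\<Delta> a)) = id_\<Delta> (\<Delta> a)) \<and>
        (\<forall>z\<in>carrier AA. \<Delta> (\<mu> z) = id_\<mu> (tensor_assoc K A A A (\<Delta>_1 z))) \<and>
        (\<forall>z\<in>carrier AA. \<Delta> (\<mu> z) = \<mu>_1 (tensor_assoc_inv K A A A (id_\<Delta> z))))"

text \<open>
  A coproduct is a map on \<open>carrier A\<close>; as a HOL function it is made unique by
  extensionality.
\<close>

definition frob_space ::
  "('k, 'r) ring_scheme \<Rightarrow> ('k, 'a, 'x) module_scheme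
    \<Rightarrow> ('k, 'a \<Rightarrow> ('a \<times> 'a \<Rightarrow> 'k) set) module" where
  "frob_space K A =
    \<lparr>carrier = {\<Delta> \<in> extensional (carrier A). nearly_frobenius K A \<Delta>},
     mult = undefined, one = undefined,
     zero = (\<lambda>a\<in>carrier A. \<zero>\<^bsub>tensor K A A\<^esub>),
     add = (\<lambda>\<Delta> \<Delta>'. \<lambda>a\<in>carrier A. \<Delta> a \<oplus>\<^bsub>tensor K A A\<^esub> \<Delta>' a),
     smult = (\<lambda>c \<Delta>. \<lambda>a\<in>carrier A. c \<odot>\<^bsub>tensor K A A\<^esub> \<Delta> a)\<rparr>"

text \<open>
  \<open>vectorspace.dim\<close> is the least size of a finite generating set, hence meaningful only for
  finite-dimensional spaces. For finite-dimensional \<open>A\<close> the space of coproducts, a subspace of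
  \<open>Hom(A, A \<otimes> A)\<close>, is finite-dimensional.
\<close>

definition frobdim :: "('k, 'r) ring_scheme \<Rightarrow> ('k, 'a, 'x) module_scheme \<Rightarrow> nat" where
  "frobdim K A = vectorspace.dim K (frob_space K A)"

section \<open>Path algebras\<close>

text \<open>
  A quiver is a \<open>pre_digraph\<close>. A path is stored with its source and target, so that there
  is one trivial path \<open>(u, [], u)\<close> for every vertex \<open>u\<close>; arrows are listed in the order in
  which they are traversed.
\<close>

definition quiver_paths :: "('v, 'e) pre_digraph \<Rightarrow> ('v \<times> 'e list \<times> 'v) set" where
  "quiver_paths Q = {(u, p, v). pre_digraph.awalk Q u p v}"

definition path_algebra ::
  "('k, 'r) ring_scheme \<Rightarrow> ('v, 'e) pre_digraph \<Rightarrow> ('k, 'v \<times> 'e list \<times> 'v \<Rightarrow> 'k) module" where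
  "path_algebra K Q = (free_vs K (quiver_paths Q))
    \<lparr>mult := (\<lambda>f g z.
        \<Oplus>\<^bsub>K\<^esub>x\<in>{((u, p, v), (u', q, w)). f (u, p, v) \<noteq> \<zero>\<^bsub>K\<^esub> \<and> g (u', q, w) \<noteq> \<zero>\<^bsub>K\<^esub> \<and>
                  v = u' \<and> z = (u, p @ q, w)}.
          f (fst x) \<otimes>\<^bsub>K\<^esub> g (snd x)),
     one := (\<lambda>(u, p, v). if u \<in> verts Q \<and> p = [] \<and> v = u then \<one>\<^bsub>K\<^esub> else \<zero>\<^bsub>K\<^esub>)\<rparr>"

text \<open>
  The quiver \<open>C(n\<^sub>1,\<dots>,n\<^sub>m)\<close>: the pair \<open>(i, j)\<close> is the arrow \<open>\<alpha>\<^sup>i\<^sub>j\<close>, and the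
  vertices are numbered from \<open>1\<close>.
\<close>

definition cyc_tail :: "(nat \<Rightarrow> nat) \<Rightarrow> nat \<times> nat \<Rightarrow> nat" where
  "cyc_tail n a = (\<Sum>i\<in>{1..<fst a}. n i) + snd a"

definition cyc_head :: "nat \<Rightarrow> (nat \<Rightarrow> nat) \<Rightarrow> nat \<times> nat \<Rightarrow> nat" where
  "cyc_head m n a = (if cyc_tail n a = (\<Sum>i\<in>{1..m}. n i) then 1 else cyc_tail n a + 1)"

definition cyc_quiver :: "nat \<Rightarrow> (nat \<Rightarrow> nat) \<Rightarrow> (nat, nat \<times> nat) pre_digraph" where
  "cyc_quiver m n =
    \<lparr>verts = {1..(\<Sum>i\<in>{1..m}. n i)},
     arcs = {(i, j). i \<in> {1..m} \<and> j \<in> {1..n i}},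
     tail = cyc_tail n,
     head = cyc_head m n\<rparr>"

text \<open>The path \<open>ab\<close> of length two, for arrows with \<open>head Q a = tail Q b\<close>.\<close>

definition arrow_pair ::
  "('k, 'r) ring_scheme \<Rightarrow> ('v, 'e) pre_digraph \<Rightarrow> 'e \<Rightarrow> 'e \<Rightarrow> ('v \<times> 'e list \<times> 'v \<Rightarrow> 'k)" where
  "arrow_pair K Q a b = free_gen K (tail Q a, [a, b], head Q b)"

definition cyc_ideal ::
  "('k, 'r) ring_scheme \<Rightarrow> nat \<Rightarrow> (nat \<Rightarrow> nat) \<Rightarrow> (nat \<times> (nat \<times> nat) list \<times> nat \<Rightarrow> 'k) set" where
  "cyc_ideal K m n = Idl\<^bsub>path_algebra K (cyc_quiver m n)\<^esub>
    ({arrow_pair K (cyc_quiver m n) (m, n m) (1, 1)} \<union>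
     {arrow_pair K (cyc_quiver m n) (i, n i) (i + 1, 1) | i. i \<in> {1..<m}})"

definition cyc_algebra ::
  "('k, 'r) ring_scheme \<Rightarrow> nat \<Rightarrow> (nat \<Rightarrow> nat)
    \<Rightarrow> ('k, (nat \<times> (nat \<times> nat) list \<times> nat \<Rightarrow> 'k) set) module" where
  "cyc_algebra K m n = quot_module (path_algebra K (cyc_quiver m n)) (cyc_ideal K m n)"

end

theory Submission
  imports Defs
begin

text \<open>
  Let \<open>A\<close> be a unital algebra. A nearly Frobenius coproduct on \<open>A\<close> is a linear map \<open>\<Delta>\<close> with
  \<open>\<Delta> (a b) = a (\<Delta> b) = (\<Delta> a) b\<close>, where \<open>A\<close> acts on the outer factors of \<open>A \<otimes> A\<close>; coassociativity
  is then automatic (\<open>nearly_frobenius_iff\<close>). Such a map is determined by \<open>z = \<Delta> 1\<close>, which satisfies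
  \<open>a z = z a\<close> for all \<open>a\<close>, and conversely every \<open>z\<close> commuting with \<open>A\<close> in this sense yields the
  coproduct \<open>\<Delta> a = a z\<close>. So linearly independent commuting tensors bound \<open>Frobdim\<close> from below
  (\<open>card_le_frobdim\<close>).

  The algebra of the cyclic quiver is spanned by the paths that stay inside one of the \<open>m\<close> blocks of
  length \<open>t\<close>: \<open>m t\<close> trivial ones, and \<open>t (t + 1) / 2\<close> nontrivial ones in each block. This bounds its
  dimension by \<open>m (t + t (t + 1) / 2)\<close> (\<open>dim_upper_bound\<close>). At a junction, a nontrivial path \<open>x\<close> that
  leaves it and a nontrivial path \<open>y\<close> that enters it give a tensor \<open>x \<otimes> y\<close> which commutes with the
  algebra, because every product that could spoil this passes through the junction and is zero. There
  are \<open>m t\<^sup>2\<close> of these (\<open>junction_tensor_commuting\<close>). A further commuting tensor is the sum of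
  \<open>p\<^sub>j\<^sub>t \<otimes> p\<^sub>0\<^sub>j\<close> over the positions \<open>j\<close> of one block (\<open>block_tensor_commuting\<close>), and all of them are
  linearly independent (\<open>frobdim_lower_bound\<close>). Now \<open>t + t (t + 1) / 2 \<le> t\<^sup>2\<close> amounts to \<open>3 t \<le> t\<^sup>2\<close>,
  which holds for \<open>t \<ge> 3\<close>. For \<open>t = 3\<close> it is an equality, and the additional tensor makes the
  difference.

  To see that the products and tensors behave as they should, the first half provides the universal
  properties: linear maps out of free modules, quotients and tensor products are given by their
  values on generators. Independence is shown with coordinates, which exist on the quotient algebra
  because its ideal is supported on the paths that cross a junction (\<open>I_supported_on_crossing\<close>).
\<close>

section \<open>Linear maps\<close>

abbreviation linear_maps where "linear_maps \<equiv> LinearCombinations.module_hom"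

lemmas lin_add = LinearCombinations.module_hom_add
lemmas lin_smult = LinearCombinations.module_hom_smult

lemma linI:
  assumes "\<And>x. x \<in> carrier V \<Longrightarrow> f x \<in> carrier W"
    and "\<And>x y. x \<in> carrier V \<Longrightarrow> y \<in> carrier V \<Longrightarrow> f (x \<oplus>\<^bsub>V\<^esub> y) = f x \<oplus>\<^bsub>W\<^esub> f y"
    and "\<And>c x. c \<in> carrier K \<Longrightarrow> x \<in> carrier V \<Longrightarrow> f (c \<odot>\<^bsub>V\<^esub> x) = c \<odot>\<^bsub>W\<^esub> f x"
  shows "f \<in> linear_maps K V W"
  using assms by (auto simp: LinearCombinations.module_hom_def)

lemma lin_carrier: "f \<in> linear_maps K V W \<Longrightarrow> x \<in> carrier V \<Longrightarrow> f x \<in> carrier W"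
  by (auto simp: LinearCombinations.module_hom_def)

lemma lin_comp:
  assumes "f \<in> linear_maps K V W" and "g \<in> linear_maps K W U"
  shows "(\<lambda>x. g (f x)) \<in> linear_maps K V U"
  using assms by (auto simp: LinearCombinations.module_hom_def Pi_def)

lemma lin_zero:
  assumes "Module.module K V" and "Module.module K W" and "f \<in> linear_maps K V W"
  shows "f \<zero>\<^bsub>V\<^esub> = \<zero>\<^bsub>W\<^esub>"
proof -
  interpret mod_hom K V W f
    using assms by (simp add: mod_hom_def mod_hom_axioms_def)
  show ?thesis by simp
qed

lemma lin_finsum:
  assumes "Module.module K V" and "Module.module K W" and "f \<in> linear_maps K V W"
    and "g \<in> I \<rightarrow> carrier V"
  shows "f (finsum V g I) = finsum W (\<lambda>i. f (g i)) I"
proof -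
  interpret V: Module.module K V by fact
  interpret W: Module.module K W by fact
  show ?thesis
    using assms(4)
  proof (induct I rule: infinite_finite_induct)
    case (insert i I)
    then have "f (g i) \<in> carrier W" "(\<lambda>i. f (g i)) \<in> I \<rightarrow> carrier W" "finsum V g I \<in> carrier V"
      using lin_carrier[OF assms(3)] by (auto intro: V.finsum_closed)
    with insert show ?case
      by (simp add: lin_add[OF assms(3)])
  qed (simp_all add: lin_zero[OF assms(1-3)])
qed

lemma lin_plus:
  assumes "Module.module K W" and "f \<in> linear_maps K V W" and "g \<in> linear_maps K V W"
  shows "(\<lambda>x. f x \<oplus>\<^bsub>W\<^esub> g x) \<in> linear_maps K V W"
proof -
  interpret W: Module.module K W by fact
  show ?thesis
    using assms(2,3)
    by (intro linI)
      (simp_all add: lin_carrier lin_add lin_smult W.smult_r_distr W.a_ac)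
qed

lemma lin_scaled:
  assumes "Module.module K W" and "f \<in> linear_maps K V W" and "c \<in> carrier K"
  shows "(\<lambda>x. c \<odot>\<^bsub>W\<^esub> f x) \<in> linear_maps K V W"
proof -
  interpret W: Module.module K W by fact
  have *: "d \<odot>\<^bsub>W\<^esub> (c \<odot>\<^bsub>W\<^esub> y) = c \<odot>\<^bsub>W\<^esub> (d \<odot>\<^bsub>W\<^esub> y)" if "d \<in> carrier K" "y \<in> carrier W" for d y
    using that assms(3) by (metis W.smult_assoc1 W.R.m_comm)
  show ?thesis
    using assms(2,3)
    by (intro linI)
      (simp_all add: lin_carrier lin_add lin_smult W.smult_r_distr *)
qed

lemma lin_eq_on_span:
  assumes V: "Module.module K V" and W: "Module.module K W"
    and f: "f \<in> linear_maps K V W" and g: "g \<in> linear_maps K V W"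
    and S: "S \<subseteq> carrier V" "x \<in> LinearCombinations.module.span K V S"
    and eq: "\<And>s. s \<in> S \<Longrightarrow> f s = g s"
  shows "f x = g x"
proof -
  interpret V: Module.module K V by fact
  have "LinearCombinations.submodule K {x \<in> carrier V. f x = g x} V"
    using f g V by (unfold_locales)
      (auto simp: lin_add lin_smult lin_zero[OF V W])
  then have "V.span S \<subseteq> {x \<in> carrier V. f x = g x}"
    using S eq by (intro V.span_is_subset) auto
  then show ?thesis
    using S by auto
qed

lemma lin_span_submodule:
  assumes V: "Module.module K V" and W: "Module.module K W" and f: "f \<in> linear_maps K V W"
    and S: "S \<subseteq> carrier V" "x \<in> LinearCombinations.module.span K V S"
    and N: "LinearCombinations.submodule K N W" and fS: "\<And>s. s \<in> S \<Longrightarrow> f s \<in> N"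
  shows "f x \<in> N"
proof -
  interpret V: Module.module K V by fact
  interpret N: LinearCombinations.submodule K N W by fact
  have "LinearCombinations.submodule K {x \<in> carrier V. f x \<in> N} V"
    using f V by (unfold_locales)
      (auto simp: lin_add lin_smult lin_zero[OF V W])
  then have "V.span S \<subseteq> {x \<in> carrier V. f x \<in> N}"
    using S fS by (intro V.span_is_subset) auto
  then show ?thesis
    using S by auto
qed

section \<open>Free modules\<close>

lemma free_vs_simps [simp]:
  "\<zero>\<^bsub>free_vs K X\<^esub> = (\<lambda>x. \<zero>\<^bsub>K\<^esub>)"
  "f \<oplus>\<^bsub>free_vs K X\<^esub> g = (\<lambda>x. f x \<oplus>\<^bsub>K\<^esub> g x)"
  "c \<odot>\<^bsub>free_vs K X\<^esub> f = (\<lambda>x. c \<otimes>\<^bsub>K\<^esub> f x)"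
  by (simp_all add: free_vs_def)

lemma free_vs_carrier:
  "f \<in> carrier (free_vs K X) \<longleftrightarrow>
    (\<forall>x. f x \<in> carrier K) \<and> {x. f x \<noteq> \<zero>\<^bsub>K\<^esub>} \<subseteq> X \<and> finite {x. f x \<noteq> \<zero>\<^bsub>K\<^esub>}"
  by (auto simp: free_vs_def)

lemma free_vs_val [simp]: "f \<in> carrier (free_vs K X) \<Longrightarrow> f x \<in> carrier K"
  by (simp add: free_vs_carrier)

lemma free_vs_outside: "f \<in> carrier (free_vs K X) \<Longrightarrow> x \<notin> X \<Longrightarrow> f x = \<zero>\<^bsub>K\<^esub>"
  by (auto simp: free_vs_carrier)

lemma free_vs_module:
  assumes "cring K"
  shows "Module.module K (free_vs K X)"
proof -
  interpret K: cring K by fact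
  have closed: "h \<in> carrier (free_vs K X)"
    if "\<And>x. h x \<in> carrier K" "\<And>x. f x = \<zero>\<^bsub>K\<^esub> \<Longrightarrow> g x = \<zero>\<^bsub>K\<^esub> \<Longrightarrow> h x = \<zero>\<^bsub>K\<^esub>"
      "f \<in> carrier (free_vs K X)" "g \<in> carrier (free_vs K X)" for f g h
  proof -
    have "{x. h x \<noteq> \<zero>\<^bsub>K\<^esub>} \<subseteq> {x. f x \<noteq> \<zero>\<^bsub>K\<^esub>} \<union> {x. g x \<noteq> \<zero>\<^bsub>K\<^esub>}"
      using that(2) by auto
    moreover have "finite ({x. f x \<noteq> \<zero>\<^bsub>K\<^esub>} \<union> {x. g x \<noteq> \<zero>\<^bsub>K\<^esub>})"
      "{x. f x \<noteq> \<zero>\<^bsub>K\<^esub>} \<union> {x. g x \<noteq> \<zero>\<^bsub>K\<^esub>} \<subseteq> X"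
      using that(3,4) by (auto simp: free_vs_carrier)
    ultimately show ?thesis
      using that(1) unfolding free_vs_carrier by (meson finite_subset subset_trans)
  qed
  show ?thesis
  proof (rule moduleI)
    show "abelian_group (free_vs K X)"
    proof (rule abelian_groupI)
      fix f g assume fg: "f \<in> carrier (free_vs K X)" "g \<in> carrier (free_vs K X)"
      then show "f \<oplus>\<^bsub>free_vs K X\<^esub> g \<in> carrier (free_vs K X)"
        using closed[of "\<lambda>x. f x \<oplus>\<^bsub>K\<^esub> g x" f g] by auto
    next
      fix f assume f: "f \<in> carrier (free_vs K X)"
      then have "(\<lambda>x. \<ominus>\<^bsub>K\<^esub> f x) \<in> carrier (free_vs K X)"
        using closed[of "\<lambda>x. \<ominus>\<^bsub>K\<^esub> f x" f f] by auto
      with f show "\<exists>g\<in>carrier (free_vs K X). g \<oplus>\<^bsub>free_vs K X\<^esub> f = \<zero>\<^bsub>free_vs K X\<^esub>"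
        by (intro bexI[of _ "\<lambda>x. \<ominus>\<^bsub>K\<^esub> f x"]) (auto simp: K.l_neg)
    qed (auto simp: free_vs_carrier K.a_ac)
  next
    fix c f assume "c \<in> carrier K" "f \<in> carrier (free_vs K X)"
    then show "c \<odot>\<^bsub>free_vs K X\<^esub> f \<in> carrier (free_vs K X)"
      using closed[of "\<lambda>x. c \<otimes>\<^bsub>K\<^esub> f x" f f] by auto
  qed (auto simp: K.l_distr K.r_distr K.m_assoc assms)
qed

lemma free_gen_carrier:
  assumes "cring K" and "x \<in> X"
  shows "free_gen K x \<in> carrier (free_vs K X)"
proof -
  interpret K: cring K by fact
  have "{y. free_gen K x y \<noteq> \<zero>\<^bsub>K\<^esub>} \<subseteq> {x}" by (auto simp: free_gen_def)
  then show ?thesis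
    using assms(2) finite_subset[of _ "{x}"] by (auto simp: free_vs_carrier free_gen_def)
qed

text \<open>
  Induction on the size of the support: each step splits off the value at one point.
\<close>

lemma free_vs_induct [consumes 2, case_names zero add]:
  assumes K: "cring K" and f: "f \<in> carrier (free_vs K X)"
    and zero: "P (\<lambda>x. \<zero>\<^bsub>K\<^esub>)"
    and add: "\<And>c x g. c \<in> carrier K \<Longrightarrow> x \<in> X \<Longrightarrow> g \<in> carrier (free_vs K X) \<Longrightarrow> P g \<Longrightarrow>
      P (c \<odot>\<^bsub>free_vs K X\<^esub> free_gen K x \<oplus>\<^bsub>free_vs K X\<^esub> g)"
  shows "P f"
proof -
  interpret K: cring K by fact
  have "finite {x. f x \<noteq> \<zero>\<^bsub>K\<^esub>}" using f by (simp add: free_vs_carrier)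
  then show ?thesis using f
  proof (induct "{x. f x \<noteq> \<zero>\<^bsub>K\<^esub>}" arbitrary: f rule: finite_induct)
    case empty
    then have "f = (\<lambda>x. \<zero>\<^bsub>K\<^esub>)" by auto
    with zero show ?case by simp
  next
    case (insert x S)
    define g where "g = f(x := \<zero>\<^bsub>K\<^esub>)"
    have S: "S = {x. g x \<noteq> \<zero>\<^bsub>K\<^esub>}" using insert(2,4) by (auto simp: g_def)
    have "x \<in> X" using insert(4,5) by (auto simp: free_vs_carrier)
    have g: "g \<in> carrier (free_vs K X)"
      using insert(1,4,5) S by (auto simp: free_vs_carrier g_def)
    have "f = f x \<odot>\<^bsub>free_vs K X\<^esub> free_gen K x \<oplus>\<^bsub>free_vs K X\<^esub> g"
      using insert(5) by (auto simp: g_def free_gen_def fun_eq_iff)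
    moreover have "P (f x \<odot>\<^bsub>free_vs K X\<^esub> free_gen K x \<oplus>\<^bsub>free_vs K X\<^esub> g)"
      using insert(5) \<open>x \<in> X\<close> g insert(3)[OF S g] by (intro add) auto
    ultimately show ?case by simp
  qed
qed

lemma free_gen_span:
  assumes "cring K"
  shows "LinearCombinations.module.span K (free_vs K X) (free_gen K ` X) = carrier (free_vs K X)"
proof -
  interpret F: Module.module K "free_vs K X" by (rule free_vs_module[OF assms])
  have sub: "free_gen K ` X \<subseteq> carrier (free_vs K X)"
    using free_gen_carrier[OF assms] by auto
  interpret S: LinearCombinations.submodule K "F.span (free_gen K ` X)" "free_vs K X"
    by (rule F.span_is_submodule[OF sub])
  have "f \<in> F.span (free_gen K ` X)" if "f \<in> carrier (free_vs K X)" for f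
    using assms that
  proof (induct rule: free_vs_induct)
    case zero
    then show ?case using S.zero_closed by simp
  next
    case (add c x g)
    have "free_gen K x \<in> F.span (free_gen K ` X)"
      using F.in_own_span[OF sub] add(2) by auto
    then show ?case using add by (intro S.m_closed S.smult_closed)
  qed
  then show ?thesis using F.span_is_subset2[OF sub] by auto
qed

text \<open>
  The linear extension of \<open>g\<close> from the basis \<open>free_gen K x\<close>. It is the sum that occurs in
  \<open>tensor_lift\<close>.
\<close>

definition free_lift ::
  "('k, 'r) ring_scheme \<Rightarrow> ('k, 'u, 'z) module_scheme \<Rightarrow> ('x \<Rightarrow> 'u) \<Rightarrow> ('x \<Rightarrow> 'k) \<Rightarrow> 'u" where
  "free_lift K U g f = (\<Oplus>\<^bsub>U\<^esub>x\<in>{x. f x \<noteq> \<zero>\<^bsub>K\<^esub>}. f x \<odot>\<^bsub>U\<^esub> g x)"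

text \<open>
  The defining sum runs over the support of \<open>f\<close>, which changes from function to function.
  Enlarging it to a set that contains the supports of \<open>f\<close>, \<open>h\<close> and \<open>f + h\<close> makes their
  extensions comparable.
\<close>

lemma free_lift_eq:
  assumes U: "Module.module K U" and g: "\<And>x. x \<in> X \<Longrightarrow> g x \<in> carrier U"
    and f: "f \<in> carrier (free_vs K X)"
    and S: "finite S" "S \<subseteq> X" "{x. f x \<noteq> \<zero>\<^bsub>K\<^esub>} \<subseteq> S"
  shows "free_lift K U g f = (\<Oplus>\<^bsub>U\<^esub>x\<in>S. f x \<odot>\<^bsub>U\<^esub> g x)"
proof -
  interpret U: Module.module K U by fact
  have gS: "x \<in> S \<Longrightarrow> g x \<in> carrier U" for x using g S by auto
  show ?thesis
    unfolding free_lift_def using S g gS f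
    by (intro U.add.finprod_mono_neutral_cong_left) auto
qed

lemma free_lift_hom:
  assumes U: "Module.module K U" and g: "\<And>x. x \<in> X \<Longrightarrow> g x \<in> carrier U"
  shows "free_lift K U g \<in> linear_maps K (free_vs K X) U"
proof -
  interpret U: Module.module K U by fact
  have K: "cring K" ..
  interpret F: Module.module K "free_vs K X" by (rule free_vs_module[OF K])
  note eq = free_lift_eq[where g = g, OF U g]
  have in_X: "{x. f x \<noteq> \<zero>\<^bsub>K\<^esub>} \<subseteq> X" "finite {x. f x \<noteq> \<zero>\<^bsub>K\<^esub>}" if "f \<in> carrier (free_vs K X)" for f
    using that by (auto simp: free_vs_carrier)
  show ?thesis
  proof (rule linI)
    fix f assume f: "f \<in> carrier (free_vs K X)"
    show "free_lift K U g f \<in> carrier U"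
      unfolding free_lift_def using f in_X[OF f] g by (intro U.finsum_closed) auto
  next
    fix f h assume f: "f \<in> carrier (free_vs K X)" and h: "h \<in> carrier (free_vs K X)"
    let ?S = "{x. f x \<noteq> \<zero>\<^bsub>K\<^esub>} \<union> {x. h x \<noteq> \<zero>\<^bsub>K\<^esub>}"
    have S: "finite ?S" "?S \<subseteq> X" using in_X f h by auto
    have g': "x \<in> ?S \<Longrightarrow> g x \<in> carrier U" for x using g S(2) by blast
    have fh: "f \<oplus>\<^bsub>free_vs K X\<^esub> h \<in> carrier (free_vs K X)" using f h by (rule F.a_closed)
    have "{x. (f \<oplus>\<^bsub>free_vs K X\<^esub> h) x \<noteq> \<zero>\<^bsub>K\<^esub>} \<subseteq> ?S" using f h by auto
    from eq[OF _ fh S this] have "free_lift K U g (f \<oplus>\<^bsub>free_vs K X\<^esub> h) =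
      (\<Oplus>\<^bsub>U\<^esub>x\<in>?S. (f x \<oplus>\<^bsub>K\<^esub> h x) \<odot>\<^bsub>U\<^esub> g x)" by simp
    also have "\<dots> = (\<Oplus>\<^bsub>U\<^esub>x\<in>?S. f x \<odot>\<^bsub>U\<^esub> g x \<oplus>\<^bsub>U\<^esub> h x \<odot>\<^bsub>U\<^esub> g x)"
      using f h g' by (intro U.finsum_cong') (auto intro!: U.smult_l_distr)
    also have "\<dots> = (\<Oplus>\<^bsub>U\<^esub>x\<in>?S. f x \<odot>\<^bsub>U\<^esub> g x) \<oplus>\<^bsub>U\<^esub> (\<Oplus>\<^bsub>U\<^esub>x\<in>?S. h x \<odot>\<^bsub>U\<^esub> g x)"
      using f h g' by (intro U.finsum_addf) auto
    also have "\<dots> = free_lift K U g f \<oplus>\<^bsub>U\<^esub> free_lift K U g h"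
      using eq[OF _ f S] eq[OF _ h S] by auto
    finally show "free_lift K U g (f \<oplus>\<^bsub>free_vs K X\<^esub> h) = free_lift K U g f \<oplus>\<^bsub>U\<^esub> free_lift K U g h" .
  next
    fix c f assume c: "c \<in> carrier K" and f: "f \<in> carrier (free_vs K X)"
    let ?S = "{x. f x \<noteq> \<zero>\<^bsub>K\<^esub>}"
    have S: "finite ?S" "?S \<subseteq> X" using in_X f by auto
    have g': "x \<in> ?S \<Longrightarrow> g x \<in> carrier U" for x using g S(2) by blast
    have cf: "c \<odot>\<^bsub>free_vs K X\<^esub> f \<in> carrier (free_vs K X)" using c f by (rule F.smult_closed)
    have "{x. (c \<odot>\<^bsub>free_vs K X\<^esub> f) x \<noteq> \<zero>\<^bsub>K\<^esub>} \<subseteq> ?S" using c by auto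
    from eq[OF _ cf S this] have "free_lift K U g (c \<odot>\<^bsub>free_vs K X\<^esub> f) =
      (\<Oplus>\<^bsub>U\<^esub>x\<in>?S. (c \<otimes>\<^bsub>K\<^esub> f x) \<odot>\<^bsub>U\<^esub> g x)" by simp
    also have "\<dots> = (\<Oplus>\<^bsub>U\<^esub>x\<in>?S. c \<odot>\<^bsub>U\<^esub> (f x \<odot>\<^bsub>U\<^esub> g x))"
      using f c g' by (intro U.finsum_cong') (auto intro!: U.smult_assoc1)
    also have "\<dots> = c \<odot>\<^bsub>U\<^esub> free_lift K U g f"
      unfolding free_lift_def using f c g' S by (intro U.finsum_smult_ldistr[symmetric]) auto
    finally show "free_lift K U g (c \<odot>\<^bsub>free_vs K X\<^esub> f) = c \<odot>\<^bsub>U\<^esub> free_lift K U g f" .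
  qed
qed

lemma free_lift_gen:
  assumes U: "Module.module K U" and g: "g x \<in> carrier U"
  shows "free_lift K U g (free_gen K x) = g x"
proof -
  interpret U: Module.module K U by fact
  have K: "cring K" ..
  have "free_lift K U g (free_gen K x) = (\<Oplus>\<^bsub>U\<^esub>y\<in>{x}. free_gen K x y \<odot>\<^bsub>U\<^esub> g y)"
    using g by (intro free_lift_eq[where X = "{x}"] U free_gen_carrier K) (auto simp: free_gen_def)
  also have "\<dots> = g x" using g by (simp add: free_gen_def)
  finally show ?thesis .
qed

section \<open>Quotient modules\<close>

lemma quot_module_simps:
  "carrier (quot_module M N) = (\<lambda>x. N +>\<^bsub>M\<^esub> x) ` carrier M"
  "\<zero>\<^bsub>quot_module M N\<^esub> = N"
  "X \<oplus>\<^bsub>quot_module M N\<^esub> Y = X <+>\<^bsub>M\<^esub> Y"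
  "c \<odot>\<^bsub>quot_module M N\<^esub> X = (\<Union>x\<in>X. N +>\<^bsub>M\<^esub> (c \<odot>\<^bsub>M\<^esub> x))"
  by (auto simp: quot_module_def FactRing_def A_RCOSETS_def RCOSETS_def a_r_coset_def)

text \<open>
  \<open>quot_module\<close> is defined for arbitrary sets \<open>N\<close>; its operations on cosets are well defined
  when \<open>N\<close> is a submodule.
\<close>

locale module_quotient = Module.module K M for K and M (structure) +
  fixes N
  assumes N: "LinearCombinations.submodule K N M"
begin

sublocale N: LinearCombinations.submodule K N M by (fact N)

lemma N_minus:
  assumes "x \<in> N"
  shows "\<ominus>\<^bsub>M\<^esub> x \<in> N"
proof -
  have x: "x \<in> carrier M" using assms N.subset by auto
  have "(\<ominus>\<^bsub>K\<^esub> \<one>\<^bsub>K\<^esub>) \<odot>\<^bsub>M\<^esub> x \<in> N" using assms by (intro N.smult_closed) auto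
  then show ?thesis using x by (simp add: smult_l_minus)
qed

sublocale abelian_subgroup N M
proof (rule abelian_subgroupI3)
  show "additive_subgroup N M"
  proof (intro additive_subgroup.intro M.add.subgroupI)
    show "N \<noteq> {}" using N.zero_closed by blast
  qed (use N.subset N_minus in \<open>auto simp: a_inv_def[symmetric]\<close>)
qed (rule M.abelian_group_axioms)

abbreviation proj where "proj x \<equiv> N +> x"

lemma proj_eq_iff:
  assumes "x \<in> carrier M" "y \<in> carrier M"
  shows "proj x = proj y \<longleftrightarrow> x \<ominus>\<^bsub>M\<^esub> y \<in> N"
  using a_repr_independence'[of x y] a_rcos_module[of y x] a_rcos_self[of x] assms
  by (auto simp: a_minus_def)

lemma proj_carrier [simp]: "x \<in> carrier M \<Longrightarrow> proj x \<in> carrier (quot_module M N)"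
  by (simp add: quot_module_simps)

lemma proj_add:
  assumes "x \<in> carrier M" "y \<in> carrier M"
  shows "proj x \<oplus>\<^bsub>quot_module M N\<^esub> proj y = proj (x \<oplus>\<^bsub>M\<^esub> y)"
  using assms by (simp add: quot_module_simps a_rcos_sum)

lemma proj_smult:
  assumes "c \<in> carrier K" "x \<in> carrier M"
  shows "c \<odot>\<^bsub>quot_module M N\<^esub> proj x = proj (c \<odot>\<^bsub>M\<^esub> x)"
proof -
  have "proj (c \<odot>\<^bsub>M\<^esub> y) = proj (c \<odot>\<^bsub>M\<^esub> x)" if y: "y \<in> proj x" for y
  proof -
    obtain h where h: "h \<in> N" "y = h \<oplus>\<^bsub>M\<^esub> x" using y by (auto simp: a_r_coset_def r_coset_def)
    then have "y \<in> carrier M" using assms N.subset by auto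
    with h assms N.subset show ?thesis
      by (subst proj_eq_iff) (auto simp: smult_r_distr M.minus_eq M.a_assoc M.r_neg)
  qed
  moreover have "proj x \<noteq> {}" using assms a_rcos_self by blast
  ultimately show ?thesis unfolding quot_module_simps by (intro SUP_eq_const)
qed

lemma proj_zero: "proj \<zero>\<^bsub>M\<^esub> = \<zero>\<^bsub>quot_module M N\<^esub>"
  using N.subset by (simp add: quot_module_simps)

lemma quot_carrier: "X \<in> carrier (quot_module M N) \<longleftrightarrow> (\<exists>x\<in>carrier M. X = proj x)"
  by (auto simp: quot_module_simps)

lemma quot_is_module: "Module.module K (quot_module M N)"
proof (rule moduleI)
  show "abelian_group (quot_module M N)"
  proof (rule abelian_groupI)
    fix X assume "X \<in> carrier (quot_module M N)"
    then obtain x where x: "x \<in> carrier M" "X = proj x" by (auto simp: quot_carrier)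
    then show "\<exists>Y\<in>carrier (quot_module M N). Y \<oplus>\<^bsub>quot_module M N\<^esub> X = \<zero>\<^bsub>quot_module M N\<^esub>"
      by (intro bexI[of _ "proj (\<ominus>\<^bsub>M\<^esub> x)"])
        (auto simp: proj_add M.l_neg quot_carrier simp flip: proj_zero)
  qed (auto simp: quot_carrier proj_add M.a_ac simp flip: proj_zero)
qed (auto simp: quot_carrier proj_add proj_smult smult_l_distr smult_r_distr smult_assoc1
    R.cring_axioms)

lemma proj_hom: "proj \<in> linear_maps K M (quot_module M N)"
  by (rule linI) (auto simp: quot_carrier proj_add proj_smult)

lemma representative:
  assumes "X \<in> carrier (quot_module M N)"
  shows "(SOME x. x \<in> X) \<in> carrier M" "proj (SOME x. x \<in> X) = X"
proof -
  obtain x where x: "x \<in> carrier M" "X = proj x" using assms by (auto simp: quot_carrier)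
  then have "x \<in> X" using a_rcos_self by simp
  then have some: "(SOME x. x \<in> X) \<in> X" by (rule someI)
  have rep: "y \<in> carrier M \<and> proj y = X" if y: "y \<in> X" for y
  proof -
    obtain h where h: "h \<in> N" "y = h \<oplus>\<^bsub>M\<^esub> x" using y x by (auto simp: a_r_coset_def r_coset_def)
    then have "y \<in> carrier M" using x N.subset by auto
    with h x N.subset show ?thesis
      by (auto simp: proj_eq_iff M.minus_eq M.a_assoc M.r_neg)
  qed
  show "(SOME x. x \<in> X) \<in> carrier M" "proj (SOME x. x \<in> X) = X" using rep[OF some] by blast+
qed

text \<open>
  A linear map that kills \<open>N\<close> is constant on the cosets of \<open>N\<close>, so its value at the
  representative picked by \<open>SOME\<close> is the induced map. \<open>tensor_lift\<close> has this form.
\<close>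

lemma
  assumes W: "Module.module K W" and f: "f \<in> linear_maps K M W"
    and null: "\<And>x. x \<in> N \<Longrightarrow> f x = \<zero>\<^bsub>W\<^esub>"
  shows quot_lift_linear: "(\<lambda>X. f (SOME x. x \<in> X)) \<in> linear_maps K (quot_module M N) W"
    and quot_lift_proj: "x \<in> carrier M \<Longrightarrow> f (SOME y. y \<in> proj x) = f x"
proof -
  interpret f: mod_hom K M W f
    using module_axioms W f by (simp add: mod_hom_def mod_hom_axioms_def)
  interpret W: Module.module K W by (rule W)
  have lift: "f (SOME y. y \<in> proj x) = f x" if x: "x \<in> carrier M" for x
  proof -
    let ?y = "SOME y. y \<in> proj x"
    have y: "?y \<in> carrier M" "proj ?y = proj x" by (rule representative[OF proj_carrier[OF x]])+
    then have "f ?y \<ominus>\<^bsub>W\<^esub> f x = \<zero>\<^bsub>W\<^esub>"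
      using null proj_eq_iff[OF y(1) x] f.f_minus[OF y(1) x] by simp
    then show ?thesis using y x by simp
  qed
  then show "x \<in> carrier M \<Longrightarrow> f (SOME y. y \<in> proj x) = f x" .
  show "(\<lambda>X. f (SOME x. x \<in> X)) \<in> linear_maps K (quot_module M N) W"
    by (rule linI) (auto simp: quot_carrier proj_add proj_smult lift)
qed

lemma quot_span:
  assumes "S \<subseteq> carrier M" and "span S = carrier M"
  shows "LinearCombinations.module.span K (quot_module M N) (proj ` S) = carrier (quot_module M N)"
proof -
  interpret Q: Module.module K "quot_module M N" by (rule quot_is_module)
  have sub: "proj ` S \<subseteq> carrier (quot_module M N)" using assms(1) by auto
  have "proj x \<in> Q.span (proj ` S)" if "x \<in> carrier M" for x
  proof (rule lin_span_submodule[OF module_axioms quot_is_module proj_hom assms(1)])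
    show "LinearCombinations.submodule K (Q.span (proj ` S)) (quot_module M N)"
      by (rule Q.span_is_submodule[OF sub])
    show "x \<in> span S" using that assms(2) by simp
    show "proj s \<in> Q.span (proj ` S)" if "s \<in> S" for s
      using Q.in_own_span[OF sub] that by blast
  qed
  then show ?thesis
    using Q.span_is_subset2[OF sub] by (auto simp: quot_carrier)
qed

end

section \<open>Tensor products\<close>

definition bilinear_map ::
  "('k, 'r) ring_scheme \<Rightarrow> ('k, 'v, 'x) module_scheme \<Rightarrow> ('k, 'w, 'y) module_scheme
    \<Rightarrow> ('k, 'u, 'z) module_scheme \<Rightarrow> ('v \<Rightarrow> 'w \<Rightarrow> 'u) \<Rightarrow> bool" where
  "bilinear_map K V W U \<beta> \<longleftrightarrow>
    (\<forall>w\<in>carrier W. (\<lambda>v. \<beta> v w) \<in> linear_maps K V U) \<and>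
    (\<forall>v\<in>carrier V. \<beta> v \<in> linear_maps K W U)"

lemma bilinear_mapI:
  assumes "\<And>w. w \<in> carrier W \<Longrightarrow> (\<lambda>v. \<beta> v w) \<in> linear_maps K V U"
    and "\<And>v. v \<in> carrier V \<Longrightarrow> \<beta> v \<in> linear_maps K W U"
  shows "bilinear_map K V W U \<beta>"
  using assms by (simp add: bilinear_map_def)

lemma bilinear_mapD:
  assumes "bilinear_map K V W U \<beta>"
  shows "w \<in> carrier W \<Longrightarrow> (\<lambda>v. \<beta> v w) \<in> linear_maps K V U"
    and "v \<in> carrier V \<Longrightarrow> \<beta> v \<in> linear_maps K W U"
  using assms by (simp_all add: bilinear_map_def)

lemma bilinear_map_comp:
  assumes "bilinear_map K V W U \<beta>" and "f \<in> linear_maps K V' V" and "g \<in> linear_maps K W' W"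
    and "h \<in> linear_maps K U U'"
  shows "bilinear_map K V' W' U' (\<lambda>v w. h (\<beta> (f v) (g w)))"
proof (rule bilinear_mapI)
  fix w assume "w \<in> carrier W'"
  then have "(\<lambda>v. \<beta> v (g w)) \<in> linear_maps K V U"
    by (rule bilinear_mapD(1)[OF assms(1) lin_carrier[OF assms(3)]])
  then show "(\<lambda>v. h (\<beta> (f v) (g w))) \<in> linear_maps K V' U'"
    by (rule lin_comp[OF lin_comp[OF assms(2)] assms(4)])
next
  fix v assume "v \<in> carrier V'"
  then have "\<beta> (f v) \<in> linear_maps K W U"
    by (rule bilinear_mapD(2)[OF assms(1) lin_carrier[OF assms(2)]])
  then show "(\<lambda>w. h (\<beta> (f v) (g w))) \<in> linear_maps K W' U'"
    by (rule lin_comp[OF lin_comp[OF assms(3)] assms(4)])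
qed

lemma lin_ident: "(\<lambda>x. x) \<in> linear_maps K V V"
  by (simp add: linI)

locale module_pair = V: Module.module K V + W: Module.module K W
  for K :: "('k, 'r) ring_scheme" and V :: "('k, 'v, 'x) module_scheme"
    and W :: "('k, 'w, 'y) module_scheme"
begin

abbreviation F where "F \<equiv> free_vs K (carrier V \<times> carrier W)"
abbreviation T where "T \<equiv> tensor K V W"
abbreviation pt where "pt \<equiv> pure_tensor K V W"

interpretation F: Module.module K F
  by (rule free_vs_module[OF V.R.cring_axioms])

lemma gen_closed: "v \<in> carrier V \<Longrightarrow> w \<in> carrier W \<Longrightarrow> free_gen K (v, w) \<in> carrier F"
  by (intro free_gen_carrier[OF V.R.cring_axioms]) auto

lemma tensor_rels_cases:
  assumes "r \<in> tensor_rels K V W"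
  obtains (add_left) v v' w where "v \<in> carrier V" "v' \<in> carrier V" "w \<in> carrier W"
      "r = free_gen K (v \<oplus>\<^bsub>V\<^esub> v', w) \<ominus>\<^bsub>F\<^esub> (free_gen K (v, w) \<oplus>\<^bsub>F\<^esub> free_gen K (v', w))"
    | (add_right) v w w' where "v \<in> carrier V" "w \<in> carrier W" "w' \<in> carrier W"
      "r = free_gen K (v, w \<oplus>\<^bsub>W\<^esub> w') \<ominus>\<^bsub>F\<^esub> (free_gen K (v, w) \<oplus>\<^bsub>F\<^esub> free_gen K (v, w'))"
    | (smult_left) c v w where "c \<in> carrier K" "v \<in> carrier V" "w \<in> carrier W"
      "r = free_gen K (c \<odot>\<^bsub>V\<^esub> v, w) \<ominus>\<^bsub>F\<^esub> (c \<odot>\<^bsub>F\<^esub> free_gen K (v, w))"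
    | (smult_right) c v w where "c \<in> carrier K" "v \<in> carrier V" "w \<in> carrier W"
      "r = free_gen K (v, c \<odot>\<^bsub>W\<^esub> w) \<ominus>\<^bsub>F\<^esub> (c \<odot>\<^bsub>F\<^esub> free_gen K (v, w))"
  using assms unfolding tensor_rels_def Let_def
  by (elim UnE CollectE exE conjE) (rule that; assumption)+

lemma
  assumes "v \<in> carrier V" and "w \<in> carrier W"
  shows rel_add_left: "v' \<in> carrier V \<Longrightarrow>
      free_gen K (v \<oplus>\<^bsub>V\<^esub> v', w) \<ominus>\<^bsub>F\<^esub> (free_gen K (v, w) \<oplus>\<^bsub>F\<^esub> free_gen K (v', w))
        \<in> tensor_rels K V W"
    and rel_add_right: "w' \<in> carrier W \<Longrightarrow>
      free_gen K (v, w \<oplus>\<^bsub>W\<^esub> w') \<ominus>\<^bsub>F\<^esub> (free_gen K (v, w) \<oplus>\<^bsub>F\<^esub> free_gen K (v, w'))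
        \<in> tensor_rels K V W"
    and rel_smult_left: "c \<in> carrier K \<Longrightarrow>
      free_gen K (c \<odot>\<^bsub>V\<^esub> v, w) \<ominus>\<^bsub>F\<^esub> (c \<odot>\<^bsub>F\<^esub> free_gen K (v, w)) \<in> tensor_rels K V W"
    and rel_smult_right: "c \<in> carrier K \<Longrightarrow>
      free_gen K (v, c \<odot>\<^bsub>W\<^esub> w) \<ominus>\<^bsub>F\<^esub> (c \<odot>\<^bsub>F\<^esub> free_gen K (v, w)) \<in> tensor_rels K V W"
  using assms unfolding tensor_rels_def Let_def
     apply -
     apply (rule UnI1, rule UnI1, rule UnI1, rule CollectI, intro exI conjI; (rule refl | assumption))
    apply (rule UnI1, rule UnI1, rule UnI2, rule CollectI, intro exI conjI; (rule refl | assumption))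
   apply (rule UnI1, rule UnI2, rule CollectI, intro exI conjI; (rule refl | assumption))
  apply (rule UnI2, rule CollectI, intro exI conjI; (rule refl | assumption))
  done

lemma tensor_rels_closed: "tensor_rels K V W \<subseteq> carrier F"
proof
  fix r assume "r \<in> tensor_rels K V W"
  then show "r \<in> carrier F"
    by (cases rule: tensor_rels_cases)
      (simp_all only: F.minus_closed F.a_closed F.smult_closed gen_closed
        V.a_closed W.a_closed V.smult_closed W.smult_closed)
qed

interpretation Q: module_quotient K F "tensor_null K V W"
  unfolding tensor_null_def
  by (intro module_quotient.intro module_quotient_axioms.intro F.module_axioms
      F.span_is_submodule tensor_rels_closed)

lemma tensor_module: "Module.module K T"
  unfolding tensor_def by (rule Q.quot_is_module)

interpretation T: Module.module K T by (rule tensor_module)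

lemma pt_eq: "pt v w = Q.proj (free_gen K (v, w))"
  by (simp add: pure_tensor_def)

lemma pt_closed [simp]: "v \<in> carrier V \<Longrightarrow> w \<in> carrier W \<Longrightarrow> pt v w \<in> carrier T"
  unfolding tensor_def pt_eq by (intro Q.proj_carrier gen_closed)

lemma proj_rel:
  assumes "x \<ominus>\<^bsub>F\<^esub> y \<in> tensor_rels K V W" and "x \<in> carrier F" and "y \<in> carrier F"
  shows "Q.proj x = Q.proj y"
  using assms F.in_own_span[OF tensor_rels_closed]
  by (subst Q.proj_eq_iff) (auto simp: tensor_null_def)

text \<open>
  Each of the four laws is one of the four families of relations of the tensor product.
\<close>

lemma pt_bilinear: "bilinear_map K V W T pt"
proof (intro bilinear_mapI linI)
  fix v v' w assume *: "v \<in> carrier V" "v' \<in> carrier V" "w \<in> carrier W"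
  let ?r = "free_gen K (v, w) \<oplus>\<^bsub>F\<^esub> free_gen K (v', w)"
  have "Q.proj (free_gen K (v \<oplus>\<^bsub>V\<^esub> v', w)) = Q.proj ?r"
    by (rule proj_rel, rule rel_add_left) (use * in \<open>simp_all only: gen_closed F.a_closed F.smult_closed
        V.a_closed W.a_closed V.smult_closed W.smult_closed\<close>)
  also have "\<dots> = pt v w \<oplus>\<^bsub>T\<^esub> pt v' w"
    unfolding tensor_def pt_eq using * by (intro Q.proj_add[symmetric] gen_closed)
  finally show "pt (v \<oplus>\<^bsub>V\<^esub> v') w = pt v w \<oplus>\<^bsub>T\<^esub> pt v' w" by (simp only: pt_eq)
next
  fix v w w' assume *: "v \<in> carrier V" "w \<in> carrier W" "w' \<in> carrier W"
  let ?r = "free_gen K (v, w) \<oplus>\<^bsub>F\<^esub> free_gen K (v, w')"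
  have "Q.proj (free_gen K (v, w \<oplus>\<^bsub>W\<^esub> w')) = Q.proj ?r"
    by (rule proj_rel, rule rel_add_right) (use * in \<open>simp_all only: gen_closed F.a_closed F.smult_closed
        V.a_closed W.a_closed V.smult_closed W.smult_closed\<close>)
  also have "\<dots> = pt v w \<oplus>\<^bsub>T\<^esub> pt v w'"
    unfolding tensor_def pt_eq using * by (intro Q.proj_add[symmetric] gen_closed)
  finally show "pt v (w \<oplus>\<^bsub>W\<^esub> w') = pt v w \<oplus>\<^bsub>T\<^esub> pt v w'" by (simp only: pt_eq)
next
  fix c v w assume *: "c \<in> carrier K" "v \<in> carrier V" "w \<in> carrier W"
  let ?r = "c \<odot>\<^bsub>F\<^esub> free_gen K (v, w)"
  have r: "Q.proj ?r = c \<odot>\<^bsub>T\<^esub> pt v w"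
    unfolding tensor_def pt_eq using * by (intro Q.proj_smult[symmetric] gen_closed)
  have "Q.proj (free_gen K (c \<odot>\<^bsub>V\<^esub> v, w)) = Q.proj ?r"
    by (rule proj_rel, rule rel_smult_left) (use * in \<open>simp_all only: gen_closed F.a_closed F.smult_closed
        V.a_closed W.a_closed V.smult_closed W.smult_closed\<close>)
  with r show "pt (c \<odot>\<^bsub>V\<^esub> v) w = c \<odot>\<^bsub>T\<^esub> pt v w" by (simp only: pt_eq)
  have "Q.proj (free_gen K (v, c \<odot>\<^bsub>W\<^esub> w)) = Q.proj ?r"
    by (rule proj_rel, rule rel_smult_right) (use * in \<open>simp_all only: gen_closed F.a_closed F.smult_closed
        V.a_closed W.a_closed V.smult_closed W.smult_closed\<close>)
  with r show "pt v (c \<odot>\<^bsub>W\<^esub> w) = c \<odot>\<^bsub>T\<^esub> pt v w" by (simp only: pt_eq)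
qed auto

lemma tensor_span:
  "LinearCombinations.module.span K T ((\<lambda>(v, w). pt v w) ` (carrier V \<times> carrier W)) = carrier T"
proof -
  have eq: "(\<lambda>(v, w). pt v w) ` (carrier V \<times> carrier W)
      = Q.proj ` free_gen K ` (carrier V \<times> carrier W)"
    by (auto simp: pt_eq image_image)
  have sub: "free_gen K ` (carrier V \<times> carrier W) \<subseteq> carrier F" using gen_closed by auto
  show ?thesis
    unfolding eq tensor_def by (rule Q.quot_span[OF sub free_gen_span[OF V.R.cring_axioms]])
qed

text \<open>
  Pure tensors span. Almost every identity between maps on tensor products below is checked on
  pure tensors by this rule.
\<close>

lemma tensor_eqI:
  assumes "Module.module K U" and "f \<in> linear_maps K T U" and "g \<in> linear_maps K T U"
    and "\<And>v w. v \<in> carrier V \<Longrightarrow> w \<in> carrier W \<Longrightarrow> f (pt v w) = g (pt v w)"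
    and "z \<in> carrier T"
  shows "f z = g z"
  by (rule lin_eq_on_span[OF tensor_module assms(1-3), of
        "(\<lambda>(v, w). pt v w) ` (carrier V \<times> carrier W)"])
    (use assms(4,5) in \<open>auto simp: tensor_span\<close>)

text \<open>
  Expand the second factor first, with the first one in \<open>S\<close>, and then the first factor. The
  lemma makes tensor products of finite-dimensional spaces finite-dimensional.
\<close>

lemma tensor_span_generators:
  assumes S: "S \<subseteq> carrier V" "V.span S = carrier V" and S': "S' \<subseteq> carrier W" "W.span S' = carrier W"
  shows "T.span ((\<lambda>(v, w). pt v w) ` (S \<times> S')) = carrier T"
proof -
  let ?P = "(\<lambda>(v, w). pt v w) ` (S \<times> S')"
  have sub: "?P \<subseteq> carrier T" using S(1) S'(1) by (auto intro!: pt_closed)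
  have sm: "LinearCombinations.submodule K (T.span ?P) T" by (rule T.span_is_submodule[OF sub])
  have 1: "pt s w \<in> T.span ?P" if s: "s \<in> S" and w: "w \<in> carrier W" for s w
  proof (rule lin_span_submodule[OF W.module_axioms tensor_module _ S'(1) _ sm, of "pt s"])
    show "pt s \<in> linear_maps K W T" using s S by (intro bilinear_mapD[OF pt_bilinear]) auto
    show "w \<in> W.span S'" using w S' by simp
    show "pt s w \<in> T.span ?P" if "w \<in> S'" for w
      using T.in_own_span[OF sub] s that by auto
  qed
  have 2: "pt v w \<in> T.span ?P" if v: "v \<in> carrier V" and w: "w \<in> carrier W" for v w
  proof (rule lin_span_submodule[OF V.module_axioms tensor_module _ S(1) _ sm, of "\<lambda>v. pt v w"])
    show "(\<lambda>v. pt v w) \<in> linear_maps K V T" using w by (intro bilinear_mapD[OF pt_bilinear]) auto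
    show "v \<in> V.span S" using v S by simp
  qed (use 1 w in auto)
  have "T.span ((\<lambda>(v, w). pt v w) ` (carrier V \<times> carrier W)) \<subseteq> T.span ?P"
    using 2 by (intro T.span_is_subset[OF _ sm]) auto
  then show ?thesis
    unfolding tensor_span using T.span_is_subset2[OF sub] by auto
qed

text \<open>
  The linear extension of \<open>\<beta>\<close> to the free module kills the four families of relations, one for
  each law of bilinearity, and hence the submodule that they span.
\<close>

lemma
  assumes U: "Module.module K U" and \<beta>: "bilinear_map K V W U \<beta>"
  shows tensor_lift_linear: "tensor_lift K U \<beta> \<in> linear_maps K T U"
    and tensor_lift_pt: "v \<in> carrier V \<Longrightarrow> w \<in> carrier W \<Longrightarrow> tensor_lift K U \<beta> (pt v w) = \<beta> v w"
proof -
  interpret U: Module.module K U by (rule U)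
  note \<beta>D = bilinear_mapD[OF \<beta>]
  define L where "L = free_lift K U (\<lambda>p. \<beta> (fst p) (snd p))"
  have \<beta>_closed: "\<beta> (fst p) (snd p) \<in> carrier U" if "p \<in> carrier V \<times> carrier W" for p
    using that lin_carrier[OF \<beta>D(2)] by auto
  have L: "L \<in> linear_maps K F U"
    unfolding L_def by (rule free_lift_hom[OF U \<beta>_closed])
  interpret L: mod_hom K F U L
    using L by unfold_locales
  have L_gen: "L (free_gen K (v, w)) = \<beta> v w" if "v \<in> carrier V" "w \<in> carrier W" for v w
    unfolding L_def using \<beta>_closed[of "(v, w)"] that by (subst free_lift_gen[OF U]) auto
  have L_rel: "L r = \<zero>\<^bsub>U\<^esub>" if "r \<in> tensor_rels K V W" for r
    using that
  proof (cases rule: tensor_rels_cases)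
    case (add_left v v' w)
    then show ?thesis
      using lin_add[OF \<beta>D(1)] lin_carrier[OF \<beta>D(2)]
      by (simp del: free_vs_simps add: gen_closed L_gen U.minus_eq U.r_neg)
  next
    case (add_right v w w')
    then show ?thesis
      using lin_add[OF \<beta>D(2)] lin_carrier[OF \<beta>D(2)]
      by (simp del: free_vs_simps add: gen_closed L_gen U.minus_eq U.r_neg)
  next
    case (smult_left c v w)
    then show ?thesis
      using lin_smult[OF \<beta>D(1)] lin_carrier[OF \<beta>D(2)]
      by (simp del: free_vs_simps add: gen_closed L_gen U.minus_eq U.r_neg)
  next
    case (smult_right c v w)
    then show ?thesis
      using lin_smult[OF \<beta>D(2)] lin_carrier[OF \<beta>D(2)]
      by (simp del: free_vs_simps add: gen_closed L_gen U.minus_eq U.r_neg)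
  qed
  have "LinearCombinations.submodule K L.ker F" by (rule L.ker_is_submodule)
  moreover have "tensor_rels K V W \<subseteq> L.ker"
    using L_rel tensor_rels_closed by (auto simp: L.ker_def)
  ultimately have null: "L x = \<zero>\<^bsub>U\<^esub>" if "x \<in> tensor_null K V W" for x
    using that F.span_is_subset[of "tensor_rels K V W" L.ker]
    by (auto simp: tensor_null_def L.ker_def)
  have lift: "tensor_lift K U \<beta> = (\<lambda>z. L (SOME \<phi>. \<phi> \<in> z))"
    by (simp add: fun_eq_iff tensor_lift_def L_def free_lift_def Let_def)
  show "tensor_lift K U \<beta> \<in> linear_maps K T U"
    unfolding lift tensor_def by (rule Q.quot_lift_linear[OF U L null])
  show "tensor_lift K U \<beta> (pt v w) = \<beta> v w" if "v \<in> carrier V" "w \<in> carrier W"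
    unfolding lift pt_eq using that by (simp only: Q.quot_lift_proj[OF U L null] gen_closed L_gen)
qed

end

lemma
  assumes V: "Module.module K V" and W: "Module.module K W"
    and V': "Module.module K V'" and W': "Module.module K W'"
    and f: "f \<in> linear_maps K V V'" and g: "g \<in> linear_maps K W W'"
  shows tensor_map_linear: "tensor_map K V' W' f g \<in> linear_maps K (tensor K V W) (tensor K V' W')"
    and tensor_map_pt: "v \<in> carrier V \<Longrightarrow> w \<in> carrier W \<Longrightarrow>
      tensor_map K V' W' f g (pure_tensor K V W v w) = pure_tensor K V' W' (f v) (g w)"
proof -
  interpret VW: module_pair K V W using V W by (rule module_pair.intro)
  interpret VW': module_pair K V' W' using V' W' by (rule module_pair.intro)
  have "bilinear_map K V W VW'.T (\<lambda>v w. VW'.pt (f v) (g w))"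
    using bilinear_map_comp[OF VW'.pt_bilinear f g lin_ident] .
  from VW.tensor_lift_linear[OF VW'.tensor_module this] VW.tensor_lift_pt[OF VW'.tensor_module this]
  show "tensor_map K V' W' f g \<in> linear_maps K VW.T VW'.T"
    and "v \<in> carrier V \<Longrightarrow> w \<in> carrier W \<Longrightarrow>
      tensor_map K V' W' f g (VW.pt v w) = VW'.pt (f v) (g w)"
    by (simp_all add: tensor_map_def)
qed

locale module_triple = U: Module.module K U + V: Module.module K V + W: Module.module K W
  for K :: "('k, 'r) ring_scheme" and U :: "('k, 'u, 'z) module_scheme"
    and V :: "('k, 'v, 'x) module_scheme" and W :: "('k, 'w, 'y) module_scheme"
begin

interpretation UV: module_pair K U V by unfold_locales
interpretation VW: module_pair K V W by unfold_locales
interpretation UV_W: module_pair K UV.T W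
  by (intro module_pair.intro UV.tensor_module W.module_axioms)
interpretation U_VW: module_pair K U VW.T
  by (intro module_pair.intro VW.tensor_module U.module_axioms)

lemma assoc_inner:
  assumes "w \<in> carrier W"
  shows "bilinear_map K U V U_VW.T (\<lambda>u v. U_VW.pt u (VW.pt v w))"
  using bilinear_map_comp[OF U_VW.pt_bilinear lin_ident bilinear_mapD(1)[OF VW.pt_bilinear assms] lin_ident] .

text \<open>
  Linearity in \<open>w\<close> for fixed \<open>x\<close> compares the lifts of different bilinear maps at the same
  tensor \<open>x\<close>. As all of these lifts are linear in \<open>x\<close>, it suffices to take \<open>x\<close> pure.
\<close>

lemma assoc_outer:
  "bilinear_map K UV.T W U_VW.T
    (\<lambda>x w. tensor_lift K U_VW.T (\<lambda>u v. U_VW.pt u (VW.pt v w)) x)"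
proof -
  note lift = UV.tensor_lift_linear[OF U_VW.tensor_module assoc_inner]
    UV.tensor_lift_pt[OF U_VW.tensor_module assoc_inner]
  note pt = bilinear_mapD[OF VW.pt_bilinear] bilinear_mapD[OF U_VW.pt_bilinear]
  interpret T: Module.module K U_VW.T by (rule U_VW.tensor_module)
  show ?thesis
  proof (intro bilinear_mapI)
    fix w assume w: "w \<in> carrier W"
    then show "(\<lambda>x. tensor_lift K U_VW.T (\<lambda>u v. U_VW.pt u (VW.pt v w)) x)
        \<in> linear_maps K UV.T U_VW.T" by (rule lift)
  next
    fix x assume x: "x \<in> carrier UV.T"
    show "(\<lambda>w. tensor_lift K U_VW.T (\<lambda>u v. U_VW.pt u (VW.pt v w)) x)
        \<in> linear_maps K W U_VW.T"
    proof (rule linI)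
      fix w assume w: "w \<in> carrier W"
      show "tensor_lift K U_VW.T (\<lambda>u v. U_VW.pt u (VW.pt v w)) x \<in> carrier U_VW.T"
        by (rule lin_carrier[OF lift(1)[OF w] x])
    next
      fix w w' assume w: "w \<in> carrier W" "w' \<in> carrier W"
      then have ww: "w \<oplus>\<^bsub>W\<^esub> w' \<in> carrier W" by simp
      show "tensor_lift K U_VW.T (\<lambda>u v. U_VW.pt u (VW.pt v (w \<oplus>\<^bsub>W\<^esub> w'))) x =
          tensor_lift K U_VW.T (\<lambda>u v. U_VW.pt u (VW.pt v w)) x \<oplus>\<^bsub>U_VW.T\<^esub>
          tensor_lift K U_VW.T (\<lambda>u v. U_VW.pt u (VW.pt v w')) x"
        by (rule UV.tensor_eqI[OF U_VW.tensor_module lift(1)[OF ww]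
            lin_plus[OF U_VW.tensor_module lift(1)[OF w(1)] lift(1)[OF w(2)]] _ x])
          (use w ww in \<open>simp add: lift(2) lin_add[OF pt(2)] lin_add[OF pt(4)]\<close>)
    next
      fix c w assume c: "c \<in> carrier K" and w: "w \<in> carrier W"
      then have cw: "c \<odot>\<^bsub>W\<^esub> w \<in> carrier W" by simp
      show "tensor_lift K U_VW.T (\<lambda>u v. U_VW.pt u (VW.pt v (c \<odot>\<^bsub>W\<^esub> w))) x =
          c \<odot>\<^bsub>U_VW.T\<^esub> tensor_lift K U_VW.T (\<lambda>u v. U_VW.pt u (VW.pt v w)) x"
        by (rule UV.tensor_eqI[OF U_VW.tensor_module lift(1)[OF cw]
            lin_scaled[OF U_VW.tensor_module lift(1)[OF w] c] _ x])
          (use c w cw in \<open>simp add: lift(2) lin_smult[OF pt(2)] lin_smult[OF pt(4)]\<close>)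
    qed
  qed
qed

lemma assoc_linear: "tensor_assoc K U V W \<in> linear_maps K UV_W.T U_VW.T"
  unfolding tensor_assoc_def Let_def
  by (rule UV_W.tensor_lift_linear[OF U_VW.tensor_module assoc_outer])

lemma assoc_pt_left:
  assumes "x \<in> carrier UV.T" and "w \<in> carrier W"
  shows "tensor_assoc K U V W (UV_W.pt x w) =
    tensor_lift K U_VW.T (\<lambda>u v. U_VW.pt u (VW.pt v w)) x"
  unfolding tensor_assoc_def Let_def
  using assms by (rule UV_W.tensor_lift_pt[OF U_VW.tensor_module assoc_outer])

lemma assoc_pt:
  assumes "u \<in> carrier U" and "v \<in> carrier V" and "w \<in> carrier W"
  shows "tensor_assoc K U V W (UV_W.pt (UV.pt u v) w) = U_VW.pt u (VW.pt v w)"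
  using assms by (simp add: assoc_pt_left UV.tensor_lift_pt[OF U_VW.tensor_module assoc_inner])

lemma assoc_inv_inner:
  assumes "u \<in> carrier U"
  shows "bilinear_map K V W UV_W.T (\<lambda>v w. UV_W.pt (UV.pt u v) w)"
  using bilinear_map_comp[OF UV_W.pt_bilinear bilinear_mapD(2)[OF UV.pt_bilinear assms] lin_ident lin_ident] .

lemma assoc_inv_outer:
  "bilinear_map K U VW.T UV_W.T
    (\<lambda>u x. tensor_lift K UV_W.T (\<lambda>v w. UV_W.pt (UV.pt u v) w) x)"
proof -
  note lift = VW.tensor_lift_linear[OF UV_W.tensor_module assoc_inv_inner]
    VW.tensor_lift_pt[OF UV_W.tensor_module assoc_inv_inner]
  note pt = bilinear_mapD[OF UV.pt_bilinear] bilinear_mapD[OF UV_W.pt_bilinear]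
  interpret T: Module.module K UV_W.T by (rule UV_W.tensor_module)
  show ?thesis
  proof (intro bilinear_mapI)
    fix u assume "u \<in> carrier U"
    then show "tensor_lift K UV_W.T (\<lambda>v w. UV_W.pt (UV.pt u v) w)
        \<in> linear_maps K VW.T UV_W.T" by (rule lift)
  next
    fix x assume x: "x \<in> carrier VW.T"
    show "(\<lambda>u. tensor_lift K UV_W.T (\<lambda>v w. UV_W.pt (UV.pt u v) w) x)
        \<in> linear_maps K U UV_W.T"
    proof (rule linI)
      fix u assume u: "u \<in> carrier U"
      show "tensor_lift K UV_W.T (\<lambda>v w. UV_W.pt (UV.pt u v) w) x \<in> carrier UV_W.T"
        by (rule lin_carrier[OF lift(1)[OF u] x])
    next
      fix u u' assume u: "u \<in> carrier U" "u' \<in> carrier U"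
      then have uu: "u \<oplus>\<^bsub>U\<^esub> u' \<in> carrier U" by simp
      show "tensor_lift K UV_W.T (\<lambda>v w. UV_W.pt (UV.pt (u \<oplus>\<^bsub>U\<^esub> u') v) w) x =
          tensor_lift K UV_W.T (\<lambda>v w. UV_W.pt (UV.pt u v) w) x \<oplus>\<^bsub>UV_W.T\<^esub>
          tensor_lift K UV_W.T (\<lambda>v w. UV_W.pt (UV.pt u' v) w) x"
        by (rule VW.tensor_eqI[OF UV_W.tensor_module lift(1)[OF uu]
            lin_plus[OF UV_W.tensor_module lift(1)[OF u(1)] lift(1)[OF u(2)]] _ x])
          (use u uu in \<open>simp add: lift(2) lin_add[OF pt(1)] lin_add[OF pt(3)]\<close>)
    next
      fix c u assume c: "c \<in> carrier K" and u: "u \<in> carrier U"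
      then have cu: "c \<odot>\<^bsub>U\<^esub> u \<in> carrier U" by simp
      show "tensor_lift K UV_W.T (\<lambda>v w. UV_W.pt (UV.pt (c \<odot>\<^bsub>U\<^esub> u) v) w) x =
          c \<odot>\<^bsub>UV_W.T\<^esub> tensor_lift K UV_W.T (\<lambda>v w. UV_W.pt (UV.pt u v) w) x"
        by (rule VW.tensor_eqI[OF UV_W.tensor_module lift(1)[OF cu]
            lin_scaled[OF UV_W.tensor_module lift(1)[OF u] c] _ x])
          (use c u cu in \<open>simp add: lift(2) lin_smult[OF pt(1)] lin_smult[OF pt(3)]\<close>)
    qed
  qed
qed

lemma assoc_inv_linear: "tensor_assoc_inv K U V W \<in> linear_maps K U_VW.T UV_W.T"
  unfolding tensor_assoc_inv_def Let_def
  by (rule U_VW.tensor_lift_linear[OF UV_W.tensor_module assoc_inv_outer])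

lemma assoc_inv_pt:
  assumes "u \<in> carrier U" and "v \<in> carrier V" and "w \<in> carrier W"
  shows "tensor_assoc_inv K U V W (U_VW.pt u (VW.pt v w)) = UV_W.pt (UV.pt u v) w"
proof -
  have "tensor_assoc_inv K U V W (U_VW.pt u (VW.pt v w)) =
      tensor_lift K UV_W.T (\<lambda>v w. UV_W.pt (UV.pt u v) w) (VW.pt v w)"
    unfolding tensor_assoc_inv_def Let_def
    using assms by (intro U_VW.tensor_lift_pt[OF UV_W.tensor_module assoc_inv_outer]) auto
  also have "\<dots> = UV_W.pt (UV.pt u v) w"
    using assms by (intro VW.tensor_lift_pt[OF UV_W.tensor_module assoc_inv_inner])
  finally show ?thesis .
qed

end

section \<open>Dimension estimates\<close>

lemma vectorspaceI: "field K \<Longrightarrow> Module.module K V \<Longrightarrow> vectorspace K V"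
  by (simp add: vectorspace_def)

lemma linear_mapI:
  assumes "field K" and "Module.module K V" and "Module.module K W" and "T \<in> linear_maps K V W"
  shows "linear_map K V W T"
  using assms
  by (simp add: linear_map_def vectorspace_def mod_hom_def mod_hom_axioms_def)

text \<open>
  An injective linear map keeps finite independent sets independent, so \<open>dim W\<close> bounds the size of
  every independent set of \<open>V\<close>. An independent set that is maximal then exists, and it generates.
\<close>

lemma fin_dim_of_injective:
  assumes "field K" and "Module.module K V" and "Module.module K W"
    and T: "T \<in> linear_maps K V W" and inj: "inj_on T (carrier V)"
    and fin: "vectorspace.fin_dim K W"
  shows "vectorspace.fin_dim K V"
proof -
  interpret V: vectorspace K V by (rule vectorspaceI[OF assms(1,2)])
  interpret W: vectorspace K W by (rule vectorspaceI[OF assms(1,3)])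
  interpret linear_map K V W T by (rule linear_mapI[OF assms(1-4)])
  have indep_image: "W.lin_indpt (T ` S)" if S: "S \<subseteq> carrier V" "V.lin_indpt S" "finite S" for S
  proof (rule W.finite_lin_indpt2)
    show "finite (T ` S)" "T ` S \<subseteq> carrier W" using S by auto
    fix a assume a: "a \<in> T ` S \<rightarrow> carrier K" "W.lincomb a (T ` S) = \<zero>\<^bsub>W\<^esub>"
    then have aT: "a \<circ> T \<in> S \<rightarrow> carrier K" by auto
    have "T (V.lincomb (a \<circ> T) S) = T \<zero>\<^bsub>V\<^esub>"
      using lincomb_linear_image[OF inj S(1) a(1) S(3)] a(2) by simp
    then have "V.lincomb (a \<circ> T) S = \<zero>\<^bsub>V\<^esub>"
      using inj_onD[OF inj] V.lincomb_closed[OF S(1) aT] by blast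
    then show "\<forall>v\<in>T ` S. a v = \<zero>\<^bsub>K\<^esub>"
      using V.not_lindepD[OF S(2,3) subset_refl aT] by auto
  qed
  have bound: "card S \<le> W.dim" if S: "S \<subseteq> carrier V" "V.lin_indpt S" "finite S" for S
  proof -
    have "card (T ` S) \<le> W.dim"
      using S by (intro W.li_le_dim(2)[OF fin _ indep_image]) auto
    then show ?thesis using card_image[OF inj_on_subset[OF inj S(1)]] by simp
  qed
  have fin_bound: "finite S \<and> card S \<le> W.dim" if S: "S \<subseteq> carrier V \<and> V.lin_indpt S" for S
  proof -
    have "finite S"
    proof (rule ccontr)
      assume "infinite S"
      then obtain S' where S': "S' \<subseteq> S" "finite S'" "card S' = Suc W.dim"
        using infinite_arbitrarily_large by blast
      have "V.lin_indpt S'" using S V.subset_li_is_li[OF _ S'(1)] by blast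
      then show False using bound[OF _ _ S'(2)] S S' by auto
    qed
    then show ?thesis using bound S by blast
  qed
  have "{} \<subseteq> carrier V \<and> V.lin_indpt {}" by (simp add: V.lin_dep_def)
  from maximal_exists[where P = "\<lambda>S. S \<subseteq> carrier V \<and> V.lin_indpt S", OF fin_bound this]
  obtain S where S: "finite S" "maximal S (\<lambda>S. S \<subseteq> carrier V \<and> V.lin_indpt S)" by blast
  have "S \<subseteq> carrier V" using S(2) by (simp add: maximal_def)
  with S(1) V.max_li_is_gen[OF S(2)] show ?thesis
    unfolding V.fin_dim_def by blast
qed

text \<open>
  The functionals \<open>v \<mapsto> \<Theta> v (p j)\<close> are dual to the vectors \<open>z i\<close>: applied to a linear
  combination of the \<open>z i\<close>, the \<open>j\<close>-th one reads off the \<open>j\<close>-th coefficient.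
\<close>

lemma card_le_dim_of_dual_family:
  assumes K: "field K" and V: "Module.module K V" and fin_dim: "vectorspace.fin_dim K V"
    and "finite I" and z: "\<And>i. i \<in> I \<Longrightarrow> z i \<in> carrier V"
    and \<Theta>: "\<Theta> \<in> linear_maps K V (free_vs K UNIV)"
    and dual: "\<And>i j. i \<in> I \<Longrightarrow> j \<in> I \<Longrightarrow> \<Theta> (z i) (p j) = (if i = j then \<one>\<^bsub>K\<^esub> else \<zero>\<^bsub>K\<^esub>)"
  shows "card I \<le> vectorspace.dim K V"
proof -
  interpret vectorspace K V by (rule vectorspaceI[OF K V])
  have K': "cring K" by (rule R.cring_axioms)
  note F = free_vs_module[OF K', of UNIV]
  have inj: "inj_on z I"
  proof (rule inj_onI)
    fix i j assume "i \<in> I" "j \<in> I" "z i = z j"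
    then have "(if j = i then \<one>\<^bsub>K\<^esub> else \<zero>\<^bsub>K\<^esub>) = \<one>\<^bsub>K\<^esub>" using dual[of i i] dual[of j i] by simp
    then show "i = j" by (auto split: if_splits)
  qed
  have sub: "z ` I \<subseteq> carrier V" using z by auto
  have "lin_indpt (z ` I)"
  proof (rule finite_lin_indpt2[OF _ sub])
    show "finite (z ` I)" using \<open>finite I\<close> by simp
    fix a assume a: "a \<in> z ` I \<rightarrow> carrier K" "lincomb a (z ` I) = \<zero>\<^bsub>V\<^esub>"
    \<comment> \<open>Over a growing subset of \<open>I\<close>, the \<open>j\<close>-th functional picks up \<open>a (z j)\<close> once \<open>j\<close> is in it.\<close>
    have "a (z j) = \<zero>\<^bsub>K\<^esub>" if j: "j \<in> I" for j
    proof -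
      have az: "a (z i) \<in> carrier K" if "i \<in> I" for i using a that by auto
      have "(\<Oplus>\<^bsub>V\<^esub>v\<in>z ` I'. a v \<odot>\<^bsub>V\<^esub> v) \<in> carrier V \<and>
          \<Theta> (\<Oplus>\<^bsub>V\<^esub>v\<in>z ` I'. a v \<odot>\<^bsub>V\<^esub> v) (p j) = (if j \<in> I' then a (z j) else \<zero>\<^bsub>K\<^esub>)"
        if "finite I'" "I' \<subseteq> I" for I'
        using that
      proof (induct I' rule: finite_induct)
        case empty
        then show ?case using lin_zero[OF V F \<Theta>] by simp
      next
        case (insert i I')
        then have i: "i \<in> I" "I' \<subseteq> I" "z i \<notin> z ` I'" using inj by (auto simp: inj_on_def)
        let ?s = "\<Oplus>\<^bsub>V\<^esub>v\<in>z ` I'. a v \<odot>\<^bsub>V\<^esub> v"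
        have s: "?s \<in> carrier V" "\<Theta> ?s (p j) = (if j \<in> I' then a (z j) else \<zero>\<^bsub>K\<^esub>)"
          using insert i by auto
        have iz: "a (z i) \<odot>\<^bsub>V\<^esub> z i \<in> carrier V" using az z i by simp
        have "(\<Oplus>\<^bsub>V\<^esub>v\<in>z ` insert i I'. a v \<odot>\<^bsub>V\<^esub> v) = a (z i) \<odot>\<^bsub>V\<^esub> z i \<oplus>\<^bsub>V\<^esub> ?s"
          unfolding image_insert using i insert(1) az z iz
          by (intro M.finsum_insert) auto
        moreover have "\<Theta> (a (z i) \<odot>\<^bsub>V\<^esub> z i \<oplus>\<^bsub>V\<^esub> ?s) (p j)
            = a (z i) \<otimes>\<^bsub>K\<^esub> (if i = j then \<one>\<^bsub>K\<^esub> else \<zero>\<^bsub>K\<^esub>) \<oplus>\<^bsub>K\<^esub> (if j \<in> I' then a (z j) else \<zero>\<^bsub>K\<^esub>)"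
          using lin_add[OF \<Theta> iz s(1)] lin_smult[OF \<Theta> az[OF i(1)] z[OF i(1)]] s(2)
            dual[OF i(1) j] by simp
        ultimately show ?case using s(1) iz az j i(1) insert(2) by auto
      qed
      from this[OF \<open>finite I\<close> subset_refl] show ?thesis
        using a(2) j lin_zero[OF V F \<Theta>] by (simp add: lincomb_def)
    qed
    then show "\<forall>v\<in>z ` I. a v = \<zero>\<^bsub>K\<^esub>" by auto
  qed
  then have "card (z ` I) \<le> dim" by (rule li_le_dim(2)[OF fin_dim sub])
  then show ?thesis using card_image[OF inj] by simp
qed

section \<open>Nearly Frobenius coproducts\<close>

locale assoc_algebra = M: Module.module K A + R: ring A
  for K :: "('k, 'r) ring_scheme" and A :: "('k, 'a, 'x) module_scheme" +
  assumes smult_mult_left: "c \<in> carrier K \<Longrightarrow> x \<in> carrier A \<Longrightarrow> y \<in> carrier A \<Longrightarrow>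
      (c \<odot>\<^bsub>A\<^esub> x) \<otimes>\<^bsub>A\<^esub> y = c \<odot>\<^bsub>A\<^esub> (x \<otimes>\<^bsub>A\<^esub> y)"
    and smult_mult_right: "c \<in> carrier K \<Longrightarrow> x \<in> carrier A \<Longrightarrow> y \<in> carrier A \<Longrightarrow>
      x \<otimes>\<^bsub>A\<^esub> (c \<odot>\<^bsub>A\<^esub> y) = c \<odot>\<^bsub>A\<^esub> (x \<otimes>\<^bsub>A\<^esub> y)"
begin

lemma A: "Module.module K A" by (rule M.module_axioms)

interpretation AA: module_pair K A A by (intro module_pair.intro A)

abbreviation AA where "AA \<equiv> tensor K A A"
abbreviation pt where "pt \<equiv> pure_tensor K A A"

lemmas AA = AA.tensor_module

interpretation T: Module.module K AA by (rule AA)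
interpretation AA_A: module_pair K AA A by (intro module_pair.intro A AA)
interpretation A_AA: module_pair K A AA by (intro module_pair.intro A AA)
interpretation AAA: module_triple K A A A by (intro module_triple.intro A)

lemma mult_left_linear: "a \<in> carrier A \<Longrightarrow> (\<lambda>x. a \<otimes>\<^bsub>A\<^esub> x) \<in> linear_maps K A A"
  by (intro linI) (auto simp: R.r_distr smult_mult_right)

lemma mult_right_linear: "a \<in> carrier A \<Longrightarrow> (\<lambda>x. x \<otimes>\<^bsub>A\<^esub> a) \<in> linear_maps K A A"
  by (intro linI) (auto simp: R.l_distr smult_mult_left)

lemma mult_bilinear: "bilinear_map K A A A (\<lambda>x y. x \<otimes>\<^bsub>A\<^esub> y)"
  by (intro bilinear_mapI mult_left_linear mult_right_linear)

abbreviation \<mu> where "\<mu> \<equiv> alg_mult K A"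

lemma \<mu>_linear: "\<mu> \<in> linear_maps K AA A"
  unfolding alg_mult_def by (rule AA.tensor_lift_linear[OF A mult_bilinear])

lemma \<mu>_pt: "x \<in> carrier A \<Longrightarrow> y \<in> carrier A \<Longrightarrow> \<mu> (pt x y) = x \<otimes>\<^bsub>A\<^esub> y"
  unfolding alg_mult_def by (rule AA.tensor_lift_pt[OF A mult_bilinear])

definition act_left :: "'a \<Rightarrow> ('a \<times> 'a \<Rightarrow> 'k) set \<Rightarrow> ('a \<times> 'a \<Rightarrow> 'k) set" where
  "act_left a = tensor_map K A A (\<lambda>x. a \<otimes>\<^bsub>A\<^esub> x) (\<lambda>y. y)"

definition act_right :: "'a \<Rightarrow> ('a \<times> 'a \<Rightarrow> 'k) set \<Rightarrow> ('a \<times> 'a \<Rightarrow> 'k) set" where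
  "act_right a = tensor_map K A A (\<lambda>x. x) (\<lambda>y. y \<otimes>\<^bsub>A\<^esub> a)"

lemma act_left_linear: "a \<in> carrier A \<Longrightarrow> act_left a \<in> linear_maps K AA AA"
  unfolding act_left_def by (rule tensor_map_linear[OF A A A A mult_left_linear lin_ident])

lemma act_right_linear: "a \<in> carrier A \<Longrightarrow> act_right a \<in> linear_maps K AA AA"
  unfolding act_right_def by (rule tensor_map_linear[OF A A A A lin_ident mult_right_linear])

lemma act_left_pt:
  "a \<in> carrier A \<Longrightarrow> x \<in> carrier A \<Longrightarrow> y \<in> carrier A \<Longrightarrow> act_left a (pt x y) = pt (a \<otimes>\<^bsub>A\<^esub> x) y"
  unfolding act_left_def by (rule tensor_map_pt[OF A A A A mult_left_linear lin_ident])

lemma act_right_pt: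
  "a \<in> carrier A \<Longrightarrow> x \<in> carrier A \<Longrightarrow> y \<in> carrier A \<Longrightarrow> act_right a (pt x y) = pt x (y \<otimes>\<^bsub>A\<^esub> a)"
  unfolding act_right_def by (rule tensor_map_pt[OF A A A A lin_ident mult_right_linear])

lemma act_left_closed [simp]: "a \<in> carrier A \<Longrightarrow> z \<in> carrier AA \<Longrightarrow> act_left a z \<in> carrier AA"
  by (rule lin_carrier[OF act_left_linear])

lemma act_right_closed [simp]: "a \<in> carrier A \<Longrightarrow> z \<in> carrier AA \<Longrightarrow> act_right a z \<in> carrier AA"
  by (rule lin_carrier[OF act_right_linear])

lemma act_left_bilinear: "bilinear_map K A AA AA act_left"
proof (rule bilinear_mapI)
  fix z assume z: "z \<in> carrier AA"
  note pt = bilinear_mapD(1)[OF AA.pt_bilinear]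
  show "(\<lambda>a. act_left a z) \<in> linear_maps K A AA"
  proof (rule linI)
    fix a b assume ab: "a \<in> carrier A" "b \<in> carrier A"
    then have ab': "a \<oplus>\<^bsub>A\<^esub> b \<in> carrier A" by simp
    show "act_left (a \<oplus>\<^bsub>A\<^esub> b) z = act_left a z \<oplus>\<^bsub>AA\<^esub> act_left b z"
      by (rule AA.tensor_eqI[OF AA act_left_linear[OF ab'] lin_plus[OF AA act_left_linear act_left_linear] _ z])
        (use ab ab' in \<open>simp_all add: act_left_pt R.l_distr lin_add[OF pt]\<close>)
  next
    fix c a assume c: "c \<in> carrier K" and a: "a \<in> carrier A"
    then have ca: "c \<odot>\<^bsub>A\<^esub> a \<in> carrier A" by simp
    show "act_left (c \<odot>\<^bsub>A\<^esub> a) z = c \<odot>\<^bsub>AA\<^esub> act_left a z"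
      by (rule AA.tensor_eqI[OF AA act_left_linear[OF ca] lin_scaled[OF AA act_left_linear[OF a] c] _ z])
        (use c a ca in \<open>simp_all add: act_left_pt smult_mult_left lin_smult[OF pt]\<close>)
  qed (use z in simp)
qed (rule act_left_linear)

lemma act_right_bilinear: "bilinear_map K A AA AA act_right"
proof (rule bilinear_mapI)
  fix z assume z: "z \<in> carrier AA"
  note pt = bilinear_mapD(2)[OF AA.pt_bilinear]
  show "(\<lambda>a. act_right a z) \<in> linear_maps K A AA"
  proof (rule linI)
    fix a b assume ab: "a \<in> carrier A" "b \<in> carrier A"
    then have ab': "a \<oplus>\<^bsub>A\<^esub> b \<in> carrier A" by simp
    show "act_right (a \<oplus>\<^bsub>A\<^esub> b) z = act_right a z \<oplus>\<^bsub>AA\<^esub> act_right b z"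
      by (rule AA.tensor_eqI[OF AA act_right_linear[OF ab'] lin_plus[OF AA act_right_linear act_right_linear] _ z])
        (use ab ab' in \<open>simp_all add: act_right_pt R.r_distr lin_add[OF pt]\<close>)
  next
    fix c a assume c: "c \<in> carrier K" and a: "a \<in> carrier A"
    then have ca: "c \<odot>\<^bsub>A\<^esub> a \<in> carrier A" by simp
    show "act_right (c \<odot>\<^bsub>A\<^esub> a) z = c \<odot>\<^bsub>AA\<^esub> act_right a z"
      by (rule AA.tensor_eqI[OF AA act_right_linear[OF ca] lin_scaled[OF AA act_right_linear[OF a] c] _ z])
        (use c a ca in \<open>simp_all add: act_right_pt smult_mult_right lin_smult[OF pt]\<close>)
  qed (use z in simp)
qed (rule act_right_linear)

lemma act_left_one: "z \<in> carrier AA \<Longrightarrow> act_left \<one>\<^bsub>A\<^esub> z = z"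
  by (rule AA.tensor_eqI[OF AA act_left_linear lin_ident]) (simp_all add: act_left_pt)

lemma act_right_one: "z \<in> carrier AA \<Longrightarrow> act_right \<one>\<^bsub>A\<^esub> z = z"
  by (rule AA.tensor_eqI[OF AA act_right_linear lin_ident]) (simp_all add: act_right_pt)

lemma act_left_mult:
  assumes "a \<in> carrier A" "b \<in> carrier A" "z \<in> carrier AA"
  shows "act_left (a \<otimes>\<^bsub>A\<^esub> b) z = act_left a (act_left b z)"
  by (rule AA.tensor_eqI[OF AA act_left_linear lin_comp[OF act_left_linear act_left_linear]])
    (use assms in \<open>simp_all add: act_left_pt R.m_assoc\<close>)

lemma act_left_right:
  assumes "a \<in> carrier A" "b \<in> carrier A" "z \<in> carrier AA"
  shows "act_left a (act_right b z) = act_right b (act_left a z)"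
  by (rule AA.tensor_eqI[OF AA lin_comp[OF act_right_linear act_left_linear]
        lin_comp[OF act_left_linear act_right_linear]])
    (use assms in \<open>simp_all add: act_right_pt act_left_pt\<close>)

text \<open>
  Reassociating \<open>s \<otimes> b\<close> and multiplying the last two factors lets \<open>b\<close> act on \<open>s\<close> from the right.
  This turns the axiom \<open>\<Delta> \<circ> \<mu> = (1 \<otimes> \<mu>) \<circ> (\<Delta> \<otimes> 1)\<close> into \<open>\<Delta> (a b) = (\<Delta> a) b\<close>; the next lemma
  turns the other one into \<open>\<Delta> (a b) = a (\<Delta> b)\<close>.
\<close>

lemma mult_after_assoc:
  assumes s: "s \<in> carrier AA" and b: "b \<in> carrier A"
  shows "tensor_map K A A (\<lambda>a. a) \<mu> (tensor_assoc K A A A (pure_tensor K AA A s b)) = act_right b s"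
proof (rule AA.tensor_eqI[OF AA _ act_right_linear[OF b] _ s])
  show "(\<lambda>s. tensor_map K A A (\<lambda>a. a) \<mu> (tensor_assoc K A A A (pure_tensor K AA A s b)))
      \<in> linear_maps K AA AA"
    by (rule lin_comp[OF lin_comp[OF bilinear_mapD(1)[OF AA_A.pt_bilinear b] AAA.assoc_linear]
          tensor_map_linear[OF A AA A A lin_ident \<mu>_linear]])
qed (use b in \<open>simp add: AAA.assoc_pt tensor_map_pt[OF A AA A A lin_ident \<mu>_linear] \<mu>_pt act_right_pt\<close>)

lemma mult_after_assoc_inv:
  assumes s: "s \<in> carrier AA" and a: "a \<in> carrier A"
  shows "tensor_map K A A \<mu> (\<lambda>a. a) (tensor_assoc_inv K A A A (pure_tensor K A AA a s)) = act_left a s"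
proof (rule AA.tensor_eqI[OF AA _ act_left_linear[OF a] _ s])
  show "(\<lambda>s. tensor_map K A A \<mu> (\<lambda>a. a) (tensor_assoc_inv K A A A (pure_tensor K A AA a s)))
      \<in> linear_maps K AA AA"
    by (rule lin_comp[OF lin_comp[OF bilinear_mapD(2)[OF A_AA.pt_bilinear a] AAA.assoc_inv_linear]
          tensor_map_linear[OF AA A A A \<mu>_linear lin_ident]])
qed (use a in \<open>simp add: AAA.assoc_inv_pt tensor_map_pt[OF AA A A A \<mu>_linear lin_ident] \<mu>_pt act_left_pt\<close>)

lemma tensor_map_add_left:
  assumes f: "f \<in> linear_maps K A AA" and f': "f' \<in> linear_maps K A AA" and s: "s \<in> carrier AA"
  shows "tensor_map K AA A (\<lambda>u. f u \<oplus>\<^bsub>AA\<^esub> f' u) (\<lambda>a. a) s =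
    tensor_map K AA A f (\<lambda>a. a) s \<oplus>\<^bsub>AA_A.T\<^esub> tensor_map K AA A f' (\<lambda>a. a) s"
  by (rule AA.tensor_eqI[OF AA_A.tensor_module
        tensor_map_linear[OF A A AA A lin_plus[OF AA f f'] lin_ident]
        lin_plus[OF AA_A.tensor_module tensor_map_linear[OF A A AA A f lin_ident]
          tensor_map_linear[OF A A AA A f' lin_ident]] _ s])
    (simp add: tensor_map_pt[OF A A AA A _ lin_ident] lin_plus[OF AA] f f' lin_carrier[OF f] lin_carrier[OF f']
      lin_add[OF bilinear_mapD(1)[OF AA_A.pt_bilinear]])

lemma tensor_map_smult_left:
  assumes f: "f \<in> linear_maps K A AA" and c: "c \<in> carrier K" and s: "s \<in> carrier AA"
  shows "tensor_map K AA A (\<lambda>u. c \<odot>\<^bsub>AA\<^esub> f u) (\<lambda>a. a) s =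
    c \<odot>\<^bsub>AA_A.T\<^esub> tensor_map K AA A f (\<lambda>a. a) s"
  by (rule AA.tensor_eqI[OF AA_A.tensor_module
        tensor_map_linear[OF A A AA A lin_scaled[OF AA f c] lin_ident]
        lin_scaled[OF AA_A.tensor_module tensor_map_linear[OF A A AA A f lin_ident] c] _ s])
    (simp add: tensor_map_pt[OF A A AA A _ lin_ident] lin_scaled[OF AA] f c lin_carrier[OF f]
      lin_smult[OF bilinear_mapD(1)[OF AA_A.pt_bilinear]])

text \<open>
  For \<open>z = \<Sum> x\<^sub>i \<otimes> y\<^sub>i\<close> and \<open>s = \<Sum> u\<^sub>j \<otimes> v\<^sub>j\<close> both sides are \<open>\<Sum> x\<^sub>i \<otimes> (y\<^sub>i u\<^sub>j \<otimes> v\<^sub>j)\<close>. Both are linear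
  in \<open>z\<close> and in \<open>s\<close>, so it is enough to compare them on pure tensors, first in \<open>z\<close>, then in \<open>s\<close>.
\<close>

lemma coassoc_general:
  assumes z: "z \<in> carrier AA" and s: "s \<in> carrier AA"
  shows "tensor_assoc K A A A (tensor_map K AA A (\<lambda>u. act_right u z) (\<lambda>a. a) s) =
    tensor_map K A AA (\<lambda>a. a) (\<lambda>v. act_left v s) z"
proof (rule AA.tensor_eqI[OF A_AA.tensor_module _ _ _ z])
  note right = bilinear_mapD(1)[OF act_right_bilinear]
  note left = bilinear_mapD(1)[OF act_left_bilinear]
  show "(\<lambda>z. tensor_assoc K A A A (tensor_map K AA A (\<lambda>u. act_right u z) (\<lambda>a. a) s))
      \<in> linear_maps K AA A_AA.T"
  proof (rule lin_comp[OF linI AAA.assoc_linear])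
    fix z assume z: "z \<in> carrier AA"
    show "tensor_map K AA A (\<lambda>u. act_right u z) (\<lambda>a. a) s \<in> carrier AA_A.T"
      by (rule lin_carrier[OF tensor_map_linear[OF A A AA A right[OF z] lin_ident] s])
  next
    fix z z' assume z: "z \<in> carrier AA" "z' \<in> carrier AA"
    have "tensor_map K AA A (\<lambda>u. act_right u (z \<oplus>\<^bsub>AA\<^esub> z')) (\<lambda>a. a) s =
        tensor_map K AA A (\<lambda>u. act_right u z \<oplus>\<^bsub>AA\<^esub> act_right u z') (\<lambda>a. a) s"
      by (rule AA.tensor_eqI[OF AA_A.tensor_module
            tensor_map_linear[OF A A AA A right lin_ident]
            tensor_map_linear[OF A A AA A lin_plus[OF AA right right] lin_ident] _ s])
        (use z in \<open>simp_all add: tensor_map_pt[OF A A AA A _ lin_ident] right lin_plus[OF AA]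
            lin_add[OF act_right_linear]\<close>)
    then show "tensor_map K AA A (\<lambda>u. act_right u (z \<oplus>\<^bsub>AA\<^esub> z')) (\<lambda>a. a) s =
        tensor_map K AA A (\<lambda>u. act_right u z) (\<lambda>a. a) s \<oplus>\<^bsub>AA_A.T\<^esub>
        tensor_map K AA A (\<lambda>u. act_right u z') (\<lambda>a. a) s"
      by (simp add: tensor_map_add_left[OF right[OF z(1)] right[OF z(2)] s])
  next
    fix c z assume c: "c \<in> carrier K" and z: "z \<in> carrier AA"
    have "tensor_map K AA A (\<lambda>u. act_right u (c \<odot>\<^bsub>AA\<^esub> z)) (\<lambda>a. a) s =
        tensor_map K AA A (\<lambda>u. c \<odot>\<^bsub>AA\<^esub> act_right u z) (\<lambda>a. a) s"
      by (rule AA.tensor_eqI[OF AA_A.tensor_module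
            tensor_map_linear[OF A A AA A right lin_ident]
            tensor_map_linear[OF A A AA A lin_scaled[OF AA right c] lin_ident] _ s])
        (use c z in \<open>simp_all add: tensor_map_pt[OF A A AA A _ lin_ident] right lin_scaled[OF AA]
            lin_smult[OF act_right_linear]\<close>)
    then show "tensor_map K AA A (\<lambda>u. act_right u (c \<odot>\<^bsub>AA\<^esub> z)) (\<lambda>a. a) s =
        c \<odot>\<^bsub>AA_A.T\<^esub> tensor_map K AA A (\<lambda>u. act_right u z) (\<lambda>a. a) s"
      by (simp add: tensor_map_smult_left[OF right[OF z] c s])
  qed
  show "tensor_map K A AA (\<lambda>a. a) (\<lambda>v. act_left v s) \<in> linear_maps K AA A_AA.T"
    by (rule tensor_map_linear[OF A A A AA lin_ident left[OF s]])
  fix x y assume xy: "x \<in> carrier A" "y \<in> carrier A"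
  have xy_z: "pt x y \<in> carrier AA" using xy by simp
  have "tensor_assoc K A A A (tensor_map K AA A (\<lambda>u. act_right u (pt x y)) (\<lambda>a. a) s) =
      A_AA.pt x (act_left y s)"
  proof (rule AA.tensor_eqI[OF A_AA.tensor_module _ _ _ s])
    show "(\<lambda>s. tensor_assoc K A A A (tensor_map K AA A (\<lambda>u. act_right u (pt x y)) (\<lambda>a. a) s))
        \<in> linear_maps K AA A_AA.T"
      by (rule lin_comp[OF tensor_map_linear[OF A A AA A right[OF xy_z] lin_ident] AAA.assoc_linear])
    show "(\<lambda>s. A_AA.pt x (act_left y s)) \<in> linear_maps K AA A_AA.T"
      by (rule lin_comp[OF act_left_linear[OF xy(2)] bilinear_mapD(2)[OF A_AA.pt_bilinear xy(1)]])
  qed (use xy in \<open>simp add: tensor_map_pt[OF A A AA A right[OF xy_z] lin_ident] act_right_pt act_left_pt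
      AAA.assoc_pt\<close>)
  then show "tensor_assoc K A A A (tensor_map K AA A (\<lambda>u. act_right u (pt x y)) (\<lambda>a. a) s) =
      tensor_map K A AA (\<lambda>a. a) (\<lambda>v. act_left v s) (pt x y)"
    using xy by (simp add: tensor_map_pt[OF A A A AA lin_ident left[OF s]])
qed

text \<open>
  Coassociativity is a consequence of the two bimodule conditions. They give
  \<open>\<Delta> u = z u\<close> with \<open>z = \<Delta> 1\<close>, and \<open>\<Delta> (v a) = v s\<close> with \<open>s = \<Delta> a = z a\<close>. So
  \<open>(\<Delta> \<otimes> 1) s\<close> and \<open>(1 \<otimes> \<Delta>) s\<close> become the two sides of \<open>coassoc_general\<close>.
  What remains is linear in \<open>\<Delta>\<close>, which is why the coproducts form a vector space.
\<close>

lemma nearly_frobenius_iff: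
  "nearly_frobenius K A \<Delta> \<longleftrightarrow> \<Delta> \<in> linear_maps K A AA \<and>
    (\<forall>a\<in>carrier A. \<forall>b\<in>carrier A. \<Delta> (a \<otimes>\<^bsub>A\<^esub> b) = act_right b (\<Delta> a) \<and>
      \<Delta> (a \<otimes>\<^bsub>A\<^esub> b) = act_left a (\<Delta> b))"
proof (cases "\<Delta> \<in> linear_maps K A AA")
  case False
  then show ?thesis by (simp add: nearly_frobenius_def Let_def)
next
  case \<Delta>: True
  let ?D1 = "tensor_map K AA A \<Delta> (\<lambda>a. a)" and ?D2 = "tensor_map K A AA (\<lambda>a. a) \<Delta>"
  let ?R = "\<lambda>z. tensor_map K A A (\<lambda>a. a) \<mu> (tensor_assoc K A A A (?D1 z))"
  let ?L = "\<lambda>z. tensor_map K A A \<mu> (\<lambda>a. a) (tensor_assoc_inv K A A A (?D2 z))"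
  have R_pt: "?R (pt a b) = act_right b (\<Delta> a)" if "a \<in> carrier A" "b \<in> carrier A" for a b
    using that
    by (simp add: tensor_map_pt[OF A A AA A \<Delta> lin_ident] mult_after_assoc lin_carrier[OF \<Delta>])
  have L_pt: "?L (pt a b) = act_left a (\<Delta> b)" if "a \<in> carrier A" "b \<in> carrier A" for a b
    using that
    by (simp add: tensor_map_pt[OF A A A AA lin_ident \<Delta>] mult_after_assoc_inv lin_carrier[OF \<Delta>])
  have R_lin: "?R \<in> linear_maps K AA AA"
    by (rule lin_comp[OF lin_comp[OF tensor_map_linear[OF A A AA A \<Delta> lin_ident] AAA.assoc_linear]
          tensor_map_linear[OF A AA A A lin_ident \<mu>_linear]])
  have L_lin: "?L \<in> linear_maps K AA AA"
    by (rule lin_comp[OF lin_comp[OF tensor_map_linear[OF A A A AA lin_ident \<Delta>] AAA.assoc_inv_linear]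
          tensor_map_linear[OF AA A A A \<mu>_linear lin_ident]])
  have \<Delta>\<mu>_lin: "(\<lambda>z. \<Delta> (\<mu> z)) \<in> linear_maps K AA AA" by (rule lin_comp[OF \<mu>_linear \<Delta>])
  have R_iff: "(\<forall>z\<in>carrier AA. \<Delta> (\<mu> z) = ?R z) \<longleftrightarrow>
      (\<forall>a\<in>carrier A. \<forall>b\<in>carrier A. \<Delta> (a \<otimes>\<^bsub>A\<^esub> b) = act_right b (\<Delta> a))"
  proof (intro iffI ballI)
    fix a b assume "\<forall>z\<in>carrier AA. \<Delta> (\<mu> z) = ?R z" and ab: "a \<in> carrier A" "b \<in> carrier A"
    then have "\<Delta> (\<mu> (pt a b)) = ?R (pt a b)" by simp
    then show "\<Delta> (a \<otimes>\<^bsub>A\<^esub> b) = act_right b (\<Delta> a)" using ab by (simp only: R_pt \<mu>_pt)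
  next
    fix z assume *: "\<forall>a\<in>carrier A. \<forall>b\<in>carrier A. \<Delta> (a \<otimes>\<^bsub>A\<^esub> b) = act_right b (\<Delta> a)"
      and z: "z \<in> carrier AA"
    show "\<Delta> (\<mu> z) = ?R z"
      by (rule AA.tensor_eqI[OF AA \<Delta>\<mu>_lin R_lin _ z]) (use * in \<open>simp only: R_pt \<mu>_pt\<close>)
  qed
  have L_iff: "(\<forall>z\<in>carrier AA. \<Delta> (\<mu> z) = ?L z) \<longleftrightarrow>
      (\<forall>a\<in>carrier A. \<forall>b\<in>carrier A. \<Delta> (a \<otimes>\<^bsub>A\<^esub> b) = act_left a (\<Delta> b))"
  proof (intro iffI ballI)
    fix a b assume "\<forall>z\<in>carrier AA. \<Delta> (\<mu> z) = ?L z" and ab: "a \<in> carrier A" "b \<in> carrier A"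
    then have "\<Delta> (\<mu> (pt a b)) = ?L (pt a b)" by simp
    then show "\<Delta> (a \<otimes>\<^bsub>A\<^esub> b) = act_left a (\<Delta> b)" using ab by (simp only: L_pt \<mu>_pt)
  next
    fix z assume *: "\<forall>a\<in>carrier A. \<forall>b\<in>carrier A. \<Delta> (a \<otimes>\<^bsub>A\<^esub> b) = act_left a (\<Delta> b)"
      and z: "z \<in> carrier AA"
    show "\<Delta> (\<mu> z) = ?L z"
      by (rule AA.tensor_eqI[OF AA \<Delta>\<mu>_lin L_lin _ z]) (use * in \<open>simp only: L_pt \<mu>_pt\<close>)
  qed
  have coassoc: "tensor_assoc K A A A (?D1 (\<Delta> a)) = ?D2 (\<Delta> a)"
    if a: "a \<in> carrier A"
      and bimod: "\<forall>a\<in>carrier A. \<forall>b\<in>carrier A. \<Delta> (a \<otimes>\<^bsub>A\<^esub> b) = act_right b (\<Delta> a)"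
        "\<forall>a\<in>carrier A. \<forall>b\<in>carrier A. \<Delta> (a \<otimes>\<^bsub>A\<^esub> b) = act_left a (\<Delta> b)" for a
  proof -
    let ?z = "\<Delta> \<one>\<^bsub>A\<^esub>" and ?s = "\<Delta> a"
    have z: "?z \<in> carrier AA" and s: "?s \<in> carrier AA" using a by (auto intro: lin_carrier[OF \<Delta>])
    have \<Delta>_right: "\<Delta> u = act_right u ?z" if "u \<in> carrier A" for u
      using bimod(1)[rule_format, of "\<one>\<^bsub>A\<^esub>" u] that by simp
    note right = bilinear_mapD(1)[OF act_right_bilinear z]
      and left = bilinear_mapD(1)[OF act_left_bilinear s]
    have "?D1 ?s = tensor_map K AA A (\<lambda>u. act_right u ?z) (\<lambda>a. a) ?s"
      by (rule AA.tensor_eqI[OF AA_A.tensor_module tensor_map_linear[OF A A AA A \<Delta> lin_ident]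
            tensor_map_linear[OF A A AA A right lin_ident] _ s])
        (simp add: tensor_map_pt[OF A A AA A _ lin_ident] \<Delta> right flip: \<Delta>_right)
    moreover have "?D2 ?s = tensor_map K A AA (\<lambda>a. a) (\<lambda>v. act_left v ?s) ?z"
    proof -
      have "?D2 (act_right a w) = tensor_map K A AA (\<lambda>a. a) (\<lambda>v. act_left v ?s) w"
        if w: "w \<in> carrier AA" for w
        by (rule AA.tensor_eqI[OF A_AA.tensor_module
              lin_comp[OF act_right_linear[OF a] tensor_map_linear[OF A A A AA lin_ident \<Delta>]]
              tensor_map_linear[OF A A A AA lin_ident left] _ w])
          (use a bimod(2) in \<open>simp add: act_right_pt tensor_map_pt[OF A A A AA lin_ident] \<Delta> left\<close>)
      from this[OF z] \<Delta>_right[OF a] show ?thesis by simp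
    qed
    ultimately show ?thesis using coassoc_general[OF z s] by simp
  qed
  show ?thesis
    unfolding nearly_frobenius_def Let_def R_iff L_iff using \<Delta> coassoc by blast
qed

text \<open>
  The values at \<open>1\<close> of the nearly Frobenius coproducts.
\<close>

definition commuting_tensors :: "('a \<times> 'a \<Rightarrow> 'k) set set" where
  "commuting_tensors = {z \<in> carrier AA. \<forall>a\<in>carrier A. act_left a z = act_right a z}"

lemma frob_space_carrier:
  "\<Delta> \<in> carrier (frob_space K A) \<longleftrightarrow> \<Delta> \<in> extensional (carrier A) \<and> nearly_frobenius K A \<Delta>"
  by (simp add: frob_space_def)

lemma frob_space_simps:
  "\<zero>\<^bsub>frob_space K A\<^esub> = (\<lambda>a\<in>carrier A. \<zero>\<^bsub>AA\<^esub>)"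
  "\<Delta> \<oplus>\<^bsub>frob_space K A\<^esub> \<Delta>' = (\<lambda>a\<in>carrier A. \<Delta> a \<oplus>\<^bsub>AA\<^esub> \<Delta>' a)"
  "c \<odot>\<^bsub>frob_space K A\<^esub> \<Delta> = (\<lambda>a\<in>carrier A. c \<odot>\<^bsub>AA\<^esub> \<Delta> a)"
  by (simp_all add: frob_space_def)

lemma frob_value [simp]:
  "\<Delta> \<in> carrier (frob_space K A) \<Longrightarrow> a \<in> carrier A \<Longrightarrow> \<Delta> a \<in> carrier AA"
  unfolding frob_space_carrier nearly_frobenius_iff by (blast intro: lin_carrier)

lemma nearly_frobenius_restrict:
  assumes f: "f \<in> linear_maps K A AA"
    and bimod: "\<And>a b. a \<in> carrier A \<Longrightarrow> b \<in> carrier A \<Longrightarrow> f (a \<otimes>\<^bsub>A\<^esub> b) = act_right b (f a)"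
      "\<And>a b. a \<in> carrier A \<Longrightarrow> b \<in> carrier A \<Longrightarrow> f (a \<otimes>\<^bsub>A\<^esub> b) = act_left a (f b)"
  shows "restrict f (carrier A) \<in> carrier (frob_space K A)"
proof -
  have "restrict f (carrier A) \<in> linear_maps K A AA"
    using lin_carrier[OF f] lin_add[OF f] lin_smult[OF f] by (intro linI) auto
  then show ?thesis using bimod by (auto simp: frob_space_carrier nearly_frobenius_iff)
qed

lemma nearly_frobenius_of_commuting:
  assumes "z \<in> commuting_tensors"
  shows "(\<lambda>a\<in>carrier A. act_left a z) \<in> carrier (frob_space K A)"
proof -
  have z: "z \<in> carrier AA" "\<And>a. a \<in> carrier A \<Longrightarrow> act_left a z = act_right a z"
    using assms by (auto simp: commuting_tensors_def)
  show ?thesis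
  proof (rule nearly_frobenius_restrict[OF bilinear_mapD(1)[OF act_left_bilinear z(1)]])
    fix a b assume ab: "a \<in> carrier A" "b \<in> carrier A"
    then show "act_left (a \<otimes>\<^bsub>A\<^esub> b) z = act_left a (act_left b z)" using z(1) by (rule act_left_mult)
    also have "\<dots> = act_right b (act_left a z)"
      using ab z by (simp add: act_left_right)
    finally show "act_left (a \<otimes>\<^bsub>A\<^esub> b) z = act_right b (act_left a z)" .
  qed
qed

lemma frob_space_module: "Module.module K (frob_space K A)"
proof -
  have D: "\<Delta> \<in> linear_maps K A AA"
    "\<And>a b. a \<in> carrier A \<Longrightarrow> b \<in> carrier A \<Longrightarrow> \<Delta> (a \<otimes>\<^bsub>A\<^esub> b) = act_right b (\<Delta> a)"
    "\<And>a b. a \<in> carrier A \<Longrightarrow> b \<in> carrier A \<Longrightarrow> \<Delta> (a \<otimes>\<^bsub>A\<^esub> b) = act_left a (\<Delta> b)"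
    if "\<Delta> \<in> carrier (frob_space K A)" for \<Delta>
    using that unfolding frob_space_carrier nearly_frobenius_iff by blast+
  have smult_closed: "c \<odot>\<^bsub>frob_space K A\<^esub> \<Delta> \<in> carrier (frob_space K A)"
    if c: "c \<in> carrier K" and \<Delta>: "\<Delta> \<in> carrier (frob_space K A)" for c \<Delta>
    unfolding frob_space_simps
    by (rule nearly_frobenius_restrict[OF lin_scaled[OF AA D(1)[OF \<Delta>] c]])
      (use c \<Delta> in \<open>simp add: D(2)[OF \<Delta>] lin_smult[OF act_right_linear],
        simp add: D(3)[OF \<Delta>] lin_smult[OF act_left_linear]\<close>)
  have ext: "\<Delta> = \<Delta>'" if "\<Delta> \<in> carrier (frob_space K A)" "\<Delta>' \<in> carrier (frob_space K A)"
      "\<And>a. a \<in> carrier A \<Longrightarrow> \<Delta> a = \<Delta>' a" for \<Delta> \<Delta>'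
    using that by (intro extensionalityI[of _ "carrier A"]) (auto simp: frob_space_carrier)
  have add_closed: "\<Delta> \<oplus>\<^bsub>frob_space K A\<^esub> \<Delta>' \<in> carrier (frob_space K A)"
    if \<Delta>: "\<Delta> \<in> carrier (frob_space K A)" and \<Delta>': "\<Delta>' \<in> carrier (frob_space K A)" for \<Delta> \<Delta>'
    unfolding frob_space_simps
    by (rule nearly_frobenius_restrict[OF lin_plus[OF AA D(1)[OF \<Delta>] D(1)[OF \<Delta>']]])
      (use \<Delta> \<Delta>' in \<open>simp add: D(2)[OF \<Delta>] D(2)[OF \<Delta>'] lin_add[OF act_right_linear],
        simp add: D(3)[OF \<Delta>] D(3)[OF \<Delta>'] lin_add[OF act_left_linear]\<close>)
  have zero_closed: "\<zero>\<^bsub>frob_space K A\<^esub> \<in> carrier (frob_space K A)"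
    unfolding frob_space_simps
    by (rule nearly_frobenius_restrict)
      (auto intro!: linI simp: lin_zero[OF AA AA act_left_linear] lin_zero[OF AA AA act_right_linear])
  show ?thesis
  proof (rule moduleI)
    show "abelian_group (frob_space K A)"
    proof (rule abelian_groupI)
      fix \<Delta> assume \<Delta>: "\<Delta> \<in> carrier (frob_space K A)"
      let ?n = "(\<ominus>\<^bsub>K\<^esub> \<one>\<^bsub>K\<^esub>) \<odot>\<^bsub>frob_space K A\<^esub> \<Delta>"
      have n: "?n \<in> carrier (frob_space K A)" using \<Delta> by (intro smult_closed) auto
      have "?n \<oplus>\<^bsub>frob_space K A\<^esub> \<Delta> = \<zero>\<^bsub>frob_space K A\<^esub>"
        by (rule ext[OF add_closed[OF n \<Delta>] zero_closed])
          (use \<Delta> in \<open>simp add: frob_space_simps T.smult_l_minus T.l_neg\<close>)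
      then show "\<exists>\<Delta>'\<in>carrier (frob_space K A). \<Delta>' \<oplus>\<^bsub>frob_space K A\<^esub> \<Delta> = \<zero>\<^bsub>frob_space K A\<^esub>"
        using n by blast
      show "\<zero>\<^bsub>frob_space K A\<^esub> \<oplus>\<^bsub>frob_space K A\<^esub> \<Delta> = \<Delta>"
        by (rule ext[OF add_closed[OF zero_closed \<Delta>] \<Delta>]) (use \<Delta> in \<open>simp add: frob_space_simps\<close>)
    next
      fix \<Delta> \<Delta>' \<Delta>'' assume *: "\<Delta> \<in> carrier (frob_space K A)" "\<Delta>' \<in> carrier (frob_space K A)"
        "\<Delta>'' \<in> carrier (frob_space K A)"
      then show "\<Delta> \<oplus>\<^bsub>frob_space K A\<^esub> \<Delta>' \<oplus>\<^bsub>frob_space K A\<^esub> \<Delta>'' =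
          \<Delta> \<oplus>\<^bsub>frob_space K A\<^esub> (\<Delta>' \<oplus>\<^bsub>frob_space K A\<^esub> \<Delta>'')"
        by (intro ext add_closed) (auto simp: frob_space_simps T.a_assoc)
    next
      fix \<Delta> \<Delta>' assume *: "\<Delta> \<in> carrier (frob_space K A)" "\<Delta>' \<in> carrier (frob_space K A)"
      then show "\<Delta> \<oplus>\<^bsub>frob_space K A\<^esub> \<Delta>' = \<Delta>' \<oplus>\<^bsub>frob_space K A\<^esub> \<Delta>"
        by (intro ext add_closed) (auto simp: frob_space_simps T.a_comm)
    qed (fact add_closed zero_closed)+
  next
    fix a b \<Delta> assume "a \<in> carrier K" "b \<in> carrier K" and "\<Delta> \<in> carrier (frob_space K A)"
    then show "(a \<oplus>\<^bsub>K\<^esub> b) \<odot>\<^bsub>frob_space K A\<^esub> \<Delta> =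
        a \<odot>\<^bsub>frob_space K A\<^esub> \<Delta> \<oplus>\<^bsub>frob_space K A\<^esub> b \<odot>\<^bsub>frob_space K A\<^esub> \<Delta>"
      by (intro ext add_closed smult_closed) (auto simp: frob_space_simps T.smult_l_distr)
  next
    fix a b \<Delta> assume "a \<in> carrier K" "b \<in> carrier K" and "\<Delta> \<in> carrier (frob_space K A)"
    then show "a \<otimes>\<^bsub>K\<^esub> b \<odot>\<^bsub>frob_space K A\<^esub> \<Delta> = a \<odot>\<^bsub>frob_space K A\<^esub> (b \<odot>\<^bsub>frob_space K A\<^esub> \<Delta>)"
      by (intro ext smult_closed) (auto simp: frob_space_simps T.smult_assoc1)
  next
    fix a \<Delta> \<Delta>' assume "a \<in> carrier K" "\<Delta> \<in> carrier (frob_space K A)" "\<Delta>' \<in> carrier (frob_space K A)"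
    then show "a \<odot>\<^bsub>frob_space K A\<^esub> (\<Delta> \<oplus>\<^bsub>frob_space K A\<^esub> \<Delta>') =
        a \<odot>\<^bsub>frob_space K A\<^esub> \<Delta> \<oplus>\<^bsub>frob_space K A\<^esub> a \<odot>\<^bsub>frob_space K A\<^esub> \<Delta>'"
      by (intro ext add_closed smult_closed) (auto simp: frob_space_simps T.smult_r_distr)
  next
    fix \<Delta> assume "\<Delta> \<in> carrier (frob_space K A)"
    then show "\<one>\<^bsub>K\<^esub> \<odot>\<^bsub>frob_space K A\<^esub> \<Delta> = \<Delta>"
      by (intro ext smult_closed) (auto simp: frob_space_simps)
  qed (auto intro: smult_closed M.R.cring_axioms)
qed

lemma eval_one_linear: "(\<lambda>\<Delta>. \<Delta> \<one>\<^bsub>A\<^esub>) \<in> linear_maps K (frob_space K A) AA"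
  by (intro linI) (auto simp: frob_space_simps)

text \<open>
  \<open>\<Delta> a = \<Delta> (1 a) = (\<Delta> 1) a\<close>.
\<close>

lemma eval_one_inj: "inj_on (\<lambda>\<Delta>. \<Delta> \<one>\<^bsub>A\<^esub>) (carrier (frob_space K A))"
proof (rule inj_onI)
  fix \<Delta> \<Delta>' assume \<Delta>: "\<Delta> \<in> carrier (frob_space K A)" and \<Delta>': "\<Delta>' \<in> carrier (frob_space K A)"
    and eq: "\<Delta> \<one>\<^bsub>A\<^esub> = \<Delta>' \<one>\<^bsub>A\<^esub>"
  have right: "\<Delta> a = act_right a (\<Delta> \<one>\<^bsub>A\<^esub>)"
    if "\<Delta> \<in> carrier (frob_space K A)" "a \<in> carrier A" for \<Delta> a
  proof -
    have "\<Delta> (\<one>\<^bsub>A\<^esub> \<otimes>\<^bsub>A\<^esub> a) = act_right a (\<Delta> \<one>\<^bsub>A\<^esub>)"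
      using that unfolding frob_space_carrier nearly_frobenius_iff by blast
    then show ?thesis using that by simp
  qed
  have "\<Delta> a = \<Delta>' a" if "a \<in> carrier A" for a
    using right[OF \<Delta> that] right[OF \<Delta>' that] eq by simp
  with \<Delta> \<Delta>' show "\<Delta> = \<Delta>'"
    by (intro extensionalityI[of _ "carrier A"]) (simp_all add: frob_space_carrier)
qed

text \<open>
  \<open>vectorspace.dim\<close> is the least size of a finite generating set, so a lower bound for it needs
  one to exist. The embedding \<open>\<Delta> \<mapsto> \<Delta> 1\<close> into \<open>A \<otimes> A\<close>, which is generated by the tensors
  \<open>v \<otimes> w\<close> with \<open>v, w \<in> S\<close>, provides it.
\<close>

lemma card_le_frobdim:
  assumes K: "field K"
    and gen: "finite S" "S \<subseteq> carrier A" "M.span S = carrier A"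
    and "finite I" and z: "\<And>i. i \<in> I \<Longrightarrow> z i \<in> commuting_tensors"
    and \<Theta>: "\<Theta> \<in> linear_maps K AA (free_vs K UNIV)"
    and dual: "\<And>i j. i \<in> I \<Longrightarrow> j \<in> I \<Longrightarrow> \<Theta> (z i) (p j) = (if i = j then \<one>\<^bsub>K\<^esub> else \<zero>\<^bsub>K\<^esub>)"
  shows "card I \<le> frobdim K A"
proof -
  interpret TV: vectorspace K AA by (rule vectorspaceI[OF K AA])
  let ?P = "(\<lambda>(v, w). pt v w) ` (S \<times> S)"
  have "T.span ?P = carrier AA"
    by (rule AA.tensor_span_generators[OF gen(2,3) gen(2,3)])
  moreover have "finite ?P" "?P \<subseteq> carrier AA" using gen(1,2) by (auto intro!: AA.pt_closed)
  ultimately have "TV.fin_dim" unfolding TV.fin_dim_def by blast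
  then have fin: "vectorspace.fin_dim K (frob_space K A)"
    by (rule fin_dim_of_injective[OF K frob_space_module AA eval_one_linear eval_one_inj])
  have val: "(\<lambda>a\<in>carrier A. act_left a (z i)) \<one>\<^bsub>A\<^esub> = z i" if "i \<in> I" for i
    using z[OF that] by (auto simp: commuting_tensors_def act_left_one act_right_one)
  show ?thesis
    unfolding frobdim_def
  proof (rule card_le_dim_of_dual_family[OF K frob_space_module fin \<open>finite I\<close>,
        where z = "\<lambda>i. \<lambda>a\<in>carrier A. act_left a (z i)" and \<Theta> = "\<lambda>\<Delta>. \<Theta> (\<Delta> \<one>\<^bsub>A\<^esub>)" and p = p])
    show "(\<lambda>\<Delta>. \<Theta> (\<Delta> \<one>\<^bsub>A\<^esub>)) \<in> linear_maps K (frob_space K A) (free_vs K UNIV)"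
      by (rule lin_comp[OF eval_one_linear \<Theta>])
    show "(\<lambda>a\<in>carrier A. act_left a (z i)) \<in> carrier (frob_space K A)" if "i \<in> I" for i
      by (rule nearly_frobenius_of_commuting[OF z[OF that]])
  qed (simp only: val dual)
qed

lemma commuting_tensors_of_generators:
  assumes gen: "S \<subseteq> carrier A" "M.span S = carrier A" and z: "z \<in> carrier AA"
    and comm: "\<And>s. s \<in> S \<Longrightarrow> act_left s z = act_right s z"
  shows "z \<in> commuting_tensors"
proof -
  have "act_left a z = act_right a z" if "a \<in> carrier A" for a
  proof (rule lin_eq_on_span[OF A AA, where f = "\<lambda>a. act_left a z" and g = "\<lambda>a. act_right a z" and S = S])
    show "(\<lambda>a. act_left a z) \<in> linear_maps K A AA" "(\<lambda>a. act_right a z) \<in> linear_maps K A AA"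
      by (rule bilinear_mapD(1)[OF act_left_bilinear z] bilinear_mapD(1)[OF act_right_bilinear z])+
    show "a \<in> M.span S" unfolding gen(2) by (rule that)
  qed (fact gen(1), rule comm)
  with z show ?thesis by (simp add: commuting_tensors_def)
qed

end

section \<open>Path algebras and their quotients\<close>

lemma module_cong:
  fixes M M' :: "('k, 'v, 'x) module_scheme"
  assumes "Module.module K M" and "carrier M' = carrier M" and "add M' = add M"
    and "zero M' = zero M" and "smult M' = smult M"
  shows "Module.module K M'"
proof -
  have "add_monoid M' = add_monoid M" using assms(2-4) by simp
  then have "Module.module K M' = Module.module K M"
    unfolding Module.module_def Module.module_axioms_def abelian_group_def abelian_monoid_def
      abelian_group_axioms_def
    by (simp only: assms(2-5))
  with assms(1) show ?thesis by simp
qed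

context assoc_algebra
begin

text \<open>
  \<open>c x = (c 1) x\<close>, so ideals are closed under scalars.
\<close>

lemma ideal_submodule:
  assumes "ideal I A"
  shows "LinearCombinations.submodule K I A"
proof -
  interpret ideal I A by fact
  have "c \<odot>\<^bsub>A\<^esub> x \<in> I" if "c \<in> carrier K" "x \<in> I" for c x
  proof -
    have "c \<odot>\<^bsub>A\<^esub> x = (c \<odot>\<^bsub>A\<^esub> \<one>\<^bsub>A\<^esub>) \<otimes>\<^bsub>A\<^esub> x"
      using that a_subset by (subst smult_mult_left) auto
    then show ?thesis using that I_l_closed by simp
  qed
  then show ?thesis
    using A a_subset by (auto simp: LinearCombinations.submodule_def)
qed

lemma quotient_algebra:
  assumes "ideal I A"
  shows "assoc_algebra K (quot_module A I)"
proof -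
  interpret I: ideal I A by fact
  interpret Q: module_quotient K A I
    by (intro module_quotient.intro module_quotient_axioms.intro A ideal_submodule assms)
  have mult: "(I +>\<^bsub>A\<^esub> x) \<otimes>\<^bsub>quot_module A I\<^esub> (I +>\<^bsub>A\<^esub> y) = I +>\<^bsub>A\<^esub> (x \<otimes>\<^bsub>A\<^esub> y)"
    if "x \<in> carrier A" "y \<in> carrier A" for x y
    using I.rcoset_mult_add[OF that] by (simp add: quot_module_def FactRing_def)
  show ?thesis
  proof (intro assoc_algebra.intro assoc_algebra_axioms.intro Q.quot_is_module)
    interpret QR: ring "A Quot I" by (rule I.quotient_is_ring)
    have eq: "carrier (quot_module A I) = carrier (A Quot I)" "add (quot_module A I) = add (A Quot I)"
      "mult (quot_module A I) = mult (A Quot I)" "one (quot_module A I) = one (A Quot I)"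
      by (simp_all add: quot_module_def)
    interpret QM: Module.module K "quot_module A I" by (rule Q.quot_is_module)
    show "ring (quot_module A I)"
    proof (rule ringI)
      show "abelian_group (quot_module A I)" by (rule QM.abelian_group_axioms)
      show "Group.monoid (quot_module A I)"
        using QR.monoid_axioms unfolding Group.monoid_def eq .
    qed (simp_all only: eq QR.l_distr QR.r_distr)
  qed (auto simp: Q.quot_carrier Q.proj_smult mult smult_mult_left smult_mult_right)
qed

end

locale path_algebra_over_field = fin_digraph Q + K: field K
  for K :: "('k, 'r) ring_scheme" and Q :: "('v, 'e) pre_digraph"
begin

abbreviation X where "X \<equiv> quiver_paths Q"
abbreviation P where "P \<equiv> path_algebra K Q"
abbreviation gen where "gen \<equiv> free_gen K"

lemmas Kc = K.cring_axioms

lemma P_carrier: "carrier P = carrier (free_vs K X)"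
  by (simp add: path_algebra_def)

lemma P_simps [simp]:
  "\<zero>\<^bsub>P\<^esub> = (\<lambda>x. \<zero>\<^bsub>K\<^esub>)"
  "f \<oplus>\<^bsub>P\<^esub> g = (\<lambda>x. f x \<oplus>\<^bsub>K\<^esub> g x)"
  "c \<odot>\<^bsub>P\<^esub> f = (\<lambda>x. c \<otimes>\<^bsub>K\<^esub> f x)"
  by (simp_all add: path_algebra_def free_vs_def)

lemma P_module: "Module.module K P"
  by (rule module_cong[OF free_vs_module[OF Kc, of X]])
    (simp_all add: path_algebra_def)

interpretation P: Module.module K P by (rule P_module)

lemma P_one: "\<one>\<^bsub>P\<^esub> = (\<lambda>(u, p, v). if u \<in> verts Q \<and> p = [] \<and> v = u then \<one>\<^bsub>K\<^esub> else \<zero>\<^bsub>K\<^esub>)"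
  by (simp add: path_algebra_def)

lemma gen_closed: "x \<in> X \<Longrightarrow> gen x \<in> carrier P"
  unfolding P_carrier by (rule free_gen_carrier[OF Kc])

lemma P_span: "P.span (gen ` X) = carrier P"
proof -
  have sub: "gen ` X \<subseteq> carrier P" using gen_closed by auto
  have "f \<in> P.span (gen ` X)" if "f \<in> carrier P" for f
  proof (rule lin_span_submodule[OF free_vs_module[OF Kc, of X] P_module, where f = "\<lambda>f. f" and S = "gen ` X"])
    show "(\<lambda>f. f) \<in> linear_maps K (free_vs K X) P"
      by (rule linI) (simp_all add: P_carrier)
    show "f \<in> LinearCombinations.module.span K (free_vs K X) (gen ` X)"
      using that by (simp add: free_gen_span[OF Kc] P_carrier)
    show "LinearCombinations.submodule K (P.span (gen ` X)) P" by (rule P.span_is_submodule[OF sub])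
  qed (use sub P.in_own_span[OF sub] in \<open>auto simp: P_carrier\<close>)
  then show ?thesis using P.span_is_subset2[OF sub] by auto
qed

text \<open>
  The ways to split the path \<open>z\<close> in two. The product in the path algebra is defined as a sum over
  a set that depends on the supports of \<open>f\<close> and \<open>g\<close>. Summing over all factorizations of \<open>z\<close>
  instead keeps the index set fixed, so that bilinearity holds term by term.
\<close>

definition factorizations :: "'v \<times> 'e list \<times> 'v \<Rightarrow> (('v \<times> 'e list \<times> 'v) \<times> ('v \<times> 'e list \<times> 'v)) set" where
  "factorizations z = {((u, p, v), (v', q, w)). (u, p, v) \<in> X \<and> (v', q, w) \<in> X \<and> v = v' \<and> z = (u, p @ q, w)}"

lemma factorizations_finite: "finite (factorizations z)"
proof -
  obtain u r w where z: "z = (u, r, w)" by (cases z)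
  let ?split = "\<lambda>i. ((u, take i r, awlast u (take i r)), (awlast u (take i r), drop i r, w))"
  have "factorizations z \<subseteq> ?split ` {..length r}"
  proof
    fix x assume "x \<in> factorizations z"
    then obtain p v q where x: "x = ((u, p, v), (v, q, w))" "r = p @ q" "awalk u p v"
      by (auto simp: factorizations_def z quiver_paths_def)
    then have "awlast u p = v" by auto
    then have "x = ?split (length p)" using x by simp
    then show "x \<in> ?split ` {..length r}" by (rule image_eqI) (simp add: x(2))
  qed
  then show ?thesis by (rule finite_subset) simp
qed

lemma factorizations_member:
  assumes "x \<in> factorizations z"
  shows "fst x \<in> X" "snd x \<in> X" "z \<in> X"
  using assms by (auto simp: factorizations_def quiver_paths_def)

lemma mult_as_finsum:
  assumes f: "f \<in> carrier P" and g: "g \<in> carrier P"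
  shows "(f \<otimes>\<^bsub>P\<^esub> g) z = (\<Oplus>\<^bsub>K\<^esub>x\<in>factorizations z. f (fst x) \<otimes>\<^bsub>K\<^esub> g (snd x))"
proof -
  have outside: "f x = \<zero>\<^bsub>K\<^esub>" "g x = \<zero>\<^bsub>K\<^esub>" if "x \<notin> X" for x
    by (rule free_vs_outside[OF f[unfolded P_carrier] that],
        rule free_vs_outside[OF g[unfolded P_carrier] that])
  have val: "f x \<in> carrier K" "g x \<in> carrier K" for x using f g by (auto simp: P_carrier)
  let ?S = "{((u, p, v), (u', q, w)). f (u, p, v) \<noteq> \<zero>\<^bsub>K\<^esub> \<and> g (u', q, w) \<noteq> \<zero>\<^bsub>K\<^esub> \<and>
                  v = u' \<and> z = (u, p @ q, w)}"
  have "(f \<otimes>\<^bsub>P\<^esub> g) z = (\<Oplus>\<^bsub>K\<^esub>x\<in>?S. f (fst x) \<otimes>\<^bsub>K\<^esub> g (snd x))"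
    by (simp add: path_algebra_def)
  also have "\<dots> = (\<Oplus>\<^bsub>K\<^esub>x\<in>factorizations z. f (fst x) \<otimes>\<^bsub>K\<^esub> g (snd x))"
  proof (rule K.add.finprod_mono_neutral_cong_left[OF factorizations_finite])
    show "?S \<subseteq> factorizations z" using outside unfolding factorizations_def by blast
    show "f (fst x) \<otimes>\<^bsub>K\<^esub> g (snd x) = \<zero>\<^bsub>K\<^esub>" if "x \<in> factorizations z - ?S" for x
    proof -
      have "f (fst x) = \<zero>\<^bsub>K\<^esub> \<or> g (snd x) = \<zero>\<^bsub>K\<^esub>"
        using that by (auto simp: factorizations_def)
      then show ?thesis using val[of "fst x"] val[of "snd x"] by auto
    qed
  qed (use val in auto)
  finally show ?thesis .
qed

lemma mult_closed:
  assumes f: "f \<in> carrier P" and g: "g \<in> carrier P"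
  shows "f \<otimes>\<^bsub>P\<^esub> g \<in> carrier P"
proof -
  have val: "f x \<in> carrier K" "g x \<in> carrier K" for x using f g by (auto simp: P_carrier)
  have closed: "(f \<otimes>\<^bsub>P\<^esub> g) z \<in> carrier K" for z
    unfolding mult_as_finsum[OF f g] using val by (intro K.finsum_closed) auto
  let ?C = "(\<lambda>((u, p, v), (u', q, w)). (u, p @ q, w)) `
      ({x. f x \<noteq> \<zero>\<^bsub>K\<^esub>} \<times> {x. g x \<noteq> \<zero>\<^bsub>K\<^esub>})"
  have sub: "{z. (f \<otimes>\<^bsub>P\<^esub> g) z \<noteq> \<zero>\<^bsub>K\<^esub>} \<subseteq>
      (\<lambda>((u, p, v), (u', q, w)). (u, p @ q, w)) ` ({x. f x \<noteq> \<zero>\<^bsub>K\<^esub>} \<times> {x. g x \<noteq> \<zero>\<^bsub>K\<^esub>}) \<inter> X"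
  proof
    fix z assume "z \<in> {z. (f \<otimes>\<^bsub>P\<^esub> g) z \<noteq> \<zero>\<^bsub>K\<^esub>}"
    then have "(\<Oplus>\<^bsub>K\<^esub>x\<in>factorizations z. f (fst x) \<otimes>\<^bsub>K\<^esub> g (snd x)) \<noteq> \<zero>\<^bsub>K\<^esub>"
      by (simp add: mult_as_finsum[OF f g])
    then have "\<exists>x\<in>factorizations z. f (fst x) \<otimes>\<^bsub>K\<^esub> g (snd x) \<noteq> \<zero>\<^bsub>K\<^esub>"
      using K.add.finprod_one_eqI[of "factorizations z" "\<lambda>x. f (fst x) \<otimes>\<^bsub>K\<^esub> g (snd x)"]
      by blast
    then obtain x where x: "x \<in> factorizations z" "f (fst x) \<otimes>\<^bsub>K\<^esub> g (snd x) \<noteq> \<zero>\<^bsub>K\<^esub>"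
      by blast
    have "f (fst x) \<noteq> \<zero>\<^bsub>K\<^esub>" "g (snd x) \<noteq> \<zero>\<^bsub>K\<^esub>"
      using x(2) val[of "fst x"] val[of "snd x"] by auto
    moreover obtain u p v q w where "x = ((u, p, v), (v, q, w))" "z = (u, p @ q, w)"
      using x(1) by (auto simp: factorizations_def)
    ultimately show "z \<in> (\<lambda>((u, p, v), (u', q, w)). (u, p @ q, w)) `
        ({x. f x \<noteq> \<zero>\<^bsub>K\<^esub>} \<times> {x. g x \<noteq> \<zero>\<^bsub>K\<^esub>}) \<inter> X"
      using factorizations_member(3)[OF x(1)] by (intro IntI image_eqI[where x = x]) auto
  qed
  have "finite {x. f x \<noteq> \<zero>\<^bsub>K\<^esub>}" "finite {x. g x \<noteq> \<zero>\<^bsub>K\<^esub>}"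
    using f g unfolding P_carrier free_vs_carrier by blast+
  then have "finite (?C \<inter> X)" by (intro finite_Int disjI1 finite_imageI finite_cartesian_product)
  then have "finite {z. (f \<otimes>\<^bsub>P\<^esub> g) z \<noteq> \<zero>\<^bsub>K\<^esub>}" by (rule finite_subset[OF sub])
  then show ?thesis unfolding P_carrier free_vs_carrier using sub closed by blast
qed

lemma mult_bilinear: "bilinear_map K P P P (\<lambda>f g. f \<otimes>\<^bsub>P\<^esub> g)"
proof (intro bilinear_mapI linI mult_closed)
  fix f f' g assume *: "f \<in> carrier P" "f' \<in> carrier P" "g \<in> carrier P"
  have val: "f x \<in> carrier K" "f' x \<in> carrier K" "g x \<in> carrier K" for x
    using * by (auto simp: P_carrier)
  have ff: "f \<oplus>\<^bsub>P\<^esub> f' \<in> carrier P" using * by (intro P.a_closed)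
  show "(f \<oplus>\<^bsub>P\<^esub> f') \<otimes>\<^bsub>P\<^esub> g = f \<otimes>\<^bsub>P\<^esub> g \<oplus>\<^bsub>P\<^esub> f' \<otimes>\<^bsub>P\<^esub> g"
  proof
    fix z
    have "((f \<oplus>\<^bsub>P\<^esub> f') \<otimes>\<^bsub>P\<^esub> g) z = (\<Oplus>\<^bsub>K\<^esub>x\<in>factorizations z.
        f (fst x) \<otimes>\<^bsub>K\<^esub> g (snd x) \<oplus>\<^bsub>K\<^esub> f' (fst x) \<otimes>\<^bsub>K\<^esub> g (snd x))"
      unfolding mult_as_finsum[OF ff *(3)]
      by (rule K.finsum_cong') (use val in \<open>auto simp: K.l_distr\<close>)
    also have "\<dots> = (f \<otimes>\<^bsub>P\<^esub> g) z \<oplus>\<^bsub>K\<^esub> (f' \<otimes>\<^bsub>P\<^esub> g) z"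
      unfolding mult_as_finsum[OF *(1,3)] mult_as_finsum[OF *(2,3)]
      by (rule K.finsum_addf) (use val in auto)
    finally show "((f \<oplus>\<^bsub>P\<^esub> f') \<otimes>\<^bsub>P\<^esub> g) z = (f \<otimes>\<^bsub>P\<^esub> g \<oplus>\<^bsub>P\<^esub> f' \<otimes>\<^bsub>P\<^esub> g) z" by simp
  qed
next
  fix f g g' assume *: "f \<in> carrier P" "g \<in> carrier P" "g' \<in> carrier P"
  have val: "f x \<in> carrier K" "g x \<in> carrier K" "g' x \<in> carrier K" for x
    using * by (auto simp: P_carrier)
  have gg: "g \<oplus>\<^bsub>P\<^esub> g' \<in> carrier P" using * by (intro P.a_closed)
  show "f \<otimes>\<^bsub>P\<^esub> (g \<oplus>\<^bsub>P\<^esub> g') = f \<otimes>\<^bsub>P\<^esub> g \<oplus>\<^bsub>P\<^esub> f \<otimes>\<^bsub>P\<^esub> g'"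
  proof
    fix z
    have "(f \<otimes>\<^bsub>P\<^esub> (g \<oplus>\<^bsub>P\<^esub> g')) z = (\<Oplus>\<^bsub>K\<^esub>x\<in>factorizations z.
        f (fst x) \<otimes>\<^bsub>K\<^esub> g (snd x) \<oplus>\<^bsub>K\<^esub> f (fst x) \<otimes>\<^bsub>K\<^esub> g' (snd x))"
      unfolding mult_as_finsum[OF *(1) gg]
      by (rule K.finsum_cong') (use val in \<open>auto simp: K.r_distr\<close>)
    also have "\<dots> = (f \<otimes>\<^bsub>P\<^esub> g) z \<oplus>\<^bsub>K\<^esub> (f \<otimes>\<^bsub>P\<^esub> g') z"
      unfolding mult_as_finsum[OF *(1,2)] mult_as_finsum[OF *(1,3)]
      by (rule K.finsum_addf) (use val in auto)
    finally show "(f \<otimes>\<^bsub>P\<^esub> (g \<oplus>\<^bsub>P\<^esub> g')) z = (f \<otimes>\<^bsub>P\<^esub> g \<oplus>\<^bsub>P\<^esub> f \<otimes>\<^bsub>P\<^esub> g') z" by simp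
  qed
next
  fix c f g assume *: "c \<in> carrier K" "f \<in> carrier P" "g \<in> carrier P"
  have val: "f x \<in> carrier K" "g x \<in> carrier K" for x using * by (auto simp: P_carrier)
  have cf: "c \<odot>\<^bsub>P\<^esub> f \<in> carrier P" and cg: "c \<odot>\<^bsub>P\<^esub> g \<in> carrier P" using * by (intro P.smult_closed; simp)+
  have fg: "c \<otimes>\<^bsub>K\<^esub> (f \<otimes>\<^bsub>P\<^esub> g) z =
      (\<Oplus>\<^bsub>K\<^esub>x\<in>factorizations z. c \<otimes>\<^bsub>K\<^esub> (f (fst x) \<otimes>\<^bsub>K\<^esub> g (snd x)))" for z
    unfolding mult_as_finsum[OF *(2,3)]
    by (rule K.finsum_rdistr[OF factorizations_finite *(1)]) (use val in auto)
  show "c \<odot>\<^bsub>P\<^esub> f \<otimes>\<^bsub>P\<^esub> g = c \<odot>\<^bsub>P\<^esub> (f \<otimes>\<^bsub>P\<^esub> g)"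
  proof
    fix z
    have "(c \<odot>\<^bsub>P\<^esub> f \<otimes>\<^bsub>P\<^esub> g) z =
        (\<Oplus>\<^bsub>K\<^esub>x\<in>factorizations z. c \<otimes>\<^bsub>K\<^esub> (f (fst x) \<otimes>\<^bsub>K\<^esub> g (snd x)))"
      unfolding mult_as_finsum[OF cf *(3)]
      by (rule K.finsum_cong') (use val * in \<open>auto simp: K.m_assoc\<close>)
    then show "(c \<odot>\<^bsub>P\<^esub> f \<otimes>\<^bsub>P\<^esub> g) z = (c \<odot>\<^bsub>P\<^esub> (f \<otimes>\<^bsub>P\<^esub> g)) z" using fg by simp
  qed
  show "f \<otimes>\<^bsub>P\<^esub> (c \<odot>\<^bsub>P\<^esub> g) = c \<odot>\<^bsub>P\<^esub> (f \<otimes>\<^bsub>P\<^esub> g)"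
  proof
    fix z
    have "(f \<otimes>\<^bsub>P\<^esub> (c \<odot>\<^bsub>P\<^esub> g)) z =
        (\<Oplus>\<^bsub>K\<^esub>x\<in>factorizations z. c \<otimes>\<^bsub>K\<^esub> (f (fst x) \<otimes>\<^bsub>K\<^esub> g (snd x)))"
      unfolding mult_as_finsum[OF *(2) cg]
      by (rule K.finsum_cong') (use val * in \<open>auto simp: K.m_ac\<close>)
    then show "(f \<otimes>\<^bsub>P\<^esub> (c \<odot>\<^bsub>P\<^esub> g)) z = (c \<odot>\<^bsub>P\<^esub> (f \<otimes>\<^bsub>P\<^esub> g)) z" using fg by simp
  qed
qed

lemma gen_mult:
  "gen (u, p, v) \<otimes>\<^bsub>P\<^esub> gen (u', q, w) = (if v = u' then gen (u, p @ q, w) else \<zero>\<^bsub>P\<^esub>)"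
proof
  fix z
  have "{((u1, p1, v1), (u1', q1, w1)). gen (u, p, v) (u1, p1, v1) \<noteq> \<zero>\<^bsub>K\<^esub> \<and>
      gen (u', q, w) (u1', q1, w1) \<noteq> \<zero>\<^bsub>K\<^esub> \<and> v1 = u1' \<and> z = (u1, p1 @ q1, w1)} =
      (if v = u' \<and> z = (u, p @ q, w) then {((u, p, v), (u', q, w))} else {})"
    by (auto simp: free_gen_def split: if_splits)
  then show "(gen (u, p, v) \<otimes>\<^bsub>P\<^esub> gen (u', q, w)) z =
      (if v = u' then gen (u, p @ q, w) else \<zero>\<^bsub>P\<^esub>) z"
    by (simp add: path_algebra_def free_gen_def)
qed

lemma gen_assoc:
  "gen x \<otimes>\<^bsub>P\<^esub> gen y \<otimes>\<^bsub>P\<^esub> gen z = gen x \<otimes>\<^bsub>P\<^esub> (gen y \<otimes>\<^bsub>P\<^esub> gen z)"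
  if "x \<in> X" "y \<in> X" "z \<in> X"
proof -
  note zl = lin_zero[OF P_module P_module bilinear_mapD(1)[OF mult_bilinear gen_closed]]
    and zr = lin_zero[OF P_module P_module bilinear_mapD(2)[OF mult_bilinear gen_closed]]
  obtain u p v u' q v' u'' r v'' where "x = (u, p, v)" "y = (u', q, v')" "z = (u'', r, v'')"
    by (metis prod_cases3)
  then show ?thesis
    using zl[OF that(3)] zr[OF that(1)] by (auto simp: gen_mult simp del: P_simps)
qed

text \<open>
  Both sides are linear in each argument, so associativity extends from paths to all elements, one
  argument at a time, starting with the last.
\<close>

lemma mult_assoc:
  assumes f: "f \<in> carrier P" and g: "g \<in> carrier P" and h: "h \<in> carrier P"
  shows "f \<otimes>\<^bsub>P\<^esub> g \<otimes>\<^bsub>P\<^esub> h = f \<otimes>\<^bsub>P\<^esub> (g \<otimes>\<^bsub>P\<^esub> h)"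
proof -
  note l = bilinear_mapD(1)[OF mult_bilinear] and r = bilinear_mapD(2)[OF mult_bilinear]
  have sub: "gen ` X \<subseteq> carrier P" using gen_closed by auto
  note eq = lin_eq_on_span[OF P_module P_module _ _ sub]
  have 1: "gen x \<otimes>\<^bsub>P\<^esub> gen y \<otimes>\<^bsub>P\<^esub> h = gen x \<otimes>\<^bsub>P\<^esub> (gen y \<otimes>\<^bsub>P\<^esub> h)"
    if x: "x \<in> X" and y: "y \<in> X" and h: "h \<in> carrier P" for x y h
  proof (rule eq[of "\<lambda>h. gen x \<otimes>\<^bsub>P\<^esub> gen y \<otimes>\<^bsub>P\<^esub> h" "\<lambda>h. gen x \<otimes>\<^bsub>P\<^esub> (gen y \<otimes>\<^bsub>P\<^esub> h)"])
    show "(\<lambda>h. gen x \<otimes>\<^bsub>P\<^esub> gen y \<otimes>\<^bsub>P\<^esub> h) \<in> linear_maps K P P"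
      by (rule r[OF mult_closed[OF gen_closed[OF x] gen_closed[OF y]]])
    show "(\<lambda>h. gen x \<otimes>\<^bsub>P\<^esub> (gen y \<otimes>\<^bsub>P\<^esub> h)) \<in> linear_maps K P P"
      by (rule lin_comp[OF r[OF gen_closed[OF y]] r[OF gen_closed[OF x]]])
    show "h \<in> P.span (gen ` X)" unfolding P_span by (rule h)
  qed (elim imageE, hypsubst, rule gen_assoc[OF x y])
  have 2: "gen x \<otimes>\<^bsub>P\<^esub> g \<otimes>\<^bsub>P\<^esub> h = gen x \<otimes>\<^bsub>P\<^esub> (g \<otimes>\<^bsub>P\<^esub> h)"
    if x: "x \<in> X" and g: "g \<in> carrier P" and h: "h \<in> carrier P" for x g h
  proof (rule eq[of "\<lambda>g. gen x \<otimes>\<^bsub>P\<^esub> g \<otimes>\<^bsub>P\<^esub> h" "\<lambda>g. gen x \<otimes>\<^bsub>P\<^esub> (g \<otimes>\<^bsub>P\<^esub> h)"])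
    show "(\<lambda>g. gen x \<otimes>\<^bsub>P\<^esub> g \<otimes>\<^bsub>P\<^esub> h) \<in> linear_maps K P P"
      by (rule lin_comp[OF r[OF gen_closed[OF x]] l[OF h]])
    show "(\<lambda>g. gen x \<otimes>\<^bsub>P\<^esub> (g \<otimes>\<^bsub>P\<^esub> h)) \<in> linear_maps K P P"
      by (rule lin_comp[OF l[OF h] r[OF gen_closed[OF x]]])
    show "g \<in> P.span (gen ` X)" unfolding P_span by (rule g)
  qed (elim imageE, hypsubst, rule 1[OF x _ h])
  show ?thesis
  proof (rule eq[of "\<lambda>f. f \<otimes>\<^bsub>P\<^esub> g \<otimes>\<^bsub>P\<^esub> h" "\<lambda>f. f \<otimes>\<^bsub>P\<^esub> (g \<otimes>\<^bsub>P\<^esub> h)"])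
    show "(\<lambda>f. f \<otimes>\<^bsub>P\<^esub> g \<otimes>\<^bsub>P\<^esub> h) \<in> linear_maps K P P"
      by (rule lin_comp[OF l[OF g] l[OF h]])
    show "(\<lambda>f. f \<otimes>\<^bsub>P\<^esub> (g \<otimes>\<^bsub>P\<^esub> h)) \<in> linear_maps K P P"
      by (rule l[OF mult_closed[OF g h]])
    show "f \<in> P.span (gen ` X)" unfolding P_span by (rule f)
  qed (elim imageE, hypsubst, rule 2[OF _ g h])
qed

lemma one_closed: "\<one>\<^bsub>P\<^esub> \<in> carrier P"
proof -
  have supp: "{x. \<one>\<^bsub>P\<^esub> x \<noteq> \<zero>\<^bsub>K\<^esub>} \<subseteq> (\<lambda>v. (v, [], v)) ` verts Q"
    by (auto simp: P_one split: if_splits)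
  have "(\<lambda>v. (v, [], v)) ` verts Q \<subseteq> X"
    by (auto simp: quiver_paths_def awalk_Nil_iff)
  moreover have "finite {x. \<one>\<^bsub>P\<^esub> x \<noteq> \<zero>\<^bsub>K\<^esub>}" by (rule finite_subset[OF supp]) simp
  moreover have "\<one>\<^bsub>P\<^esub> x \<in> carrier K" for x by (simp add: P_one split: prod.split)
  ultimately show ?thesis unfolding P_carrier free_vs_carrier using supp by blast
qed

lemma finsum_one_factorization:
  assumes "i \<in> factorizations z" and "c \<in> carrier K" and "h i = c"
    and "\<And>x. x \<in> factorizations z \<Longrightarrow> x \<noteq> i \<Longrightarrow> h x = \<zero>\<^bsub>K\<^esub>"
  shows "(\<Oplus>\<^bsub>K\<^esub>x\<in>factorizations z. h x) = c"
proof -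
  have "(\<Oplus>\<^bsub>K\<^esub>x\<in>{i}. h x) = (\<Oplus>\<^bsub>K\<^esub>x\<in>factorizations z. h x)"
  proof (rule K.add.finprod_mono_neutral_cong_left[OF factorizations_finite])
    show "h \<in> factorizations z \<rightarrow> carrier K"
      using assms(2-4) by (metis K.zero_closed Pi_I)
  qed (use assms in auto)
  then show ?thesis using assms(2,3) by simp
qed

lemma one_mult:
  assumes f: "f \<in> carrier P"
  shows "\<one>\<^bsub>P\<^esub> \<otimes>\<^bsub>P\<^esub> f = f"
proof
  fix z :: "'v \<times> 'e list \<times> 'v"
  obtain u p w where z: "z = (u, p, w)" by (cases z)
  have fK: "f x \<in> carrier K" for x using f by (simp add: P_carrier)
  show "(\<one>\<^bsub>P\<^esub> \<otimes>\<^bsub>P\<^esub> f) z = f z"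
  proof (cases "z \<in> X")
    case False
    then have "factorizations z = {}" using factorizations_member(3) by blast
    moreover have "f z = \<zero>\<^bsub>K\<^esub>" by (rule free_vs_outside[OF f[unfolded P_carrier] False])
    ultimately show ?thesis by (simp add: mult_as_finsum[OF one_closed f])
  next
    case True
    have u: "u \<in> verts Q" using True by (auto simp: z quiver_paths_def)
    show ?thesis
      unfolding mult_as_finsum[OF one_closed f]
    proof (rule finsum_one_factorization)
      show "((u, [], u), (u, p, w)) \<in> factorizations z"
        using True u by (simp add: factorizations_def z quiver_paths_def awalk_Nil_iff)
      show "\<one>\<^bsub>P\<^esub> (fst ((u, [], u), (u, p, w))) \<otimes>\<^bsub>K\<^esub> f (snd ((u, [], u), (u, p, w))) = f z"
        using u fK by (simp add: P_one z)
      fix x assume x: "x \<in> factorizations z" "x \<noteq> ((u, [], u), (u, p, w))"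
      then obtain r v q where r: "x = ((u, r, v), (v, q, w))" "awalk u r v" "p = r @ q"
        by (auto simp: factorizations_def z quiver_paths_def)
      then have "r \<noteq> []" using x(2) by (auto simp: awalk_Nil_iff)
      then have "\<one>\<^bsub>P\<^esub> (fst x) = \<zero>\<^bsub>K\<^esub>" using r by (simp add: P_one)
      then show "\<one>\<^bsub>P\<^esub> (fst x) \<otimes>\<^bsub>K\<^esub> f (snd x) = \<zero>\<^bsub>K\<^esub>" using fK[of "snd x"] by simp
    qed (rule fK)
  qed
qed

lemma mult_one:
  assumes f: "f \<in> carrier P"
  shows "f \<otimes>\<^bsub>P\<^esub> \<one>\<^bsub>P\<^esub> = f"
proof
  fix z :: "'v \<times> 'e list \<times> 'v"
  obtain u p w where z: "z = (u, p, w)" by (cases z)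
  have fK: "f x \<in> carrier K" for x using f by (simp add: P_carrier)
  show "(f \<otimes>\<^bsub>P\<^esub> \<one>\<^bsub>P\<^esub>) z = f z"
  proof (cases "z \<in> X")
    case False
    then have "factorizations z = {}" using factorizations_member(3) by blast
    moreover have "f z = \<zero>\<^bsub>K\<^esub>" by (rule free_vs_outside[OF f[unfolded P_carrier] False])
    ultimately show ?thesis by (simp add: mult_as_finsum[OF f one_closed])
  next
    case True
    have w: "w \<in> verts Q" using True by (auto simp: z quiver_paths_def)
    show ?thesis
      unfolding mult_as_finsum[OF f one_closed]
    proof (rule finsum_one_factorization)
      show "((u, p, w), (w, [], w)) \<in> factorizations z"
        using True w by (simp add: factorizations_def z quiver_paths_def awalk_Nil_iff)
      show "f (fst ((u, p, w), (w, [], w))) \<otimes>\<^bsub>K\<^esub> \<one>\<^bsub>P\<^esub> (snd ((u, p, w), (w, [], w))) = f z"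
        using w fK by (simp add: P_one z)
      fix x assume x: "x \<in> factorizations z" "x \<noteq> ((u, p, w), (w, [], w))"
      then obtain r v q where r: "x = ((u, r, v), (v, q, w))" "awalk v q w" "p = r @ q"
        by (auto simp: factorizations_def z quiver_paths_def)
      then have "q \<noteq> []" using x(2) by (auto simp: awalk_Nil_iff)
      then have "\<one>\<^bsub>P\<^esub> (snd x) = \<zero>\<^bsub>K\<^esub>" using r by (simp add: P_one)
      then show "f (fst x) \<otimes>\<^bsub>K\<^esub> \<one>\<^bsub>P\<^esub> (snd x) = \<zero>\<^bsub>K\<^esub>" using fK[of "fst x"] by simp
    qed (rule fK)
  qed
qed

lemma P_algebra: "assoc_algebra K P"
proof -
  note l = bilinear_mapD(1)[OF mult_bilinear] and r = bilinear_mapD(2)[OF mult_bilinear]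
  show ?thesis
  proof (intro assoc_algebra.intro assoc_algebra_axioms.intro P_module ringI)
    show "abelian_group P" by (rule P.abelian_group_axioms)
    show "Group.monoid P"
      by (intro monoidI mult_closed one_closed mult_assoc one_mult mult_one)
  qed (use lin_add[OF l] lin_add[OF r] lin_smult[OF l] lin_smult[OF r] in \<open>simp_all del: P_simps\<close>)
qed

end

section \<open>The cyclic quiver\<close>

locale cyclic_gentle = K: field K
  for K :: "('k, 'r) ring_scheme" +
  fixes m t :: nat and n :: "nat \<Rightarrow> nat"
  assumes m: "m \<ge> 1" and t: "t \<ge> 1" and n: "\<And>i. i \<in> {1..m} \<Longrightarrow> n i = t"
begin

abbreviation Q where "Q \<equiv> cyc_quiver m n"

text \<open>
  The vertex at position \<open>a\<close> of the \<open>i\<close>-th block \<open>\<alpha>\<^sup>i\<^sub>1 \<dots> \<alpha>\<^sup>i\<^sub>t\<close>, with positions counted from \<open>0\<close>, so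
  that \<open>\<alpha>\<^sup>i\<^sub>j\<close> goes from position \<open>j - 1\<close> to position \<open>j\<close>. The last position of a block is the
  first one of the next block; after the last block the numbering starts again at \<open>1\<close>.
\<close>

definition vtx :: "nat \<Rightarrow> nat \<Rightarrow> nat" where
  "vtx i a = (if i = m \<and> a = t then 1 else (i - 1) * t + a + 1)"

definition succ :: "nat \<Rightarrow> nat" where
  "succ i = (if i = m then 1 else i + 1)"

lemma succ_range: "i \<in> {1..m} \<Longrightarrow> succ i \<in> {1..m}"
  using m by (auto simp: succ_def)

lemma succ_inj: "i \<in> {1..m} \<Longrightarrow> i' \<in> {1..m} \<Longrightarrow> succ i = succ i' \<Longrightarrow> i = i'"
  by (cases "i = m"; cases "i' = m"; simp add: succ_def)

lemma sum_n: "k \<le> m \<Longrightarrow> (\<Sum>i\<in>{1..k}. n i) = k * t"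
  using n by (induct k) auto

lemma tail_Q: "i \<in> {1..m} \<Longrightarrow> j \<in> {1..t} \<Longrightarrow> tail Q (i, j) = vtx i (j - 1)"
  using sum_n[of "i - 1"] atLeastLessThanSuc_atLeastAtMost[of 1 "i - 1"]
  by (auto simp: cyc_quiver_def cyc_tail_def vtx_def)

lemma head_Q:
  assumes "i \<in> {1..m}" and "j \<in> {1..t}"
  shows "head Q (i, j) = vtx i j"
proof -
  have tl: "cyc_tail n (i, j) = (i - 1) * t + j"
    using tail_Q[OF assms] assms by (auto simp: cyc_quiver_def vtx_def split: if_splits)
  have "(i - 1) * t + j = m * t \<longleftrightarrow> i = m \<and> j = t"
  proof
    assume eq: "(i - 1) * t + j = m * t"
    have "i = m"
    proof (rule ccontr)
      assume "i \<noteq> m"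
      then have "i * t + t \<le> m * t" using assms(1) mult_le_mono1[of "i + 1" m t] by simp
      moreover have "(i - 1) * t + t = i * t" using assms(1) by (cases i) auto
      ultimately show False using eq assms(2) t by simp
    qed
    moreover have "(m - 1) * t + t = m * t" using m by (cases m) auto
    ultimately show "i = m \<and> j = t" using eq by simp
  next
    assume "i = m \<and> j = t"
    then show "(i - 1) * t + j = m * t" using m by (cases m) auto
  qed
  then show ?thesis
    using sum_n[of m] tl by (auto simp: cyc_quiver_def cyc_head_def vtx_def)
qed

lemma arcs_Q: "arcs Q = {(i, j). i \<in> {1..m} \<and> j \<in> {1..t}}"
  using n by (auto simp: cyc_quiver_def)

lemma verts_Q: "verts Q = {1..m * t}"
  using sum_n[of m] by (simp add: cyc_quiver_def)

lemma vtx_in_verts: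
  assumes "i \<in> {1..m}" and "a \<le> t"
  shows "vtx i a \<in> verts Q"
proof (cases "i = m \<and> a = t")
  case True
  then show ?thesis using m t by (auto simp: verts_Q vtx_def)
next
  case False
  have "(i - 1) * t + a < m * t"
  proof (cases "i = m")
    case True
    then have "a < t" using False assms(2) by simp
    moreover have "(m - 1) * t + t = m * t" using m by (cases m) auto
    ultimately show ?thesis using True by simp
  next
    case False
    then have "i * t + t \<le> m * t" using assms(1) mult_le_mono1[of "i + 1" m t] by simp
    moreover have "(i - 1) * t + t = i * t" using assms(1) by (cases i) auto
    ultimately show ?thesis using assms(2) t by simp
  qed
  then show ?thesis using False by (auto simp: verts_Q vtx_def)
qed

lemma vtx_interior_eq:
  assumes "i \<in> {1..m}" "i' \<in> {1..m}" "a < t" "a' < t"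
  shows "vtx i a = vtx i' a' \<longleftrightarrow> i = i' \<and> a = a'"
proof
  assume "vtx i a = vtx i' a'"
  then have eq: "(i - 1) * t + a = (i' - 1) * t + a'" using assms by (simp add: vtx_def)
  have "((i - 1) * t + a) div t = i - 1" "((i' - 1) * t + a') div t = i' - 1"
    using assms by simp_all
  then have "i - 1 = i' - 1" using eq by simp
  with eq assms show "i = i' \<and> a = a'" by auto
qed auto

lemma vtx_junction: "i \<in> {1..m} \<Longrightarrow> vtx i t = vtx (succ i) 0"
  using t by (cases i) (auto simp: vtx_def succ_def)

lemma vtx_end_eq_start:
  assumes "i \<in> {1..m}" "i' \<in> {1..m}" "1 \<le> b" "b \<le> t" "a < t"
  shows "vtx i b = vtx i' a \<longleftrightarrow> i = i' \<and> b = a \<or> b = t \<and> a = 0 \<and> i' = succ i"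
proof (cases "b = t")
  case True
  then show ?thesis
    using assms vtx_junction[OF assms(1)] vtx_interior_eq[of "succ i" i' 0 a] succ_range[OF assms(1)] by auto
next
  case False
  then show ?thesis using assms vtx_interior_eq[of i i' b a] by auto
qed

lemma vtx_start_eq:
  assumes "i \<in> {1..m}" "i' \<in> {1..m}" "a < t"
  shows "vtx i' 0 = vtx i a \<longleftrightarrow> i = i' \<and> a = 0"
  using vtx_interior_eq[OF assms(2,1) _ assms(3), of 0] t by auto

lemma vtx_end_eq:
  assumes "i \<in> {1..m}" "i' \<in> {1..m}" "1 \<le> b" "b \<le> t"
  shows "vtx i b = vtx i' t \<longleftrightarrow> i = i' \<and> b = t"
proof -
  have "vtx i b = vtx i' t \<longleftrightarrow> b = t \<and> succ i' = succ i"
    unfolding vtx_junction[OF assms(2)]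
    using vtx_end_eq_start[OF assms(1) succ_range[OF assms(2)] assms(3,4), of 0] t assms(3) by simp
  then show ?thesis using succ_inj[OF assms(1,2)] by metis
qed

lemma finite_Q: "fin_digraph Q"
proof
  show "finite (verts Q)" by (simp add: verts_Q)
  have "arcs Q = {1..m} \<times> {1..t}" by (auto simp: arcs_Q)
  then show "finite (arcs Q)" by simp
next
  fix e assume "e \<in> arcs Q"
  then obtain i j where e: "e = (i, j)" "i \<in> {1..m}" "j \<in> {1..t}" by (auto simp: arcs_Q)
  then show "tail Q e \<in> verts Q" "head Q e \<in> verts Q"
    using vtx_in_verts[of i "j - 1"] vtx_in_verts[of i j] le_diff_conv
    by (auto simp: tail_Q head_Q)
qed

sublocale path_algebra_over_field K Q
  by (intro path_algebra_over_field.intro finite_Q K.field_axioms)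

section \<open>Paths inside a block\<close>

text \<open>
  The path from position \<open>a\<close> to position \<open>b\<close> of block \<open>i\<close>, trivial for \<open>a = b\<close>. A junction has
  two such descriptions as a trivial path, \<open>pth i t t\<close> and \<open>pth (succ i) 0 0\<close>.
\<close>

definition pth :: "nat \<Rightarrow> nat \<Rightarrow> nat \<Rightarrow> nat \<times> (nat \<times> nat) list \<times> nat" where
  "pth i a b = (vtx i a, map (Pair i) [Suc a..<Suc b], vtx i b)"

text \<open>
  A path is crossing when it contains one of the generating relations. The others are the paths
  that stay inside a block, and their classes form a basis of the algebra.
\<close>

definition crossing :: "(nat \<times> nat) list \<Rightarrow> bool" where
  "crossing p \<longleftrightarrow> (\<exists>p1 i p2. i \<in> {1..m} \<and> p = p1 @ [(i, t), (succ i, 1)] @ p2)"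

definition block_paths :: "(nat \<times> (nat \<times> nat) list \<times> nat) set" where
  "block_paths = {pth i a b | i a b. i \<in> {1..m} \<and> a \<le> b \<and> b \<le> t}"

lemma block_pathsI: "i \<in> {1..m} \<Longrightarrow> a \<le> b \<Longrightarrow> b \<le> t \<Longrightarrow> pth i a b \<in> block_paths"
  by (auto simp: block_paths_def)

lemma pth_step: "a < b \<Longrightarrow> map (Pair i) [Suc a..<Suc b] = (i, Suc a) # map (Pair i) [Suc (Suc a)..<Suc b]"
  by (simp add: upt_conv_Cons del: upt_Suc)

lemma pth_awalk:
  assumes "i \<in> {1..m}" and "a \<le> b" and "b \<le> t"
  shows "pth i a b \<in> X"
  using assms(2)
proof (induct a rule: inc_induct)
  case base
  then show ?case using vtx_in_verts[OF assms(1,3)]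
    by (simp add: pth_def quiver_paths_def awalk_Nil_iff)
next
  case (step a)
  then show ?case
    using assms tail_Q[OF assms(1), of "Suc a"] head_Q[OF assms(1), of "Suc a"]
    unfolding pth_def pth_step[OF step(2)]
    by (simp add: quiver_paths_def awalk_Cons_iff arcs_Q del: upt_Suc)
qed

lemma block_paths_subset: "block_paths \<subseteq> X"
  using pth_awalk by (auto simp: block_paths_def)

lemma pth_not_crossing: "\<not> crossing (map (Pair i) [Suc a..<Suc b])"
proof
  assume "crossing (map (Pair i) [Suc a..<Suc b])"
  then obtain p1 k p2 where eq: "map (Pair i) [Suc a..<Suc b] = p1 @ [(k, t), (succ k, 1)] @ p2"
    by (auto simp: crossing_def)
  let ?l = "length p1"
  have len: "Suc ?l < b - a" using arg_cong[OF eq, of length] by (simp del: upt_Suc)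
  have "map (Pair i) [Suc a..<Suc b] ! ?l = (k, t)" "map (Pair i) [Suc a..<Suc b] ! Suc ?l = (succ k, 1)"
    unfolding eq by (simp_all add: nth_append)
  moreover have "[Suc a..<Suc b] ! ?l = Suc a + ?l" "[Suc a..<Suc b] ! Suc ?l = Suc a + Suc ?l"
    using len by (intro nth_upt; simp)+
  ultimately have "Suc a + ?l = t" "Suc a + Suc ?l = 1" using len by (simp_all del: upt_Suc)
  then show False using t by simp
qed

text \<open>
  Prepend one arrow at a time. An arrow \<open>\<alpha>\<^sup>i\<^sub>j\<close> in front of a nontrivial path that stays inside a
  block either extends it within the block, or \<open>j = t\<close> and the path starts with the first arrow of
  the next block.
\<close>

lemma block_path_or_crossing:
  assumes "awalk u p v"
  shows "(u, p, v) \<in> block_paths \<or> crossing p"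
  using assms
proof (induct p arbitrary: u)
  case Nil
  then have u: "u = v" "u \<in> {1..m * t}" by (auto simp: awalk_Nil_iff verts_Q)
  \<comment> \<open>block and position of the vertex \<open>u\<close>\<close>
  let ?i = "(u - 1) div t + 1" and ?a = "(u - 1) mod t"
  have "(u - 1) div t < m" using u t less_mult_imp_div_less[of "u - 1" m t] by auto
  then have i: "?i \<in> {1..m}" by auto
  have a: "?a < t" using t by simp
  have "vtx ?i ?a = u"
    using a u div_mult_mod_eq[of "u - 1" t] by (simp add: vtx_def)
  then have "(u, [], v) = pth ?i ?a ?a" using u by (simp add: pth_def)
  then show ?case using block_pathsI[OF i, of ?a ?a] a by simp
next
  case (Cons e p)
  obtain i j where e: "e = (i, j)" "i \<in> {1..m}" "j \<in> {1..t}"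
    using Cons(2) by (auto simp: awalk_Cons_iff arcs_Q)
  have u: "u = vtx i (j - 1)" and p: "awalk (vtx i j) p v"
    using Cons(2) e tail_Q head_Q by (auto simp: awalk_Cons_iff)
  from Cons(1)[OF p] show ?case
  proof
    assume "crossing p"
    then obtain p1 k p2 where "k \<in> {1..m}" "p = p1 @ [(k, t), (succ k, 1)] @ p2" by (auto simp: crossing_def)
    then have "crossing (e # p)" unfolding crossing_def by (intro exI[of _ "e # p1"] exI[of _ k] exI[of _ p2]) simp
    then show ?thesis ..
  next
    assume "(vtx i j, p, v) \<in> block_paths"
    then obtain i' a b where g: "i' \<in> {1..m}" "a \<le> b" "b \<le> t" "(vtx i j, p, v) = pth i' a b"
      by (auto simp: block_paths_def)
    show ?thesis
    proof (cases "a = b")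
      case True
      then have "p = []" "v = vtx i j" using g by (auto simp: pth_def)
      then have "(u, e # p, v) = pth i (j - 1) j"
        using e u by (simp add: pth_def upt_conv_Cons del: upt_Suc)
      then show ?thesis using block_pathsI[of i "j - 1" j] e by simp
    next
      case False
      then have ab: "a < b" using g by simp
      have "vtx i j = vtx i' a" "p = map (Pair i') [Suc a..<Suc b]" "v = vtx i' b"
        using g by (auto simp: pth_def)
      moreover from this(1) have "i = i' \<and> j = a \<or> j = t \<and> a = 0 \<and> i' = succ i"
        using vtx_end_eq_start[of i i' j a] e g ab by auto
      ultimately show ?thesis
      proof (elim disjE conjE)
        assume *: "i = i'" "j = a" "p = map (Pair i') [Suc a..<Suc b]" "v = vtx i' b"
        then have "(u, e # p, v) = pth i (j - 1) b"
          using e u ab by (simp add: pth_def upt_conv_Cons del: upt_Suc)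
        then show ?thesis using block_pathsI[of i "j - 1" b] e g ab * by simp
      next
        assume *: "j = t" "a = 0" "i' = succ i" "p = map (Pair i') [Suc a..<Suc b]"
        have "e # p = [] @ [(i, t), (succ i, 1)] @ map (Pair i') [Suc (Suc a)..<Suc b]"
          using * e pth_step[OF ab, of i'] by simp
        then have "crossing (e # p)" using e(2) unfolding crossing_def by blast
        then show ?thesis ..
      qed
    qed
  qed
qed

section \<open>The gentle algebra\<close>

abbreviation I where "I \<equiv> cyc_ideal K m n"
abbreviation A where "A \<equiv> cyc_algebra K m n"

interpretation P: assoc_algebra K P by (rule P_algebra)

lemma ideal_generators:
  "cyc_ideal K m n = Idl\<^bsub>P\<^esub> {gen (vtx i (t - 1), [(i, t), (succ i, 1)], vtx (succ i) 1) | i. i \<in> {1..m}}"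
    (is "_ = Idl\<^bsub>P\<^esub> ?S")
proof -
  have rel: "arrow_pair K Q (i, n i) (succ i, 1) = gen (vtx i (t - 1), [(i, t), (succ i, 1)], vtx (succ i) 1)"
    if "i \<in> {1..m}" for i
    using that n t succ_range[OF that] by (simp add: arrow_pair_def tail_Q head_Q)
  have "{arrow_pair K Q (m, n m) (1, 1)} \<union> {arrow_pair K Q (i, n i) (i + 1, 1) | i. i \<in> {1..<m}} =
      (\<lambda>i. arrow_pair K Q (i, n i) (succ i, 1)) ` {1..m}"
  proof -
    have "{1..m} = insert m {1..<m}" using m by auto
    then show ?thesis by (auto simp: succ_def)
  qed
  also have "\<dots> = ?S" using rel by (auto simp: image_iff)
  finally show ?thesis by (simp add: cyc_ideal_def)
qed

lemma relations_closed:
  "{gen (vtx i (t - 1), [(i, t), (succ i, 1)], vtx (succ i) 1) | i. i \<in> {1..m}} \<subseteq> carrier P"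
proof clarify
  fix i assume i: "i \<in> {1..m}"
  show "gen (vtx i (t - 1), [(i, t), (succ i, 1)], vtx (succ i) 1) \<in> carrier P"
    using i t succ_range[OF i] vtx_in_verts[OF succ_range[OF i], of 1]
    by (intro gen_closed)
      (simp add: quiver_paths_def awalk_Cons_iff awalk_Nil_iff arcs_Q tail_Q head_Q vtx_junction)
qed

lemma I_ideal: "ideal I P"
  unfolding ideal_generators by (rule P.R.genideal_ideal[OF relations_closed])

lemma crossing_append: "crossing p \<Longrightarrow> crossing (p @ q)" "crossing q \<Longrightarrow> crossing (p @ q)"
proof -
  assume "crossing p"
  then obtain p1 i p2 where "i \<in> {1..m}" "p = p1 @ [(i, t), (succ i, 1)] @ p2"
    by (auto simp: crossing_def)
  then show "crossing (p @ q)"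
    unfolding crossing_def by (intro exI[of _ p1] exI[of _ i] exI[of _ "p2 @ q"]) simp
next
  assume "crossing q"
  then obtain p1 i p2 where "i \<in> {1..m}" "q = p1 @ [(i, t), (succ i, 1)] @ p2"
    by (auto simp: crossing_def)
  then show "crossing (p @ q)"
    unfolding crossing_def by (intro exI[of _ "p @ p1"] exI[of _ i] exI[of _ p2]) simp
qed

text \<open>
  The elements supported on crossing paths form an ideal, as a product of two paths is crossing when
  one of them is, and this ideal contains the generators.
\<close>

lemma I_supported_on_crossing:
  assumes "f \<in> I" and "f (u, p, v) \<noteq> \<zero>\<^bsub>K\<^esub>"
  shows "crossing p"
proof -
  let ?J = "{f \<in> carrier P. \<forall>u p v. f (u, p, v) \<noteq> \<zero>\<^bsub>K\<^esub> \<longrightarrow> crossing p}"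
  have mult_J: "f \<otimes>\<^bsub>P\<^esub> g \<in> ?J"
    if f: "f \<in> carrier P" and g: "g \<in> carrier P" and fg: "f \<in> ?J \<or> g \<in> ?J" for f g
  proof -
    have "crossing p" if nz: "(f \<otimes>\<^bsub>P\<^esub> g) (u, p, v) \<noteq> \<zero>\<^bsub>K\<^esub>" for u p v
    proof (rule ccontr)
      assume nb: "\<not> crossing p"
      have "f (fst x) \<otimes>\<^bsub>K\<^esub> g (snd x) = \<zero>\<^bsub>K\<^esub>" if x: "x \<in> factorizations (u, p, v)" for x
      proof -
        obtain q w r where x': "x = ((u, q, w), (w, r, v))" "p = q @ r"
          using x by (auto simp: factorizations_def)
        then have "\<not> crossing q" "\<not> crossing r" using nb crossing_append by blast+
        then have "f (fst x) = \<zero>\<^bsub>K\<^esub> \<or> g (snd x) = \<zero>\<^bsub>K\<^esub>" using fg x' by auto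
        moreover have "f (fst x) \<in> carrier K" "g (snd x) \<in> carrier K" using f g by (simp_all add: P_carrier)
        ultimately show ?thesis by auto
      qed
      then have "(f \<otimes>\<^bsub>P\<^esub> g) (u, p, v) = \<zero>\<^bsub>K\<^esub>"
        unfolding mult_as_finsum[OF f g] by (rule K.add.finprod_one_eqI)
      with nz show False by simp
    qed
    then show ?thesis using mult_closed[OF f g] by blast
  qed
  have G: "abelian_group P" by (rule ring.is_abelian_group[OF P.R.ring_axioms])
  note zero = abelian_monoid.zero_closed[OF abelian_group.axioms(1)[OF G]]
    and add = abelian_monoid.a_closed[OF abelian_group.axioms(1)[OF G]]
    and neg = abelian_group.a_inv_closed[OF G]
  have "ideal ?J P"
  proof (rule idealI)
    show "ring P" by (rule P.R.ring_axioms)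
    show "subgroup ?J (add_monoid P)"
    proof (rule group.subgroupI[OF abelian_group.a_group[OF G]])
      have "\<zero>\<^bsub>P\<^esub> \<in> ?J" using zero by simp
      then show "?J \<noteq> {}" by blast
      fix f assume f: "f \<in> ?J"
      then have fP: "f \<in> carrier P" by simp
      have "\<ominus>\<^bsub>P\<^esub> f = (\<ominus>\<^bsub>K\<^esub> \<one>\<^bsub>K\<^esub>) \<odot>\<^bsub>P\<^esub> f"
        using P.M.smult_l_minus[OF K.one_closed fP] P.M.smult_one[OF fP] by (simp only:)
      then have "\<ominus>\<^bsub>P\<^esub> f = (\<lambda>z. \<ominus>\<^bsub>K\<^esub> \<one>\<^bsub>K\<^esub> \<otimes>\<^bsub>K\<^esub> f z)" by (simp only: P_simps)
      then have nz: "f z \<noteq> \<zero>\<^bsub>K\<^esub>" if "(\<ominus>\<^bsub>P\<^esub> f) z \<noteq> \<zero>\<^bsub>K\<^esub>" for z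
        using that by auto
      show "inv\<^bsub>add_monoid P\<^esub> f \<in> ?J"
        unfolding a_inv_def[symmetric] using f neg[OF fP] nz by blast
    next
      fix f g assume fg: "f \<in> ?J" "g \<in> ?J"
      then have "f \<in> carrier P" "g \<in> carrier P" by auto
      note fgP = add[OF this]
      have nz: "f z \<noteq> \<zero>\<^bsub>K\<^esub> \<or> g z \<noteq> \<zero>\<^bsub>K\<^esub>" if "(f \<oplus>\<^bsub>P\<^esub> g) z \<noteq> \<zero>\<^bsub>K\<^esub>" for z
        using that by auto
      have "f \<oplus>\<^bsub>P\<^esub> g \<in> ?J" using fg fgP nz by blast
      then show "f \<otimes>\<^bsub>add_monoid P\<^esub> g \<in> ?J" by (simp only: monoid.simps)
    qed auto
  qed (use mult_J in blast)+
  moreover have "{gen (vtx i (t - 1), [(i, t), (succ i, 1)], vtx (succ i) 1) | i. i \<in> {1..m}} \<subseteq> ?J"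
  proof -
    have "crossing [(i, t), (succ i, 1)]" if "i \<in> {1..m}" for i
      unfolding crossing_def using that by (intro exI[of _ "[]"] exI[of _ i]) simp
    then show ?thesis using relations_closed by (auto simp: free_gen_def split: if_splits)
  qed
  ultimately have "I \<subseteq> ?J" unfolding ideal_generators by (rule P.R.genideal_minimal)
  then show ?thesis using assms by blast
qed

lemma A_algebra: "assoc_algebra K A"
  unfolding cyc_algebra_def by (rule P.quotient_algebra[OF I_ideal])

sublocale A: assoc_algebra K A by (rule A_algebra)

interpretation Quo: module_quotient K P I
  by (intro module_quotient.intro module_quotient_axioms.intro P_module P.ideal_submodule I_ideal)

interpretation I: ideal I P by (rule I_ideal)

definition cls :: "nat \<times> (nat \<times> nat) list \<times> nat \<Rightarrow> (nat \<times> (nat \<times> nat) list \<times> nat \<Rightarrow> 'k) set" where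
  "cls z = Quo.proj (gen z)"

lemma cls_closed: "z \<in> X \<Longrightarrow> cls z \<in> carrier A"
  unfolding cls_def cyc_algebra_def by (intro Quo.proj_carrier gen_closed)

text \<open>
  Cutting \<open>p\<close> before and after the relation that it contains writes it as a multiple of a generator.
\<close>

lemma cls_crossing:
  assumes "awalk u p v" and "crossing p"
  shows "cls (u, p, v) = \<zero>\<^bsub>A\<^esub>"
proof -
  obtain p1 i p2 where i: "i \<in> {1..m}" and p: "p = p1 @ [(i, t), (succ i, 1)] @ p2"
    using assms(2) by (auto simp: crossing_def)
  let ?r = "(vtx i (t - 1), [(i, t), (succ i, 1)], vtx (succ i) 1)"
  have w: "awalk u p1 (vtx i (t - 1))" "awalk (vtx (succ i) 1) p2 v"
    using assms(1) i t succ_range[OF i]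
    by (auto simp: p awalk_append_iff awalk_Cons_iff tail_Q head_Q)
  have "gen ?r \<in> I"
    unfolding ideal_generators using P.R.genideal_self[OF relations_closed] i by blast
  then have "gen (u, p1, vtx i (t - 1)) \<otimes>\<^bsub>P\<^esub> gen ?r \<otimes>\<^bsub>P\<^esub> gen (vtx (succ i) 1, p2, v) \<in> I"
    using w by (intro I.I_r_closed I.I_l_closed gen_closed) (simp_all add: quiver_paths_def)
  then have "gen (u, p, v) \<in> I" by (simp add: gen_mult p)
  then show ?thesis
    by (simp add: cls_def cyc_algebra_def quot_module_simps(2) Quo.a_rcos_const)
qed

lemma cls_mult:
  assumes "(u, p, v) \<in> X" and "(u', q, w) \<in> X"
  shows "cls (u, p, v) \<otimes>\<^bsub>A\<^esub> cls (u', q, w) = (if v = u' then cls (u, p @ q, w) else \<zero>\<^bsub>A\<^esub>)"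
proof -
  have "cls (u, p, v) \<otimes>\<^bsub>A\<^esub> cls (u', q, w) = Quo.proj (gen (u, p, v) \<otimes>\<^bsub>P\<^esub> gen (u', q, w))"
    using I.rcoset_mult_add[OF gen_closed[OF assms(1)] gen_closed[OF assms(2)]]
    by (simp add: cls_def cyc_algebra_def quot_module_def FactRing_def)
  then show ?thesis
    using Quo.proj_zero by (simp add: gen_mult cls_def cyc_algebra_def del: P_simps)
qed

lemma cls_span: "A.M.span (cls ` block_paths) = carrier A"
proof -
  have sub: "cls ` block_paths \<subseteq> carrier A" using block_paths_subset cls_closed by blast
  interpret S: LinearCombinations.submodule K "A.M.span (cls ` block_paths)" A
    by (rule A.M.span_is_submodule[OF sub])
  have gen_sub: "gen ` X \<subseteq> carrier P" using gen_closed by blast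
  have "cls ` X = Quo.proj ` gen ` X" by (simp add: image_image cls_def[abs_def])
  then have all: "A.M.span (cls ` X) = carrier A"
    using Quo.quot_span[OF gen_sub P_span] by (simp only: cyc_algebra_def)
  have "cls z \<in> A.M.span (cls ` block_paths)" if "z \<in> X" for z
  proof (cases "z \<in> block_paths")
    case True
    then show ?thesis using A.M.in_own_span[OF sub] by blast
  next
    case False
    obtain u p v where z: "z = (u, p, v)" by (cases z)
    then have "cls z = \<zero>\<^bsub>A\<^esub>" using False block_path_or_crossing[of u p v] cls_crossing that by (auto simp: quiver_paths_def)
    then show ?thesis by simp
  qed
  then have "A.M.span (cls ` X) \<subseteq> A.M.span (cls ` block_paths)"
    by (intro A.M.span_is_subset[OF _ S.submodule_axioms]) auto
  then show ?thesis using all A.M.span_is_subset2[OF sub] by auto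
qed

interpretation AA: module_pair K A A by (intro module_pair.intro A.A)

section \<open>Coordinates\<close>

abbreviation F where "F \<equiv> free_vs K UNIV"

lemma F_module: "Module.module K F"
  by (rule free_vs_module[OF Kc])

text \<open>
  The coordinates along block paths. Elements of the ideal have none, so these coordinates are
  defined on the quotient.
\<close>

definition block_part :: "(nat \<times> (nat \<times> nat) list \<times> nat \<Rightarrow> 'k) \<Rightarrow> nat \<times> (nat \<times> nat) list \<times> nat \<Rightarrow> 'k" where
  "block_part f = (\<lambda>z. if z \<in> block_paths then f z else \<zero>\<^bsub>K\<^esub>)"

lemma block_part_linear: "block_part \<in> linear_maps K P F"
proof (rule linI)
  fix f assume f: "f \<in> carrier P"
  have "{z. block_part f z \<noteq> \<zero>\<^bsub>K\<^esub>} \<subseteq> {z. f z \<noteq> \<zero>\<^bsub>K\<^esub>}" by (auto simp: block_part_def)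
  moreover have "finite {z. f z \<noteq> \<zero>\<^bsub>K\<^esub>}" using f unfolding P_carrier free_vs_carrier by blast
  ultimately have "finite {z. block_part f z \<noteq> \<zero>\<^bsub>K\<^esub>}" by (rule finite_subset)
  moreover have "block_part f z \<in> carrier K" for z using f by (simp add: block_part_def P_carrier)
  ultimately show "block_part f \<in> carrier F" unfolding free_vs_carrier by blast
qed (auto simp: block_part_def)

lemma block_part_null:
  assumes "f \<in> I"
  shows "block_part f = \<zero>\<^bsub>F\<^esub>"
proof -
  have "f z = \<zero>\<^bsub>K\<^esub>" if good: "z \<in> block_paths" for z
  proof -
    obtain i a b where "z = pth i a b" using good by (auto simp: block_paths_def)
    then show ?thesis
      using I_supported_on_crossing[OF assms] pth_not_crossing[of i a b] unfolding pth_def by blast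
  qed
  then show ?thesis by (simp add: block_part_def fun_eq_iff)
qed

definition coord :: "(nat \<times> (nat \<times> nat) list \<times> nat \<Rightarrow> 'k) set \<Rightarrow> nat \<times> (nat \<times> nat) list \<times> nat \<Rightarrow> 'k" where
  "coord a = block_part (SOME f. f \<in> a)"

lemma coord_linear: "coord \<in> linear_maps K A F"
  unfolding coord_def[abs_def] cyc_algebra_def
  by (rule Quo.quot_lift_linear[OF F_module block_part_linear block_part_null])

lemma coord_cls:
  assumes "z \<in> block_paths"
  shows "coord (cls z) w = (if w = z then \<one>\<^bsub>K\<^esub> else \<zero>\<^bsub>K\<^esub>)"
proof -
  have "coord (cls z) = block_part (gen z)"
    unfolding coord_def cls_def using assms block_paths_subset
    by (intro Quo.quot_lift_proj[OF F_module block_part_linear block_part_null] gen_closed) auto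
  then show ?thesis using assms by (simp add: block_part_def free_gen_def)
qed

definition coord2 where
  "coord2 = tensor_lift K F (\<lambda>x y. \<lambda>(p, q). coord x p \<otimes>\<^bsub>K\<^esub> coord y q)"

lemma coord_product_bilinear: "bilinear_map K A A F (\<lambda>x y. \<lambda>(p, q). coord x p \<otimes>\<^bsub>K\<^esub> coord y q)"
proof -
  have val: "coord x p \<in> carrier K" if "x \<in> carrier A" for x p
    using lin_carrier[OF coord_linear that] by simp
  have closed: "(\<lambda>(p, q). coord x p \<otimes>\<^bsub>K\<^esub> coord y q) \<in> carrier F"
    if x: "x \<in> carrier A" and y: "y \<in> carrier A" for x y
  proof -
    have "finite {p. coord x p \<noteq> \<zero>\<^bsub>K\<^esub>}" "finite {p. coord y p \<noteq> \<zero>\<^bsub>K\<^esub>}"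
      using lin_carrier[OF coord_linear x] lin_carrier[OF coord_linear y]
      unfolding free_vs_carrier by blast+
    then have "finite ({p. coord x p \<noteq> \<zero>\<^bsub>K\<^esub>} \<times> {p. coord y p \<noteq> \<zero>\<^bsub>K\<^esub>})" by (rule finite_cartesian_product)
    moreover have "{pq. (\<lambda>(p, q). coord x p \<otimes>\<^bsub>K\<^esub> coord y q) pq \<noteq> \<zero>\<^bsub>K\<^esub>}
        \<subseteq> {p. coord x p \<noteq> \<zero>\<^bsub>K\<^esub>} \<times> {p. coord y p \<noteq> \<zero>\<^bsub>K\<^esub>}"
      using val[OF x] val[OF y] by auto
    ultimately have "finite {pq. (\<lambda>(p, q). coord x p \<otimes>\<^bsub>K\<^esub> coord y q) pq \<noteq> \<zero>\<^bsub>K\<^esub>}"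
      by (rule rev_finite_subset)
    moreover have "(\<lambda>(p, q). coord x p \<otimes>\<^bsub>K\<^esub> coord y q) pq \<in> carrier K" for pq
      using val[OF x] val[OF y] by (simp add: case_prod_beta)
    ultimately show ?thesis unfolding free_vs_carrier by blast
  qed
  note add = lin_add[OF coord_linear] and smult = lin_smult[OF coord_linear]
  show ?thesis
    by (intro bilinear_mapI linI closed)
      (auto simp: fun_eq_iff add smult val K.l_distr K.r_distr K.m_assoc K.m_lcomm)
qed

lemma coord2_linear: "coord2 \<in> linear_maps K A.AA F"
  unfolding coord2_def by (rule AA.tensor_lift_linear[OF F_module coord_product_bilinear])

lemma coord2_pt:
  assumes "z \<in> block_paths" and "w \<in> block_paths"
  shows "coord2 (A.pt (cls z) (cls w)) (p, q) = (if p = z \<and> q = w then \<one>\<^bsub>K\<^esub> else \<zero>\<^bsub>K\<^esub>)"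
proof -
  have "cls z \<in> carrier A" "cls w \<in> carrier A" using assms block_paths_subset cls_closed by blast+
  then have "coord2 (A.pt (cls z) (cls w)) = (\<lambda>(p, q). coord (cls z) p \<otimes>\<^bsub>K\<^esub> coord (cls w) q)"
    unfolding coord2_def by (rule AA.tensor_lift_pt[OF F_module coord_product_bilinear])
  then show ?thesis by (simp add: coord_cls assms)
qed

lemma F_finsum_apply:
  assumes "finite S" and "\<And>i. i \<in> S \<Longrightarrow> g i \<in> carrier F"
  shows "(\<Oplus>\<^bsub>F\<^esub>i\<in>S. g i) p = (\<Oplus>\<^bsub>K\<^esub>i\<in>S. g i p)"
proof -
  interpret F: Module.module K F by (rule F_module)
  show ?thesis
    using assms
  proof (induct S rule: finite_induct)
    case (insert i S)
    then have "(\<Oplus>\<^bsub>F\<^esub>i\<in>insert i S. g i) = g i \<oplus>\<^bsub>F\<^esub> (\<Oplus>\<^bsub>F\<^esub>i\<in>S. g i)"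
      by (intro F.finsum_insert) auto
    moreover have "g j p \<in> carrier K" if "j \<in> insert i S" for j
      using insert(4)[OF that] by (rule free_vs_val)
    then have "(\<Oplus>\<^bsub>K\<^esub>i\<in>insert i S. g i p) = g i p \<oplus>\<^bsub>K\<^esub> (\<Oplus>\<^bsub>K\<^esub>i\<in>S. g i p)"
      using insert(1,2) by (intro K.finsum_insert) auto
    ultimately show ?case using insert by simp
  qed simp
qed

section \<open>Products of path classes\<close>

lemma cls_pth_closed: "i \<in> {1..m} \<Longrightarrow> a \<le> b \<Longrightarrow> b \<le> t \<Longrightarrow> cls (pth i a b) \<in> carrier A"
  by (intro cls_closed pth_awalk)

lemma pth_trivial: "pth i a a = (vtx i a, [], vtx i a)"
  by (simp add: pth_def)

lemma cls_vertex_mult: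
  assumes "i \<in> {1..m}" "a \<le> b" "b \<le> t" and "k \<in> {1..m}" "c \<le> t"
  shows "cls (pth k c c) \<otimes>\<^bsub>A\<^esub> cls (pth i a b) = (if vtx k c = vtx i a then cls (pth i a b) else \<zero>\<^bsub>A\<^esub>)"
    and "cls (pth i a b) \<otimes>\<^bsub>A\<^esub> cls (pth k c c) = (if vtx k c = vtx i b then cls (pth i a b) else \<zero>\<^bsub>A\<^esub>)"
  using cls_mult[OF pth_awalk[OF assms(4) le_refl assms(5), unfolded pth_def] pth_awalk[OF assms(1-3), unfolded pth_def]]
    cls_mult[OF pth_awalk[OF assms(1-3), unfolded pth_def] pth_awalk[OF assms(4) le_refl assms(5), unfolded pth_def]]
  by (auto simp: pth_def simp del: upt_Suc)

text \<open>
  The product vanishes when the endpoints differ. When they agree at a junction that the two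
  paths enter and leave, the concatenation is crossing and it vanishes as well. The case
  \<open>a' = b' = t\<close> is that of the trivial path at the end of a block, for which the same formula holds.
\<close>

lemma cls_mult_after:
  assumes i: "i \<in> {1..m}" "a < b" "b \<le> t" and i': "i' \<in> {1..m}" "a' \<le> b'" "b' \<le> t"
    and "a' < b' \<or> a' = t"
  shows "cls (pth i a b) \<otimes>\<^bsub>A\<^esub> cls (pth i' a' b') = (if i = i' \<and> b = a' then cls (pth i a b') else \<zero>\<^bsub>A\<^esub>)"
proof (cases "a' = t")
  case True
  then have b': "b' = t" using i' by simp
  have "vtx i b = vtx i' t \<longleftrightarrow> i = i' \<and> b = t" using i by (intro vtx_end_eq[OF i(1) i'(1)]) auto
  then have "vtx i' t = vtx i b \<longleftrightarrow> i = i' \<and> b = t" by metis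
  then show ?thesis
    using cls_vertex_mult(2)[OF i(1) less_imp_le[OF i(2)] i(3) i'(1) le_refl] True b'
    by (cases "i = i' \<and> b = t") auto
next
  case False
  then have a': "a' < b'" using assms(7) by simp
  have prod: "cls (pth i a b) \<otimes>\<^bsub>A\<^esub> cls (pth i' a' b') =
      (if vtx i b = vtx i' a'
       then cls (vtx i a, map (Pair i) [Suc a..<Suc b] @ map (Pair i') [Suc a'..<Suc b'], vtx i' b')
       else \<zero>\<^bsub>A\<^esub>)"
    using cls_mult[OF pth_awalk[OF i(1) less_imp_le[OF i(2)] i(3), unfolded pth_def]
        pth_awalk[OF i', unfolded pth_def]]
    unfolding pth_def .
  have eq: "vtx i b = vtx i' a' \<longleftrightarrow> i = i' \<and> b = a' \<or> b = t \<and> a' = 0 \<and> i' = succ i"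
    using i i' a' by (intro vtx_end_eq_start) auto
  show ?thesis
  proof (cases "i = i' \<and> b = a'")
    case True
    then have "[Suc a..<Suc b] @ [Suc a'..<Suc b'] = [Suc a..<Suc b']"
      using i a' upt_add_eq_append[of "Suc a" "Suc b" "b' - b"] by simp
    then have "map (Pair i) [Suc a..<Suc b] @ map (Pair i') [Suc a'..<Suc b'] = map (Pair i) [Suc a..<Suc b']"
      using True by (simp only: map_append[symmetric])
    then show ?thesis using prod eq True by (simp add: pth_def del: upt_Suc)
  next
    case neq: False
    have "cls (pth i a b) \<otimes>\<^bsub>A\<^esub> cls (pth i' a' b') = \<zero>\<^bsub>A\<^esub>"
    proof (cases "vtx i b = vtx i' a'")
      case True
      then have j: "b = t" "a' = 0" "i' = succ i" using eq neq by auto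
      let ?p = "map (Pair i) [Suc a..<Suc b]" and ?q = "map (Pair i') [Suc a'..<Suc b']"
      have "awalk (vtx i a) ?p (vtx i b)" "awalk (vtx i b) ?q (vtx i' b')"
        using pth_awalk[OF i(1) less_imp_le[OF i(2)] i(3)] pth_awalk[OF i'] True
        by (simp_all add: pth_def quiver_paths_def del: upt_Suc)
      then have walk: "awalk (vtx i a) (?p @ ?q) (vtx i' b')" by (rule awalk_appendI)
      have "?p = map (Pair i) [Suc a..<t] @ [(i, t)]" using i j by simp
      moreover have "?q = (succ i, 1) # map (Pair i') [Suc (Suc 0)..<Suc b']"
        using pth_step[OF a'] j by (simp del: upt_Suc)
      ultimately have "?p @ ?q = map (Pair i) [Suc a..<t] @ [(i, t), (succ i, 1)] @
          map (Pair i') [Suc (Suc 0)..<Suc b']"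
        by (simp only: append.assoc append_Cons append_Nil)
      then have "crossing (?p @ ?q)" unfolding crossing_def using i(1) by blast
      from cls_crossing[OF walk this] show ?thesis unfolding prod using True by simp
    qed (simp add: prod)
    then show ?thesis unfolding if_not_P[OF neq] .
  qed
qed

text \<open>
  The mirror image, with the trivial path at the start of a block as the additional case.
\<close>

lemma cls_mult_before:
  assumes i: "i \<in> {1..m}" "a < b" "b \<le> t" and i': "i' \<in> {1..m}" "a' \<le> b'" "b' \<le> t"
    and "a' < b' \<or> b' = 0"
  shows "cls (pth i' a' b') \<otimes>\<^bsub>A\<^esub> cls (pth i a b) = (if i = i' \<and> b' = a then cls (pth i' a' b) else \<zero>\<^bsub>A\<^esub>)"
proof (cases "b' = 0")
  case True
  then have "a' = 0" using i' by simp
  with True show ?thesis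
    using cls_vertex_mult(1)[OF i(1) less_imp_le[OF i(2)] i(3) i'(1), of 0]
      vtx_start_eq[OF i(1) i'(1), of a] i
    by (cases "i = i' \<and> a = 0") auto
next
  case False
  then have "a' < b'" using assms(7) by simp
  then show ?thesis
    using cls_mult_after[OF i'(1) _ i'(3) i(1) less_imp_le[OF i(2)] i(3)] i(2) by auto
qed

section \<open>Commuting tensors\<close>

lemma pt_zero:
  assumes "x \<in> carrier A"
  shows "A.pt \<zero>\<^bsub>A\<^esub> x = \<zero>\<^bsub>A.AA\<^esub>" and "A.pt x \<zero>\<^bsub>A\<^esub> = \<zero>\<^bsub>A.AA\<^esub>"
  using lin_zero[OF A.A A.AA bilinear_mapD(1)[OF AA.pt_bilinear assms]]
    lin_zero[OF A.A A.AA bilinear_mapD(2)[OF AA.pt_bilinear assms]] by simp_all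

lemma commuting_tensorsI:
  assumes z: "z \<in> carrier A.AA"
    and vertex: "\<And>k c. k \<in> {1..m} \<Longrightarrow> c \<le> t \<Longrightarrow>
      A.act_left (cls (pth k c c)) z = A.act_right (cls (pth k c c)) z"
    and path: "\<And>k c d. k \<in> {1..m} \<Longrightarrow> c < d \<Longrightarrow> d \<le> t \<Longrightarrow>
      A.act_left (cls (pth k c d)) z = A.act_right (cls (pth k c d)) z"
  shows "z \<in> A.commuting_tensors"
proof (rule A.commuting_tensors_of_generators[OF _ cls_span z])
  show "cls ` block_paths \<subseteq> carrier A" using block_paths_subset cls_closed by blast
  fix s assume "s \<in> cls ` block_paths"
  then obtain k c d where "k \<in> {1..m}" "c \<le> d" "d \<le> t" "s = cls (pth k c d)"
    by (auto simp: block_paths_def)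
  then show "A.act_left s z = A.act_right s z"
    using vertex[of k c] path[of k c d] by (cases "c = d") auto
qed

text \<open>
  A nontrivial path \<open>x\<close> leaving a junction, tensored with a nontrivial path \<open>y\<close> entering it. Every
  nontrivial path kills \<open>x\<close> from the left and \<open>y\<close> from the right, and the trivial path at the
  junction fixes both, so the tensor commutes with the algebra.
\<close>

definition junction_tensor where
  "junction_tensor i a b = A.pt (cls (pth (succ i) 0 b)) (cls (pth i a t))"

lemma junction_tensor_commuting:
  assumes i: "i \<in> {1..m}" and a: "a < t" and b: "1 \<le> b" "b \<le> t"
  shows "junction_tensor i a b \<in> A.commuting_tensors"
proof (rule commuting_tensorsI)
  let ?x = "cls (pth (succ i) 0 b)" and ?y = "cls (pth i a t)"
  have x: "?x \<in> carrier A" and y: "?y \<in> carrier A"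
    using i a b succ_range[OF i] by (auto intro: cls_pth_closed)
  then show "junction_tensor i a b \<in> carrier A.AA" by (simp add: junction_tensor_def)
  fix k c assume k: "k \<in> {1..m}" "c \<le> t"
  then have "cls (pth k c c) \<in> carrier A" by (intro cls_pth_closed) auto
  then show "A.act_left (cls (pth k c c)) (junction_tensor i a b) =
      A.act_right (cls (pth k c c)) (junction_tensor i a b)"
    using cls_vertex_mult[OF succ_range[OF i] _ b(2) k, of 0] cls_vertex_mult[OF i less_imp_le[OF a] le_refl k]
      vtx_junction[OF i] x y
    by (simp add: junction_tensor_def A.act_left_pt A.act_right_pt pt_zero)
next
  let ?x = "cls (pth (succ i) 0 b)" and ?y = "cls (pth i a t)"
  have x: "?x \<in> carrier A" and y: "?y \<in> carrier A"
    using i a b succ_range[OF i] by (auto intro: cls_pth_closed)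
  fix k c d assume k: "k \<in> {1..m}" "c < d" "d \<le> t"
  then have "cls (pth k c d) \<in> carrier A" by (intro cls_pth_closed) auto
  moreover have "cls (pth k c d) \<otimes>\<^bsub>A\<^esub> ?x = \<zero>\<^bsub>A\<^esub>"
    using cls_mult_after[OF k succ_range[OF i] _ b(2), of 0] b k by simp
  moreover have "?y \<otimes>\<^bsub>A\<^esub> cls (pth k c d) = \<zero>\<^bsub>A\<^esub>"
    using cls_mult_after[OF i a le_refl k(1) less_imp_le[OF k(2)] k(3)] k by simp
  ultimately show "A.act_left (cls (pth k c d)) (junction_tensor i a b) =
      A.act_right (cls (pth k c d)) (junction_tensor i a b)"
    using x y by (simp add: junction_tensor_def A.act_left_pt A.act_right_pt pt_zero)
qed

text \<open>
  The sum of \<open>p\<^sub>j\<^sub>t \<otimes> p\<^sub>0\<^sub>j\<close> over the positions \<open>j\<close> of the first block, where \<open>p\<^sub>a\<^sub>b\<close> is the path from \<open>a\<close> to \<open>b\<close>.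
  Multiplication by \<open>p\<^sub>c\<^sub>d\<close> with \<open>c < d\<close> keeps only the summand \<open>j = d\<close> on the left and only \<open>j = c\<close> on
  the right, and both times the result is \<open>p\<^sub>c\<^sub>t \<otimes> p\<^sub>0\<^sub>d\<close>.
\<close>

definition block_tensor where
  "block_tensor = (\<Oplus>\<^bsub>A.AA\<^esub>j\<in>{..t}. A.pt (cls (pth 1 j t)) (cls (pth 1 0 j)))"

lemma block_factors_closed:
  assumes "j \<le> t"
  shows "cls (pth 1 j t) \<in> carrier A" and "cls (pth 1 0 j) \<in> carrier A"
  using assms m by (auto intro: cls_pth_closed)

lemma block_tensor_commuting: "block_tensor \<in> A.commuting_tensors"
proof (rule commuting_tensorsI)
  interpret T: Module.module K A.AA by (rule A.AA)
  have one: "1 \<in> {1..m}" using m by simp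
  let ?g = "\<lambda>j. A.pt (cls (pth 1 j t)) (cls (pth 1 0 j))"
  have g: "?g \<in> {..t} \<rightarrow> carrier A.AA" using block_factors_closed by (auto intro!: AA.pt_closed)
  then show "block_tensor \<in> carrier A.AA" unfolding block_tensor_def by (rule T.finsum_closed)
  have left: "A.act_left s block_tensor =
      (\<Oplus>\<^bsub>A.AA\<^esub>j\<in>{..t}. A.pt (s \<otimes>\<^bsub>A\<^esub> cls (pth 1 j t)) (cls (pth 1 0 j)))" if s: "s \<in> carrier A" for s
    unfolding block_tensor_def lin_finsum[OF A.AA A.AA A.act_left_linear[OF s] g]
    by (rule T.finsum_cong') (use s block_factors_closed in \<open>auto simp: A.act_left_pt intro!: AA.pt_closed\<close>)
  have right: "A.act_right s block_tensor =
      (\<Oplus>\<^bsub>A.AA\<^esub>j\<in>{..t}. A.pt (cls (pth 1 j t)) (cls (pth 1 0 j) \<otimes>\<^bsub>A\<^esub> s))" if s: "s \<in> carrier A" for s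
    unfolding block_tensor_def lin_finsum[OF A.AA A.AA A.act_right_linear[OF s] g]
    by (rule T.finsum_cong') (use s block_factors_closed in \<open>auto simp: A.act_right_pt intro!: AA.pt_closed\<close>)
  show "A.act_left (cls (pth k c c)) block_tensor = A.act_right (cls (pth k c c)) block_tensor"
    if k: "k \<in> {1..m}" "c \<le> t" for k c
  proof -
    have s: "cls (pth k c c) \<in> carrier A" using k by (intro cls_pth_closed) auto
    show ?thesis
      unfolding left[OF s] right[OF s]
    proof (rule T.finsum_cong')
      fix j assume "j \<in> {..t}"
      then have j: "j \<le> t" by simp
      show "A.pt (cls (pth k c c) \<otimes>\<^bsub>A\<^esub> cls (pth 1 j t)) (cls (pth 1 0 j)) =
          A.pt (cls (pth 1 j t)) (cls (pth 1 0 j) \<otimes>\<^bsub>A\<^esub> cls (pth k c c))"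
        using cls_vertex_mult(1)[OF one j le_refl k] cls_vertex_mult(2)[OF one le0 j k]
          block_factors_closed[OF j] by (simp add: pt_zero)
    qed (use s block_factors_closed in \<open>auto intro!: AA.pt_closed\<close>)
  qed
  show "A.act_left (cls (pth k c d)) block_tensor = A.act_right (cls (pth k c d)) block_tensor"
    if k: "k \<in> {1..m}" "c < d" "d \<le> t" for k c d
  proof -
    have s: "cls (pth k c d) \<in> carrier A" using k by (intro cls_pth_closed) auto
    let ?e = "if k = 1 then A.pt (cls (pth 1 c t)) (cls (pth 1 0 d)) else \<zero>\<^bsub>A.AA\<^esub>"
    have e: "?e \<in> carrier A.AA"
      using block_factors_closed[of c] block_factors_closed[of d] k by (auto intro!: AA.pt_closed)
    have "A.act_left (cls (pth k c d)) block_tensor = (\<Oplus>\<^bsub>A.AA\<^esub>j\<in>{..t}. if d = j then ?e else \<zero>\<^bsub>A.AA\<^esub>)"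
      unfolding left[OF s]
    proof (rule T.finsum_cong')
      fix j assume "j \<in> {..t}"
      then have j: "j \<le> t" by simp
      show "A.pt (cls (pth k c d) \<otimes>\<^bsub>A\<^esub> cls (pth 1 j t)) (cls (pth 1 0 j)) = (if d = j then ?e else \<zero>\<^bsub>A.AA\<^esub>)"
        using cls_mult_after[OF k one j le_refl j[unfolded le_less]]
          block_factors_closed[OF j] by (simp add: pt_zero)
    qed (use e in auto)
    also have "\<dots> = ?e" using k e by (subst T.finsum_singleton) auto
    also have "\<dots> = (\<Oplus>\<^bsub>A.AA\<^esub>j\<in>{..t}. if c = j then ?e else \<zero>\<^bsub>A.AA\<^esub>)"
      using k e by (subst T.finsum_singleton) auto
    also have "\<dots> = A.act_right (cls (pth k c d)) block_tensor"
      unfolding right[OF s]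
    proof (rule T.finsum_cong'[symmetric])
      fix j assume "j \<in> {..t}"
      then have j: "j \<le> t" by simp
      have "0 < j \<or> j = 0" by auto
      from cls_mult_before[OF k one le0 j this]
      show "A.pt (cls (pth 1 j t)) (cls (pth 1 0 j) \<otimes>\<^bsub>A\<^esub> cls (pth k c d)) = (if c = j then ?e else \<zero>\<^bsub>A.AA\<^esub>)"
        using block_factors_closed[OF j] by (cases "c = j") (simp_all add: pt_zero)
    qed (use e in auto)
    finally show ?thesis .
  qed
qed

section \<open>The two bounds\<close>

lemma pth_inj:
  assumes "pth i a b = pth i' a' b'" and "a < b" and "a' \<le> b'"
  shows "i = i' \<and> a = a' \<and> b = b'"
proof -
  have eq: "map (Pair i) [Suc a..<Suc b] = map (Pair i') [Suc a'..<Suc b']"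
    using assms(1) by (simp add: pth_def del: upt_Suc)
  from arg_cong[OF eq, of length] have len: "b - a = b' - a'" by (simp del: upt_Suc)
  then have "a' < b'" using assms by simp
  with eq assms(2) have "(i, Suc a) = (i', Suc a')"
    unfolding pth_step[OF assms(2)] pth_step[OF \<open>a' < b'\<close>] by simp
  then show ?thesis using len assms(2) \<open>a' < b'\<close> by auto
qed

lemma pth_eq_trivial: "pth i a b = pth i' a' a' \<Longrightarrow> b \<le> a"
  using arg_cong[of "pth i a b" "pth i' a' a'" "\<lambda>z. length (fst (snd z))"]
  by (simp add: pth_def del: upt_Suc)

lemma coord2_block_tensor:
  "coord2 block_tensor (p, q) =
    (\<Oplus>\<^bsub>K\<^esub>j\<in>{..t}. if p = pth 1 j t \<and> q = pth 1 0 j then \<one>\<^bsub>K\<^esub> else \<zero>\<^bsub>K\<^esub>)"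
proof -
  let ?g = "\<lambda>j. A.pt (cls (pth 1 j t)) (cls (pth 1 0 j))"
  have g: "?g \<in> {..t} \<rightarrow> carrier A.AA" using block_factors_closed by (auto intro!: AA.pt_closed)
  have "coord2 block_tensor (p, q) = (\<Oplus>\<^bsub>K\<^esub>j\<in>{..t}. coord2 (?g j) (p, q))"
    unfolding block_tensor_def lin_finsum[OF A.AA F_module coord2_linear g]
    using g by (intro F_finsum_apply lin_carrier[OF coord2_linear]) auto
  also have "\<dots> = (\<Oplus>\<^bsub>K\<^esub>j\<in>{..t}. if p = pth 1 j t \<and> q = pth 1 0 j then \<one>\<^bsub>K\<^esub> else \<zero>\<^bsub>K\<^esub>)"
  proof (rule K.finsum_cong')
    fix j assume "j \<in> {..t}"
    then show "coord2 (?g j) (p, q) = (if p = pth 1 j t \<and> q = pth 1 0 j then \<one>\<^bsub>K\<^esub> else \<zero>\<^bsub>K\<^esub>)"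
      using m by (intro coord2_pt block_pathsI) auto
  qed auto
  finally show ?thesis .
qed

text \<open>
  There are \<open>t\<^sup>2\<close> junction tensors for each of the \<open>m\<close> junctions, and the block tensor. Each junction
  tensor is a product of basis vectors of the algebra. The block tensor has a summand, \<open>j = 0\<close>, whose
  second factor is a trivial path, while no summand has two nontrivial factors and a first factor
  starting at a junction. Hence the coordinates \<open>p k\<close> separate these tensors.
\<close>

lemma frobdim_lower_bound: "m * t\<^sup>2 + 1 \<le> frobdim K A"
proof -
  define J where "J = {1..m} \<times> {..<t} \<times> {1..t}"
  \<comment> \<open>\<open>None\<close> stands for the block tensor.\<close>
  define z where "z k = (case k of None \<Rightarrow> block_tensor | Some (i, a, b) \<Rightarrow> junction_tensor i a b)" for k
  define p where "p k = (case k of None \<Rightarrow> (pth 1 0 t, pth 1 0 0)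
    | Some (i, a, b) \<Rightarrow> (pth (succ i) 0 b, pth i a t))" for k
  have "card (insert None (Some ` J)) \<le> frobdim K A"
  proof (rule A.card_le_frobdim[OF K.field_axioms _ _ cls_span _ _ coord2_linear, where z = z and p = p])
    have "block_paths \<subseteq> (\<lambda>(i, a, b). pth i a b) ` ({1..m} \<times> {..t} \<times> {..t})"
      by (force simp: block_paths_def)
    then have "finite block_paths" by (rule finite_subset) simp
    then show "finite (cls ` block_paths)" by simp
    show "cls ` block_paths \<subseteq> carrier A" using block_paths_subset cls_closed by blast
    show "finite (insert None (Some ` J))" by (simp add: J_def)
    show "z k \<in> A.commuting_tensors" if "k \<in> insert None (Some ` J)" for k
      using that block_tensor_commuting junction_tensor_commuting by (auto simp: z_def J_def)
    fix k l assume k: "k \<in> insert None (Some ` J)" and l: "l \<in> insert None (Some ` J)"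
    have junction: "coord2 (junction_tensor i a b) (x, y) =
        (if x = pth (succ i) 0 b \<and> y = pth i a t then \<one>\<^bsub>K\<^esub> else \<zero>\<^bsub>K\<^esub>)"
      if "(i, a, b) \<in> J" for i a b x y
      unfolding junction_tensor_def
      using that succ_range[of i] by (intro coord2_pt block_pathsI) (auto simp: J_def)
    show "coord2 (z k) (p l) = (if k = l then \<one>\<^bsub>K\<^esub> else \<zero>\<^bsub>K\<^esub>)"
    proof (cases k)
      case None
      show ?thesis
      proof (cases l)
        case None
        have "coord2 block_tensor (pth 1 0 t, pth 1 0 0) =
            (\<Oplus>\<^bsub>K\<^esub>j\<in>{..t}. if 0 = j then \<one>\<^bsub>K\<^esub> else \<zero>\<^bsub>K\<^esub>)"
          unfolding coord2_block_tensor
        proof (rule K.finsum_cong')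
          fix j assume "j \<in> {..t}"
          then show "(if pth 1 0 t = pth 1 j t \<and> pth 1 0 0 = pth 1 0 j then \<one>\<^bsub>K\<^esub> else \<zero>\<^bsub>K\<^esub>) =
              (if 0 = j then \<one>\<^bsub>K\<^esub> else \<zero>\<^bsub>K\<^esub>)"
            using pth_eq_trivial[of 1 0 j 1 0] by auto
        qed auto
        also have "\<dots> = \<one>\<^bsub>K\<^esub>" by (subst K.finsum_singleton) auto
        finally show ?thesis using \<open>k = None\<close> None by (simp add: z_def p_def)
      next
        case (Some l')
        then obtain i a b where l': "l = Some (i, a, b)" "(i, a, b) \<in> J" using l by auto
        then have iab: "a < t" "1 \<le> b" by (auto simp: J_def)
        have "coord2 block_tensor (pth (succ i) 0 b, pth i a t) = \<zero>\<^bsub>K\<^esub>"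
          unfolding coord2_block_tensor
        proof (rule K.add.finprod_one_eqI)
          fix j assume j: "j \<in> {..t}"
          have "\<not> (pth (succ i) 0 b = pth 1 j t \<and> pth i a t = pth 1 0 j)"
          proof
            assume *: "pth (succ i) 0 b = pth 1 j t \<and> pth i a t = pth 1 0 j"
            then have "0 = j" using pth_inj[of "succ i" 0 b 1 j t] iab j by auto
            with * show False using pth_eq_trivial[of i a t 1 0] iab by simp
          qed
          then show "(if pth (succ i) 0 b = pth 1 j t \<and> pth i a t = pth 1 0 j
              then \<one>\<^bsub>K\<^esub> else \<zero>\<^bsub>K\<^esub>) = \<zero>\<^bsub>K\<^esub>" by simp
        qed
        then show ?thesis using \<open>k = None\<close> l' by (simp add: z_def p_def)
      qed
    next
      case (Some k')
      then obtain i a b where k': "k = Some (i, a, b)" "(i, a, b) \<in> J" using k by auto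
      then have iab: "a < t" "1 \<le> b" by (auto simp: J_def)
      show ?thesis
      proof (cases l)
        case None
        have "pth 1 0 0 \<noteq> pth i a t" using pth_eq_trivial[of i a t 1 0] iab by auto
        then show ?thesis using None k' junction[OF k'(2)] by (simp add: z_def p_def)
      next
        case (Some l')
        then obtain i' a' b' where l': "l = Some (i', a', b')" "(i', a', b') \<in> J" using l by auto
        then have iab': "a' < t" "1 \<le> b'" by (auto simp: J_def)
        have "pth (succ i') 0 b' = pth (succ i) 0 b \<and> pth i' a' t = pth i a t \<longleftrightarrow> (i, a, b) = (i', a', b')"
          using pth_inj[of "succ i'" 0 b' "succ i" 0 b] pth_inj[of i' a' t i a t] iab iab' by auto
        then show ?thesis using k' l' junction[OF k'(2)] by (auto simp: z_def p_def)
      qed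
    qed
  qed
  moreover have "card (insert None (Some ` J)) = m * t\<^sup>2 + 1"
  proof -
    have "card J = m * (t * t)" by (simp add: J_def card_cartesian_product)
    moreover have "finite J" by (simp add: J_def)
    ultimately show ?thesis by (simp add: card_image power2_eq_square)
  qed
  ultimately show ?thesis by simp
qed

text \<open>
  Trivial paths correspond to the \<open>m t\<close> vertices, nontrivial block paths to a block together with
  a pair of positions \<open>a < b \<le> t\<close>. The factor \<open>2\<close> avoids the division in \<open>t (t + 1) / 2\<close>.
\<close>

lemma dim_upper_bound: "2 * vectorspace.dim K A \<le> m * (2 * t + t * (t + 1))"
proof -
  interpret V: vectorspace K A by (rule vectorspaceI[OF K.field_axioms A.A])
  let ?V = "(\<lambda>v. (v, [] :: (nat \<times> nat) list, v)) ` verts Q"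
  let ?N = "(\<lambda>(i, b, a). pth i a b) ` ({1..m} \<times> (SIGMA b:{..t}. {..<b}))"
  have "block_paths \<subseteq> ?V \<union> ?N"
  proof
    fix z assume "z \<in> block_paths"
    then obtain i a b where z: "i \<in> {1..m}" "a \<le> b" "b \<le> t" "z = pth i a b"
      by (auto simp: block_paths_def)
    show "z \<in> ?V \<union> ?N"
    proof (cases "a = b")
      case True
      then show ?thesis using z vtx_in_verts[of i b] by (auto simp: pth_trivial)
    next
      case False
      then have "(i, b, a) \<in> {1..m} \<times> (SIGMA b:{..t}. {..<b})" using z by auto
      then show ?thesis using z(4) by (intro UnI2 image_eqI[where x = "(i, b, a)"]) auto
    qed
  qed
  moreover have fin: "finite ?V" "finite ?N" by (simp_all add: verts_Q)
  ultimately have good: "finite block_paths" "card block_paths \<le> card (?V \<union> ?N)"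
    by (auto intro: finite_subset card_mono)
  have "V.dim \<le> card (cls ` block_paths)"
    using good block_paths_subset cls_closed cls_span by (intro V.gen_ge_dim) auto
  also have "\<dots> \<le> card block_paths" by (rule card_image_le[OF good(1)])
  also have "\<dots> \<le> card ?V + card ?N" by (rule order_trans[OF good(2) card_Un_le])
  also have "\<dots> \<le> m * t + m * (\<Sum>b\<le>t. b)"
  proof (rule add_mono)
    show "card ?V \<le> m * t" using card_image_le[of "verts Q" "\<lambda>v. (v, [], v)"] by (simp add: verts_Q)
    have "card ({1..m} \<times> (SIGMA b:{..t}. {..<b})) = m * (\<Sum>b\<le>t. b)"
      by (simp add: card_cartesian_product)
    then show "card ?N \<le> m * (\<Sum>b\<le>t. b)"
      by (metis (no_types, lifting) card_image_le finite_SigmaI finite_atLeastAtMost finite_atMost finite_lessThan)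
  qed
  finally have "V.dim \<le> m * t + m * (\<Sum>b\<le>t. b)" .
  moreover have "2 * (\<Sum>b\<le>t. b) = t * (t + 1)"
    by (induct t) auto
  ultimately have "2 * V.dim \<le> 2 * (m * t) + m * (t * (t + 1))"
    by (metis (no_types, lifting) add_mult_distrib2 mult.left_commute mult_le_mono2)
  then show ?thesis by (simp add: algebra_simps)
qed

end

theorem corollary4p11:
  fixes K :: "('k, 'r) ring_scheme" and m t :: nat and n :: "nat \<Rightarrow> nat"
  assumes "field K" and "m \<ge> 1" and "t \<ge> 3"
    and "\<And>i. i \<in> {1..m} \<Longrightarrow> n i = t"
  shows "frobdim K (cyc_algebra K m n) > vectorspace.dim K (cyc_algebra K m n)"
proof -
  interpret cyclic_gentle K m t n
    using assms by (intro cyclic_gentle.intro cyclic_gentle_axioms.intro) auto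
  have "2 * t + t * (t + 1) \<le> 2 * t\<^sup>2"
    using mult_le_mono2[OF assms(3), of t] by (simp add: power2_eq_square algebra_simps)
  then have "m * (2 * t + t * (t + 1)) \<le> 2 * (m * t\<^sup>2)"
    using mult_le_mono2[of "2 * t + t * (t + 1)" "2 * t\<^sup>2" m] by simp
  then show ?thesis using frobdim_lower_bound dim_upper_bound by linarith
qed

end
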